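(* Let $n\ge1$, $0<q\le1$, $t>0$, and let $\mathbf{T}_n(q,t)$ be the set of $(x_1,\dots,x_n)$ with $x_n\ge1-q$ and $qx_i\le q(1+t)x_{i-1}-t(1-q)(1-x_{j-1})$ for all $1\le j\le i\le n$ ($x_0:=1$). Let $F$ be a plane forest on $n+1$ nodes with $m$ components $T_1,\dots,T_m$ (left to right), $T_j$ having $a_j$ nodes, and $\mathbf{D}_F(q,t)=\mathbf{D}_{T_1}(t)\times\operatorname{cone}_q(\mathbf{D}_{T_2}(t)\times\operatorname{cone}_q(\mathbf{D}_{T_3}(t)\times\cdots\operatorname{cone}_q(\mathbf{D}_{T_m}(t))\cdots))$. Then $\mathbf{D}_F(q,t)$ is a bounded polytope and $$n!\operatorname{vol}\mathbf{D}_F(q,t)=\sum_{G:\ \Psi(G)=F}q^{k(G)-1}t^{|E(G)|}=\frac{\binom{n}{d_1,d_2,\dots}}{\prod_{j=2}^m(a_j+\dots+a_m)}\,q^{k(F)-1}t^{\sum_{i=1}^{n+1-m}d_i}(1+t)^{\binom{n+2-m}{2}-\sum_{i=1}^{n+1-m}i\,d_i},$$ the sum over labeled graphs $G$ on $\{1,\dots,n+1\}$, where $(d_1,\dots,d_{n+1-m})$ is the reduced degree sequence of $F$. Furthermore, the polytopes $\mathbf{D}_F(q,t)$, $F$ ranging over plane forests on $n+1$ nodes, form a subdivision of $\mathbf{T}_n(q,t)$; in particular $n!\operatorname{vol}\mathbf{T}_n(q,t)=\sum_G q^{k(G)-1}t^{|E(G)|}=\mathrm{Z}_{K_{n+1}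}(q,t)$.
   Context: $k(\cdot)$ = number of connected components, $E(\cdot)$ = edge set; $\mathrm{Z}_G(q,t)=\sum_H q^{k(H)-k(G)}t^{e(H)}$ over spanning subgraphs $H$ of $G$; $K_{n+1}$ is the complete graph on $\{1,\dots,n+1\}$. A plane tree is an unlabeled rooted tree with children ordered left to right; a plane forest is a left-to-right sequence of plane trees. Degree = number of children. Degree sequence of a plane tree: degrees in depth-first (preorder) traversal; of a forest: concatenation over components left to right; reduced degree sequence: delete the final $0$ of each component's degree sequence. $\binom{n}{d_1,d_2,\dots}:=n!/(d_1!d_2!\cdots)$. NFS positions in a forest on $N$ nodes: components processed left to right; when a component is begun its root gets the next unused position (starting from $0$); within a component the root is initially active, the children of the active node receive the next consecutive positions from right to left and then the leftmost child becomes active; if the active node has no children, the most recently positioned node not yet active becomes active. Cane path: a path $v_0,\dots,v_k$ ($k\ge2$) whose first $k-1$ steps go from a node to its parent and whose last step goes from $v_{k-1}$ to a child of $v_{k-1}$ to the right of $v_{k-2}$. For a plane tree $T$ on $a$ nodes, $\mathbf{D}_T(t)\subset\mathbb{R}^{a-1}$ is defined (with $x_0:=1$, positions $p(u)$ and cane counts $j(u)$ computed in $T$) by $1\le x_{p(u_1)}/(1+t)^{j(u_1)}\le\dots\le x_{p(u_k)}/(1+t)^{j(u_k)}\le 1+t$ for every node with children $u_1,\dots,u_k$ (left to right). For $\mathbf{P}\subset\mathbb{R}^d$, $\operatorname{cone}_q(\mathbf{P})=\{(x_0,\dots,x_d):1-q\le x_0\le1,\ q(x_1,\dots,x_d)\in(x_0-1+q)\mathbf{P}+(1-q)(1-x_0)\}$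 (adding a scalar adds it to each coordinate; $=[1-q,1]$ if $d=0$). If $m=1$, $\mathbf{D}_F(q,t)=\mathbf{D}_{T_1}(t)$. Labeled forests on $\{1,\dots,n+1\}$ are viewed as plane forests by rooting components at the largest label, ordering children by increasing label and components by decreasing largest label. NFS of a labeled graph $G$: components processed in order of decreasing maximal label; in a component, its node of maximal label is visited first and made active; at each step the unvisited neighbours of the active node are visited in decreasing order of label, each joined to the active node by a search edge, and the one of smallest label becomes active; if the active node has no unvisited neighbours, the most recently visited node not yet active becomes active. $\Psi(G)$ is the plane forest underlying the forest of search edges. A subdivision of a polytope $P$ is a finite set of full-dimensional polytopes with union $P$ and pairwise disjoint interiors. *)

theory Defs
  imports "HOL-Analysis.Analysis"
begin

section \<open>Plane trees and plane forests\<close>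

datatype ptree = Node (subtrees: "ptree list")

text \<open>A plane forest is a list of plane trees, from left to right.\<close>

type_synonym pforest = "ptree list"

primrec node_count :: "ptree \<Rightarrow> nat" where
  "node_count (Node ts) = Suc (sum_list (map node_count ts))"

definition plane_forests :: "nat \<Rightarrow> pforest set" where
  "plane_forests N = {F. sum_list (map node_count F) = N}"

primrec degree_seq :: "ptree \<Rightarrow> nat list" where
  "degree_seq (Node ts) = length ts # concat (map degree_seq ts)"

definition reduced_degree_seq :: "pforest \<Rightarrow> nat list" where
  "reduced_degree_seq F = concat (map (\<lambda>T. butlast (degree_seq T)) F)"

text \<open>
  A node of a plane tree is given by its address: \<open>[]\<close> is the root, and the children of \<open>u\<close> are
  \<open>u @ [0], u @ [1], \<dots>\<close> from left to right.
\<close>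

type_synonym node = "nat list"

primrec is_node :: "node \<Rightarrow> ptree \<Rightarrow> bool" where
  "is_node [] T \<longleftrightarrow> True"
| "is_node (i # u) T \<longleftrightarrow> i < length (subtrees T) \<and> is_node u (subtrees T ! i)"

primrec subtree_at :: "node \<Rightarrow> ptree \<Rightarrow> ptree" where
  "subtree_at [] T = T"
| "subtree_at (i # u) T = subtree_at u (subtrees T ! i)"

definition node_degree :: "ptree \<Rightarrow> node \<Rightarrow> nat" where
  "node_degree T u = length (subtrees (subtree_at u T))"

definition cane_path :: "ptree \<Rightarrow> node list \<Rightarrow> bool" where
  "cane_path T vs \<longleftrightarrow>
     (\<exists>k\<ge>2. length vs = k + 1 \<and> (\<forall>v\<in>set vs. is_node v T) \<and>
        (\<forall>i<k - 1. vs ! i \<noteq> [] \<and> vs ! (i + 1) = butlast (vs ! i)) \<and>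
        vs ! k \<noteq> [] \<and> butlast (vs ! k) = vs ! (k - 1) \<and>
        last (vs ! (k - 2)) < last (vs ! k))"

definition cane_count :: "ptree \<Rightarrow> node \<Rightarrow> nat" where
  "cane_count T u = card {vs. cane_path T vs \<and> hd vs = u}"

text \<open>
  The nodes of a plane tree in the order in which they receive their positions. The argument is the
  stack of the nodes that already have a position but have not been active (each with the subtree
  below it), most recently positioned first; its head becomes active. Since the leftmost child of an
  active node is positioned last among its siblings, ``the leftmost child becomes active'' and ``the
  most recently positioned node not yet active becomes active'' both select the head of the stack.
\<close>

lemma sum_list_sizes_less: "sum_list (map size ts) < size (Node ts)"
  by (induction ts) auto

function nfs_positioned :: "(node \<times> ptree) list \<Rightarrow> node list" where
  "nfs_positioned [] = []"
| "nfs_positioned ((u, Node ts) # st) =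
     (let new = map (\<lambda>i. (u @ [i], ts ! i)) [0..<length ts]
      in rev (map fst new) @ nfs_positioned (new @ st))"
  by pat_completeness auto
termination
proof (relation "Wellfounded.measure (\<lambda>st. sum_list (map (size \<circ> snd) st))", goal_cases)
  case (2 u ts st new)
  have "map (size \<circ> snd) new = map size (map ((!) ts) [0..<length ts])"
    by (simp add: 2 comp_def)
  then have "map (size \<circ> snd) new = map size ts"
    by (simp only: map_nth)
  then show ?case
    using sum_list_sizes_less[of ts] by simp
qed simp

definition nfs_order :: "ptree \<Rightarrow> node list" where
  "nfs_order T = [] # nfs_positioned [([], T)]"

definition nfs_position :: "ptree \<Rightarrow> node \<Rightarrow> nat" where
  "nfs_position T u = length (takeWhile (\<lambda>v. v \<noteq> u) (nfs_order T))"


section \<open>Labeled graphs\<close>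

text \<open>
  A graph on the vertex set \<open>V\<close> is given by its set of edges; an edge is a set of two vertices.
\<close>

type_synonym edges = "nat set set"

definition complete_edges :: "nat \<Rightarrow> edges" where
  "complete_edges N = {e. e \<subseteq> {1..N} \<and> card e = 2}"

definition labeled_graphs :: "nat \<Rightarrow> edges set" where
  "labeled_graphs N = Pow (complete_edges N)"

definition components_of_graph :: "nat set \<Rightarrow> edges \<Rightarrow> nat set set" where
  "components_of_graph V E = V // {(u, v). u \<in> V \<and> v \<in> V \<and> (u, v) \<in> {(x, y). {x, y} \<in> E}\<^sup>*}"

definition num_comps :: "nat set \<Rightarrow> edges \<Rightarrow> nat" where
  "num_comps V E = card (components_of_graph V E)"

definition Z_poly :: "nat set \<Rightarrow> edges \<Rightarrow> real \<Rightarrow> real \<Rightarrow> real" where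
  "Z_poly V E q t = (\<Sum>H\<in>Pow E. q ^ (num_comps V H - num_comps V E) * t ^ card H)"

text \<open>
  The search edges of a graph on \<open>{1..N}\<close>, where \<open>X\<close> is the set of visited nodes and the last
  argument is the stack of the visited nodes that have not been active, most recently visited first.
  As above, the head of the stack becomes active: neighbours are visited in decreasing order of
  label, so the one of smallest label comes first on the stack. When the stack is empty, the visited
  nodes form a union of components, so the largest unvisited label is the maximal label of the next
  component.
\<close>

function nfs_edges :: "nat \<Rightarrow> edges \<Rightarrow> nat set \<Rightarrow> nat list \<Rightarrow> edges" where
  "nfs_edges N E X [] =
     (if {1..N} - X = {} then {}
      else let r = Max ({1..N} - X) in nfs_edges N E (insert r X) [r])"
| "nfs_edges N E X (v # st) =
     (let new = {w \<in> {1..N} - X. {v, w} \<in> E}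
      in (\<lambda>w. {v, w}) ` new \<union> nfs_edges N E (X \<union> new) (sorted_list_of_set new @ st))"
  by pat_completeness auto
termination
proof (relation "measures [\<lambda>(N, E, X, st). card ({1..N} - X), \<lambda>(N, E, X, st). length st]", goal_cases)
  case (2 N E X r)
  have "r \<in> {1..N} - X"
    unfolding 2(2) using 2(1) by (intro Max_in) simp_all
  then have "{1..N} - insert r X \<subset> {1..N} - X"
    by blast
  then have "card ({1..N} - insert r X) < card ({1..N} - X)"
    by (intro psubset_card_mono finite_Diff finite_atLeastAtMost)
  then show ?case by simp
next
  case (3 N E X v st new)
  show ?case
  proof (cases "new = {}")
    case True
    then show ?thesis by simp
  next
    case False
    moreover have "new \<subseteq> {1..N} - X"
      unfolding 3 by blast
    ultimately have "{1..N} - (X \<union> new) \<subset> {1..N} - X"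
      by blast
    then have "card ({1..N} - (X \<union> new)) < card ({1..N} - X)"
      by (intro psubset_card_mono finite_Diff finite_atLeastAtMost)
    then show ?thesis by simp
  qed
qed simp

definition search_forest :: "nat \<Rightarrow> edges \<Rightarrow> edges" where
  "search_forest N E = nfs_edges N E {} []"

text \<open>
  The plane tree of a labeled tree below the node \<open>v\<close>, where \<open>X\<close> consists of all nodes except the
  proper ancestors of \<open>v\<close>. In a forest the only ancestor adjacent to \<open>v\<close> is its parent, so the
  neighbours of \<open>v\<close> in \<open>X - {v}\<close> are exactly its children. The conditional only serves to make the
  recursion terminate.
\<close>

function plane_tree_below :: "edges \<Rightarrow> nat set \<Rightarrow> nat \<Rightarrow> ptree" where
  "plane_tree_below S X v =
     (if finite X \<and> v \<in> X
      then Node (map (plane_tree_below S (X - {v}))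
                   (sorted_list_of_set {w \<in> X - {v}. {v, w} \<in> S}))
      else Node [])"
  by pat_completeness auto
termination
  by (relation "Wellfounded.measure (\<lambda>(S, X, v). card X)") (auto simp: card_Diff1_less simp del: card_Diff_insert)

declare plane_tree_below.simps [simp del]

definition plane_forest_of :: "nat \<Rightarrow> edges \<Rightarrow> pforest" where
  "plane_forest_of N S =
     map (plane_tree_below S {1..N})
       (rev (sorted_list_of_set (Max ` components_of_graph {1..N} S)))"

definition Psi :: "nat \<Rightarrow> edges \<Rightarrow> pforest" where
  "Psi N E = plane_forest_of N (search_forest N E)"


section \<open>The polytopes\<close>

text \<open>
  Since the recursive construction involves spaces of different dimensions, points of
  \<open>\<real>\<^sup>d\<close> are first represented by lists of length \<open>d\<close>. In \<open>tree_polytope\<close> and \<open>T_polytope\<close> the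
  list \<open>1 # xs\<close> accounts for the convention that \<open>x\<^sub>0 = 1\<close>.
\<close>

definition tree_polytope :: "real \<Rightarrow> ptree \<Rightarrow> real list set" where
  "tree_polytope t T =
     {xs. length xs = node_count T - 1 \<and>
        (\<forall>u. is_node u T \<and> node_degree T u > 0 \<longrightarrow>
           sorted ([1]
             @ map (\<lambda>i. (1 # xs) ! nfs_position T (u @ [i]) / (1 + t) ^ cane_count T (u @ [i]))
                 [0..<node_degree T u]
             @ [1 + t]))}"

definition cone_q :: "real \<Rightarrow> real list set \<Rightarrow> real list set" where
  "cone_q q P =
     {x\<^sub>0 # xs | x\<^sub>0 xs. 1 - q \<le> x\<^sub>0 \<and> x\<^sub>0 \<le> 1 \<and>
        map (\<lambda>x. q * x) xs \<in> map (\<lambda>y. (x\<^sub>0 - 1 + q) * y + (1 - q) * (1 - x\<^sub>0)) ` P}"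

text \<open>The value at the empty forest is irrelevant.\<close>

fun forest_polytope :: "real \<Rightarrow> real \<Rightarrow> pforest \<Rightarrow> real list set" where
  "forest_polytope q t [] = {}"
| "forest_polytope q t [T] = tree_polytope t T"
| "forest_polytope q t (T # T' # F) =
     {xs @ ys | xs ys. xs \<in> tree_polytope t T \<and> ys \<in> cone_q q (forest_polytope q t (T' # F))}"

definition T_polytope :: "nat \<Rightarrow> real \<Rightarrow> real \<Rightarrow> real list set" where
  "T_polytope n q t =
     {xs. length xs = n \<and> (let x = (\<lambda>i. (1 # xs) ! i) in
        1 - q \<le> x n \<and>
        (\<forall>i j. 1 \<le> j \<and> j \<le> i \<and> i \<le> n \<longrightarrow>
           q * x i \<le> q * (1 + t) * x (i - 1) - t * (1 - q) * (1 - x (j - 1))))}"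

text \<open>
  If \<open>e\<close> maps \<open>{1..n}\<close> bijectively onto the index type, then \<open>x $ e i\<close> is the \<open>i\<close>-th coordinate of
  \<open>x\<close>, and \<open>in_space n e\<close> turns a set of lists of length \<open>n\<close> into the corresponding subset of
  \<open>\<real>\<^sup>n\<close>.
\<close>

definition in_space :: "nat \<Rightarrow> (nat \<Rightarrow> 'n) \<Rightarrow> real list set \<Rightarrow> (real ^ 'n::finite) set" where
  "in_space n e P = {x. map (\<lambda>i. x $ e i) [1..<n + 1] \<in> P}"

definition subdivision :: "'a::euclidean_space set set \<Rightarrow> 'a set \<Rightarrow> bool" where
  "subdivision \<P> P \<longleftrightarrow>
     polytope P \<and> finite \<P> \<and>
     (\<forall>Q\<in>\<P>. polytope Q \<and> aff_dim Q = int DIM('a)) \<and>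
     \<Union>\<P> = P \<and>
     pairwise (\<lambda>Q R. interior Q \<inter> interior R = {}) \<P>"

end

theory Submission
  imports Defs
begin

text \<open>
  In the coordinates \<open>y = (x - (1 - q)) / q\<close> the \<open>q\<close>-cone becomes the linear cone over \<open>{1} \<times> P\<close>.
  Encode a plane forest by recording, for each position, either that its node is a root or the size
  \<open>h\<close> of the stack below it when it is positioned, which is its cane count. A point then lies in
  the polytope of the forest iff every root coordinate \<open>\<rho>\<close> is at most the previous one and every
  other coordinate, shifted to \<open>w = q y + (1 - q) \<rho>\<close>, lies in \<open>[(1 + t)\<^sup>h \<rho>, (1 + t)\<^sup>h\<^sup>+\<^sup>1 \<rho>]\<close> and
  is at most \<open>1 + t\<close> times its predecessor. Dropping the code, these conditions define the Tutte
  polytope; hence a point determines its code up to boundary hyperplanes, and the codes that occur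
  are exactly those of forests.

  The volume is an iterated integral: an active node with \<open>k\<close> children contributes
  \<open>(t / q)\<^sup>k / k!\<close> and powers of \<open>1 + t\<close>, a root divides by the number of remaining nodes. Revealing
  the edges of a random graph along the search gives the same recursion: edges from the active node
  to the stack are free, and its edges to unvisited nodes are exactly those to its children.
\<close>

section \<open>Codes of plane forests\<close>

text \<open>The bound by 1 + t times the predecessor has two sides. Between consecutive siblings it
  is the chain of inequalities of \<open>tree_polytope\<close>. At the first sibling of a run it
  follows from the intervals, because a run starts at a height at most that of the preceding entry,
  a root counting as height 0. Read from the point, the same bound lets the height grow by at most
  one per step and forces it to be 0 after a root, which is the condition that characterises codes.

  For fixed \<open>i\<close>, the inequalities of the Tutte polytope for all \<open>j\<close> amount
  to the one with the smallest earlier coordinate. The roots are the running minima of the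
  coordinates, so that coordinate is the current root \<rho>; collecting the terms in \<rho> gives
  w.

  Volume and graph count both earn a factor 1 + t for every node and every stack entry below it: the
  volume when the node is positioned, the graph count when it becomes active. In the middle of a
  search they therefore differ by a power of 1 + t whose exponent is the number of pairs of stack
  entries.\<close>

abbreviation forest_size :: "pforest \<Rightarrow> nat" where
  "forest_size F \<equiv> sum_list (map node_count F)"

text \<open>
  \<open>st\<close> is the stack of the current component, most recently positioned tree first, and \<open>F\<close> the
  components not yet begun; so the code of a forest \<open>T # F\<close> is \<open>forest_code [T] F\<close>, whose entries
  belong to the positions \<open>1, \<dots>, n\<close>. A root is coded by \<open>None\<close>, any other node by the size of the
  stack below it.
\<close>

function forest_code :: "pforest \<Rightarrow> pforest \<Rightarrow> nat option list" where
  "forest_code [] [] = []"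
| "forest_code [] (T # F) = None # forest_code [T] F"
| "forest_code (Node ts # st) F =
     map Some [length st..<length st + length ts] @ forest_code (ts @ st) F"
  by pat_completeness auto
termination
  by (relation "measures [\<lambda>(st, F). forest_size st + forest_size F, \<lambda>(st, F). length F]") auto

lemma node_count_pos [simp]: "0 < node_count T"
  by (cases T) simp

lemma length_forest_code: "length (forest_code st F) + length st = forest_size st + forest_size F"
  by (induction st F rule: forest_code.induct) auto

text \<open>A component is finished before the next one begins. This separates the coordinates of
  the first tree from those of the cone.\<close>

lemma forest_code_split: "forest_code st F = forest_code st [] @ forest_code [] F"
proof (induction st "[] :: pforest" rule: forest_code.induct)
  case (3 ts st)
  then show ?case by simp
qed auto

lemma None_notin_forest_code: "None \<notin> set (forest_code st [])"
  by (induction st "[] :: pforest" rule: forest_code.induct) auto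

text \<open>\<open>l\<close> bounds the next entry: an entry exceeds its predecessor by at most one,
  and the first entry after a root is 0 unless it is a root itself. The code of a forest starts
  right after its first root, hence with bound 0.\<close>

primrec valid_code :: "nat \<Rightarrow> nat option list \<Rightarrow> bool" where
  "valid_code l [] \<longleftrightarrow> True"
| "valid_code l (x # c) \<longleftrightarrow>
     (case x of None \<Rightarrow> valid_code 0 c | Some h \<Rightarrow> h \<le> l \<and> valid_code (Suc h) c)"

lemma valid_code_run:
  "valid_code l (map Some [h..<h + k] @ c) \<longleftrightarrow>
     (if k = 0 then valid_code l c else h \<le> l \<and> valid_code (h + k) c)"
proof (induction k arbitrary: h l)
  case (Suc k)
  show ?case
    using Suc[of "Suc h" "Suc h"] by (simp add: upt_conv_Cons del: upt_Suc)
qed simp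

text \<open>Popping the active node from a stack of size s starts its run at height s - 1 \<le>
  \<open>l\<close>, and afterwards the stack again has at most one entry more than the bound. The
  assumption is an inequality because a leaf leaves the stack without producing an entry.\<close>

lemma valid_forest_code: "length st \<le> Suc l \<Longrightarrow> valid_code l (forest_code st F)"
  by (induction st F arbitrary: l rule: forest_code.induct) (auto simp: valid_code_run)

text \<open>The active node leaves the stack before its children are counted, and childless nodes
  passed on the way only shrink the stack further.\<close>

lemma forest_code_Some_less: "forest_code st F = Some h # c \<Longrightarrow> h < length st"
proof (induction st F rule: forest_code.induct)
  case (3 ts st F)
  then show ?case
    by (cases ts) (auto simp: upt_conv_Cons simp del: upt_Suc)
qed auto

text \<open>A run cannot be continued by accident: after \<open>k\<close> siblings the stack has
  size \<open>s + k\<close>, whereas a longer run would need the entry \<open>s + k\<close>, which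
  is not below that size.\<close>

lemma forest_code_run_less:
  assumes "k < k'"
    and eq: "map Some [s..<s + k] @ forest_code st F = map Some [s..<s + k'] @ c"
    and len: "length st = s + k"
  shows False
proof -
  have "[s..<s + k'] = [s..<s + k] @ [s + k..<s + k']"
    using assms(1) upt_add_eq_append[of s "s + k" "k' - k"] by simp
  moreover have "[s + k..<s + k'] = (s + k) # [Suc (s + k)..<s + k']"
    using assms(1) by (simp add: upt_conv_Cons)
  ultimately have "forest_code st F = Some (s + k) # map Some [Suc (s + k)..<s + k'] @ c"
    using eq by simp
  from forest_code_Some_less[OF this] len show False by simp
qed

text \<open>A code can be parsed from left to right. The stack size fixes the height at which the
  next run starts, and \<open>forest_code_run_less\<close> fixes where it ends, so the degree of the
  active node is recovered, zero included.\<close>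

lemma forest_code_inject:
  "forest_code st F = forest_code st' F' \<Longrightarrow> length st = length st' \<Longrightarrow> st = st' \<and> F = F'"
proof (induction st F arbitrary: st' F' rule: forest_code.induct)
  case 1
  then show ?case by (cases F') auto
next
  case (2 T F)
  from 2(2,3) obtain T' G where "F' = T' # G" "st' = []"
    by (cases F') auto
  with 2(1)[of "[T']" G] 2(2) show ?case by simp
next
  case (3 ts st F)
  obtain ts' st1 where st': "st' = Node ts' # st1"
    using 3(3) by (metis length_Suc_conv ptree.exhaust)
  have len: "length st1 = length st" using 3(3) st' by simp
  have eq: "map Some [length st..<length st + length ts] @ forest_code (ts @ st) F =
        map Some [length st..<length st + length ts'] @ forest_code (ts' @ st1) F'"
    using 3(2) st' len by simp
  have k: "length ts = length ts'"
    using forest_code_run_less[OF _ eq] forest_code_run_less[OF _ eq[symmetric]] len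
    by (metis add.commute length_append nat_neq_iff)
  from eq k have "forest_code (ts @ st) F = forest_code (ts' @ st1) F'" by simp
  from 3(1)[OF this] len k have "ts @ st = ts' @ st1 \<and> F = F'" by simp
  with k st' show ?case by simp
qed

text \<open>Leaves pad a stack to a prescribed size without changing its code.\<close>

lemma forest_code_leaves: "forest_code (replicate l (Node []) @ st) F = forest_code st F"
  by (induction l) auto

text \<open>
  The siblings positioned next belong to the same active node as the last positioned node, so they
  are decoded separately from the stack below them.
\<close>

lemma valid_code_decode:
  "valid_code l c \<Longrightarrow> \<exists>us st F. length st = l \<and>
     c = map Some [l..<l + length us] @ forest_code (us @ st) F"
proof (induction c arbitrary: l)
  case Nil
  show ?case
    by (rule exI[of _ "[]"], rule exI[of _ "replicate l (Node [])"], rule exI[of _ "[]"])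
       (use forest_code_leaves[of l "[]"] in simp)
next
  case (Cons x c)
  show ?case
  proof (cases x)
    case None
    with Cons obtain us F where c: "c = map Some [0..<length us] @ forest_code us F"
      by fastforce
    show ?thesis
      by (rule exI[of _ "[]"], rule exI[of _ "replicate l (Node [])"], rule exI[of _ "Node us # F"])
         (use forest_code_leaves[of l "[]"] None c in simp)
  next
    case (Some h)
    with Cons.prems have h: "h \<le> l" "valid_code (Suc h) c" by auto
    from Cons.IH[OF h(2)] obtain us st F where st: "length st = Suc h"
      and c: "c = map Some [Suc h..<Suc h + length us] @ forest_code (us @ st) F" by blast
    \<comment> \<open>The top of the decoded stack is the node of the entry \<open>Some h\<close>.
      Siblings are positioned from right to left, so it stands to the right of the siblings
      \<open>us\<close> positioned after it.\<close>
    from st obtain T st' where T: "st = T # st'" "length st' = h" by (cases st) auto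
    have xc: "x # c = map Some [h..<h + length (us @ [T])] @ forest_code ((us @ [T]) @ st') F"
      using c Some T by (simp add: upt_conv_Cons del: upt_Suc)
    show ?thesis
    proof (cases "h = l")
      case True
      then show ?thesis using xc T(2) by blast
    next
      case False
      \<comment> \<open>The run at \<open>l\<close> is empty. The parent of the new siblings waits
        on the stack at height \<open>h\<close>, below \<open>l - Suc h\<close> leaves, which
        produce no entries.\<close>
      let ?st = "replicate (l - Suc h) (Node []) @ Node (us @ [T]) # st'"
      have "x # c = map Some [l..<l + length []] @ forest_code ([] @ ?st) F"
        using xc T(2) forest_code_leaves by simp
      moreover have "length ?st = l" using h False T(2) by simp
      ultimately show ?thesis by blast
    qed
  qed
qed

text \<open>The siblings left over at bound 0 are the children of the first root, which has no entry
  of its own.\<close>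

lemma valid_code_forest:
  assumes "valid_code 0 c"
  shows "\<exists>T F. T # F \<in> plane_forests (Suc (length c)) \<and> forest_code [T] F = c"
proof -
  from valid_code_decode[OF assms] obtain us F
    where c: "c = map Some [0..<length us] @ forest_code us F" by auto
  then have "forest_code [Node us] F = c" by simp
  moreover from this have "Node us # F \<in> plane_forests (Suc (length c))"
    using length_forest_code[of "[Node us]" F] by (simp add: plane_forests_def)
  ultimately show ?thesis by blast
qed

text \<open>The subtrees of the first tree form a forest with fewer nodes, so a nonempty forest
  splits into two smaller ones.\<close>

lemma finite_plane_forests: "finite (plane_forests N)"
proof (induction N rule: less_induct)
  case (less N)
  have "plane_forests N \<subseteq>
      {[]} \<union> (\<Union>i<N. (\<lambda>(ts, F). Node ts # F) ` (plane_forests i \<times> plane_forests (N - Suc i)))"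
  proof
    fix F assume F: "F \<in> plane_forests N"
    show "F \<in> {[]} \<union> (\<Union>i<N. (\<lambda>(ts, F). Node ts # F) ` (plane_forests i \<times> plane_forests (N - Suc i)))"
    proof (cases F)
      case (Cons T F')
      obtain ts where T: "T = Node ts" by (cases T)
      have "forest_size ts < N" "(ts, F') \<in> plane_forests (forest_size ts) \<times> plane_forests (N - Suc (forest_size ts))"
        using F Cons T by (auto simp: plane_forests_def)
      then show ?thesis using Cons T by force
    qed simp
  qed
  moreover have "finite (\<Union>i<N. (\<lambda>(ts, F). Node ts # F) ` (plane_forests i \<times> plane_forests (N - Suc i)))"
    using less by auto
  ultimately show ?case using finite_subset by blast
qed

section \<open>Cells\<close>

locale tutte_parameters =
  fixes q t :: real
  assumes q_pos: "0 < q" and q_le_1: "q \<le> 1" and t_pos: "0 < t"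
begin

text \<open>The quantity w of the overview. For \<rho> = 1 it is the original coordinate x.\<close>

definition level :: "real \<Rightarrow> real \<Rightarrow> real" where
  "level \<rho> y = q * y + (1 - q) * \<rho>"

lemma level_self [simp]: "level \<rho> \<rho> = \<rho>"
  by (simp add: level_def algebra_simps)

lemma level_le_iff: "level \<rho> x \<le> level \<rho> y \<longleftrightarrow> x \<le> y"
  using q_pos by (simp add: level_def)

lemma level_scale: "level (s * \<rho>) (s * y) = s * level \<rho> y"
  by (simp add: level_def algebra_simps)

text \<open>
  The cell of a code, in the coordinates \<open>y = (x - (1 - q)) / q\<close>, in which \<open>cone_q\<close> becomes the
  linear cone over \<open>{1} \<times> P\<close>. Here \<open>\<rho>\<close> is the coordinate of the current root and \<open>z\<close> the preceding
  coordinate.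
\<close>

fun cell :: "real \<Rightarrow> real \<Rightarrow> nat option list \<Rightarrow> real list \<Rightarrow> bool" where
  "cell \<rho> z [] [] \<longleftrightarrow> True"
| "cell \<rho> z (None # c) (y # ys) \<longleftrightarrow> 0 \<le> y \<and> y \<le> \<rho> \<and> cell y y c ys"
| "cell \<rho> z (Some h # c) (y # ys) \<longleftrightarrow>
     (1 + t) ^ h * \<rho> \<le> level \<rho> y \<and> level \<rho> y \<le> (1 + t) ^ Suc h * \<rho> \<and>
     level \<rho> y \<le> (1 + t) * level \<rho> z \<and> cell \<rho> y c ys"
| "cell \<rho> z _ _ \<longleftrightarrow> False"

lemma cell_length: "cell \<rho> z c ys \<Longrightarrow> length ys = length c"
  by (induction \<rho> z c ys rule: cell.induct) auto

lemma cell_Nil [simp]: "cell \<rho> z [] ys \<longleftrightarrow> ys = []"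
  by (cases ys) auto

text \<open>Behind a root only its own coordinate matters, both as current root and as predecessor.
  This is the product structure of \<open>forest_polytope\<close>.\<close>

lemma cell_append_root:
  "None \<notin> set c \<Longrightarrow> length xs = length c \<Longrightarrow>
     cell \<rho> z (c @ None # c') (xs @ y # ys) \<longleftrightarrow> cell \<rho> z c xs \<and> 0 \<le> y \<and> y \<le> \<rho> \<and> cell y y c' ys"
proof (induction c arbitrary: z xs)
  case (Cons a c)
  then show ?case by (cases xs; cases a) auto
qed auto

text \<open>All conditions are homogeneous in \<rho>, \<open>z\<close> and the coordinates together.
  Hence the linear cone over a cell at \<rho> = 1 consists of its copies at all root
  coordinates.\<close>

lemma cell_scale:
  assumes "0 < s"
  shows "cell (s * \<rho>) (s * z) c (map ((*) s) ys) \<longleftrightarrow> cell \<rho> z c ys"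
proof (induction \<rho> z c ys rule: cell.induct)
  case (2 \<rho> z c y ys)
  then show ?case using assms by (simp add: zero_le_mult_iff)
next
  case (3 \<rho> z h c y ys)
  have "(1 + t) ^ k * (s * \<rho>) = s * ((1 + t) ^ k * \<rho>)" for k by simp
  moreover have "(1 + t) * (s * w) = s * ((1 + t) * w)" for w by simp
  ultimately show ?case using 3 assms by (simp only: cell.simps level_scale list.map mult_le_cancel_left_pos)
qed auto

text \<open>The apex of the cone, where \<open>cell_scale\<close> does not apply.\<close>

lemma cell_zero: "cell 0 0 c ys \<longleftrightarrow> ys = replicate (length c) 0"
proof (induction c arbitrary: ys)
  case (Cons a c)
  show ?case
  proof (cases ys)
    case (Cons y ys')
    have "level 0 y \<le> 0 \<and> 0 \<le> level 0 y \<longleftrightarrow> y = 0"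
      using q_pos by (auto simp: level_def mult_le_0_iff zero_le_mult_iff)
    moreover have "level 0 0 = 0" by simp
    ultimately show ?thesis using Cons Cons.IH[of ys'] by (cases a) auto
  qed auto
qed simp

lemma power_mult_mono: "0 \<le> \<rho> \<Longrightarrow> h \<le> l \<Longrightarrow> (1 + t) ^ h * \<rho> \<le> (1 + t) ^ l * \<rho>"
  using t_pos by (simp add: mult_right_mono power_increasing)

text \<open>A point is built greedily, with each root equal to the preceding root and every other
  coordinate at its lower bound. It is needed at the apex: the multiple 0 of an empty cell would be
  empty.\<close>

lemma cell_nonempty:
  "valid_code l c \<Longrightarrow> 0 \<le> \<rho> \<Longrightarrow> (1 + t) ^ l * \<rho> \<le> (1 + t) * level \<rho> z \<Longrightarrow> \<exists>ys. cell \<rho> z c ys"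
proof (induction c arbitrary: l \<rho> z)
  case (Cons a c)
  show ?case
  proof (cases a)
    case None
    have "\<rho> \<le> (1 + t) * \<rho>" using Cons.prems(2) t_pos by (simp add: algebra_simps)
    then obtain ys where "cell \<rho> \<rho> c ys"
      using Cons.IH[of 0 \<rho> \<rho>] Cons.prems None by auto
    then have "cell \<rho> z (a # c) (\<rho> # ys)" using None Cons.prems by simp
    then show ?thesis ..
  next
    case (Some h)
    define y where "y = ((1 + t) ^ h * \<rho> - (1 - q) * \<rho>) / q"
    have y: "level \<rho> y = (1 + t) ^ h * \<rho>"
      using q_pos by (simp add: level_def y_def)
    obtain ys where ys: "cell \<rho> y c ys"
      using Cons.IH[of "Suc h" \<rho> y] Cons.prems Some y by auto
    have "(1 + t) ^ h * \<rho> \<le> (1 + t) ^ l * \<rho>"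
      using Cons.prems Some by (intro power_mult_mono) auto
    then have "cell \<rho> z (a # c) (y # ys)"
      using Some y ys Cons.prems power_mult_mono[of \<rho> h "Suc h"] by auto
    then show ?thesis ..
  qed
qed auto

text \<open>\<open>p\<close> is the preceding coordinate and \<open>m\<close> the minimum of all
  earlier ones; since t (1 - q) \<ge> 0, the inequalities for all j reduce to the one with
  \<open>m\<close>.\<close>

primrec tutte_region :: "real \<Rightarrow> real \<Rightarrow> real list \<Rightarrow> bool" where
  "tutte_region p m [] \<longleftrightarrow> True"
| "tutte_region p m (y # ys) \<longleftrightarrow>
     0 \<le> y \<and> q * y \<le> q * (1 + t) * p + t * (1 - q) * m \<and> tutte_region y (min m y) ys"

lemma level_step: "level \<rho> y \<le> (1 + t) * level \<rho> z \<longleftrightarrow> q * y \<le> q * (1 + t) * z + t * (1 - q) * \<rho>"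
  by (simp add: level_def algebra_simps)

lemma level_ge_root: "\<rho> \<le> level \<rho> y \<longleftrightarrow> \<rho> \<le> y"
  using level_le_iff[of \<rho> \<rho> y] by simp

text \<open>The current root is always the running minimum: a new root is at most \<rho>, and a
  non-root has level at least \<rho>. For a root, the inequality of the region is not among the
  conditions of the cell; it follows from y \<le> \<rho> \<le> z.\<close>

lemma cell_imp_tutte_region:
  "cell \<rho> z c ys \<Longrightarrow> 0 \<le> \<rho> \<Longrightarrow> \<rho> \<le> z \<Longrightarrow> tutte_region z \<rho> ys"
proof (induction \<rho> z c ys rule: cell.induct)
  case (2 \<rho> z c y ys)
  have "level \<rho> y \<le> (1 + t) * level \<rho> z"
  proof -
    have "level \<rho> y \<le> \<rho>" using 2 level_le_iff[of \<rho> y \<rho>] by simp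
    also have "\<dots> \<le> level \<rho> z" using 2 level_ge_root by simp
    also have "\<dots> \<le> (1 + t) * level \<rho> z"
      using t_pos 2(3) \<open>\<rho> \<le> level \<rho> z\<close> by (simp add: algebra_simps)
    finally show ?thesis .
  qed
  then show ?case using 2 by (simp add: level_step min_absorb2)
next
  case (3 \<rho> z h c y ys)
  have "\<rho> \<le> y"
    using 3 power_mult_mono[of \<rho> 0 h] level_ge_root[of \<rho> y] by simp
  then show ?case using 3 by (simp add: level_step min_absorb1)
qed auto

lemma exists_height:
  assumes "\<rho> \<le> w" "w \<le> (1 + t) ^ Suc l * \<rho>"
  shows "\<exists>h\<le>l. (1 + t) ^ h * \<rho> \<le> w \<and> w \<le> (1 + t) ^ Suc h * \<rho>"
  using assms
proof (induction l)
  case (Suc l)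
  show ?case
  proof (cases "w \<le> (1 + t) ^ Suc l * \<rho>")
    case True
    with Suc show ?thesis by (meson le_SucI)
  next
    case False
    with Suc show ?thesis by (intro exI[of _ "Suc l"]) auto
  qed
qed simp

text \<open>The code is read off the point: a coordinate not above the running minimum is a root,
  and otherwise its level selects an interval. The predecessor bound keeps the level below
  \<open>(1 + t) ^ Suc l * \<rho>\<close>, so a height of at most \<open>l\<close> can be
  chosen.\<close>

lemma tutte_region_imp_cell:
  "tutte_region z \<rho> ys \<Longrightarrow> \<rho> \<le> z \<Longrightarrow> level \<rho> z \<le> (1 + t) ^ l * \<rho> \<Longrightarrow>
     \<exists>c. valid_code l c \<and> cell \<rho> z c ys"
proof (induction ys arbitrary: \<rho> z l)
  case Nil
  have "valid_code l []" "cell \<rho> z [] []" by simp_all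
  then show ?case by blast
next
  case (Cons y ys)
  show ?case
  proof (cases "y \<le> \<rho>")
    case True
    with Cons obtain c where "valid_code 0 c" "cell y y c ys"
      by (force simp: min_absorb2)
    then have "valid_code l (None # c)" "cell \<rho> z (None # c) (y # ys)"
      using True Cons.prems by auto
    then show ?thesis by blast
  next
    case False
    have le: "level \<rho> y \<le> (1 + t) * level \<rho> z"
      using Cons.prems by (simp add: level_step)
    also have "\<dots> \<le> (1 + t) * ((1 + t) ^ l * \<rho>)"
      using Cons.prems t_pos by (intro mult_left_mono) auto
    finally obtain h where h: "h \<le> l" "(1 + t) ^ h * \<rho> \<le> level \<rho> y" "level \<rho> y \<le> (1 + t) ^ Suc h * \<rho>"
      using exists_height[of \<rho> "level \<rho> y" l] False level_ge_root[of \<rho> y] by auto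
    obtain c where "valid_code (Suc h) c" "cell \<rho> y c ys"
      using Cons.IH[of y \<rho> "Suc h"] Cons.prems False h by (auto simp: min_absorb1)
    then have "valid_code l (Some h # c)" "cell \<rho> z (Some h # c) (y # ys)"
      using h le by auto
    then show ?thesis by blast
  qed
qed

text \<open>At the first difference of the codes the two conditions meet only in a boundary, which
  makes the coordinate \<open>p\<close> a fixed multiple of the current root coordinate. The index
  \<open>j\<close> says where that root stands in \<open>\<rho> # ys\<close>, and neither it nor
  \<open>K\<close> depends on the point.\<close>

lemma cell_inter_hyperplane:
  "c \<noteq> c' \<Longrightarrow> length c = length c' \<Longrightarrow>
     \<exists>p<length c. \<exists>j\<le>p. \<exists>K. \<forall>\<rho> z ys.
       0 \<le> \<rho> \<longrightarrow> cell \<rho> z c ys \<longrightarrow> cell \<rho> z c' ys \<longrightarrow> ys ! p = K * (\<rho> # ys) ! j"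
proof (induction c arbitrary: c')
  case (Cons a c)
  then obtain a' c1 where c': "c' = a' # c1" by (cases c') auto
  have heads: "?case" if K: "\<And>\<rho> z y ys. 0 \<le> \<rho> \<Longrightarrow> cell \<rho> z (a # c) (y # ys) \<Longrightarrow>
      cell \<rho> z (a' # c1) (y # ys) \<Longrightarrow> y = K * \<rho>" for K
  proof (intro exI[of _ "0::nat"] exI[of _ K] conjI allI impI)
    fix \<rho> z ys assume "0 \<le> \<rho>" "cell \<rho> z (a # c) ys" "cell \<rho> z c' ys"
    then show "ys ! 0 = K * (\<rho> # ys) ! 0" using K c' by (cases ys) auto
  qed simp_all
  have tails: "?case" if "a = a'"
  proof -
    have "c \<noteq> c1" "length c = length c1" using Cons.prems c' that by auto
    from Cons.IH[OF this] obtain p j K where pj: "p < length c" "j \<le> p" and *: "\<And>\<rho> z ys.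
       0 \<le> \<rho> \<Longrightarrow> cell \<rho> z c ys \<Longrightarrow> cell \<rho> z c1 ys \<Longrightarrow> ys ! p = K * (\<rho> # ys) ! j"
      by blast
    \<comment> \<open>After a root the tail starts from \<open>y\<close>, so every index shifts by
      one; otherwise the tail starts from \<rho> itself, and index 0 stays.\<close>
    let ?j = "if a \<noteq> None \<and> j = 0 then 0 else Suc j"
    have "ys ! Suc p = K * (\<rho> # ys) ! ?j"
      if "0 \<le> \<rho>" "cell \<rho> z (a # c) ys" "cell \<rho> z c' ys" for \<rho> z ys
    proof (cases ys)
      case (Cons y ys')
      then show ?thesis using that c' \<open>a = a'\<close> *[of y y ys'] *[of \<rho> y ys']
        by (cases a; cases j) auto
    qed (use that in \<open>cases a; auto\<close>)
    then show ?thesis using pj by (intro exI[of _ "Suc p"] conjI exI[of _ ?j] exI[of _ K]) auto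
  qed
  have root: "y = \<rho>"
    if "0 \<le> \<rho>" "cell \<rho> z (None # d) (y # ys)" "cell \<rho> z (Some h # d') (y # ys)"
    for \<rho> z y ys h d d'
    using that power_mult_mono[of \<rho> 0 h] level_ge_root[of \<rho> y] by auto
  \<comment> \<open>The upper end of the lower interval and the lower end of the higher one squeeze
    the level to \<open>(1 + t) ^ Suc h * \<rho>\<close>; the factor solves this for
    \<open>y\<close>.\<close>
  have kids: "y = ((1 + t) ^ Suc h - (1 - q)) / q * \<rho>"
    if "h < h'" "0 \<le> \<rho>" "cell \<rho> z (Some h # d) (y # ys)" "cell \<rho> z (Some h' # d') (y # ys)"
    for \<rho> z y ys h h' d d'
  proof -
    have "level \<rho> y = (1 + t) ^ Suc h * \<rho>"
      using that power_mult_mono[of \<rho> "Suc h" h'] by auto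
    then show ?thesis using q_pos by (simp add: level_def field_simps)
  qed
  consider "a = a'" | h where "a = None" "a' = Some h" | h where "a = Some h" "a' = None"
    | h h' where "a = Some h" "a' = Some h'" "h < h'" | h h' where "a = Some h" "a' = Some h'" "h' < h"
    by (cases a; cases a') (auto, use nat_neq_iff in blast)
  then show ?case
  proof cases
    case 1
    then show ?thesis by (rule tails)
  next
    case 2
    then show ?thesis using root by (intro heads[of 1]) auto
  next
    case 3
    then show ?thesis using root by (intro heads[of 1]) auto
  next
    case 4
    show ?thesis by (rule heads) (use kids[OF 4(3)] 4 in blast)
  next
    case 5
    show ?thesis by (rule heads) (use kids[OF 5(3)] 5 in blast)
  qed
qed simp

end

section \<open>Cane paths and positions\<close>

lemma is_node_append: "is_node (u @ v) T \<longleftrightarrow> is_node u T \<and> is_node v (subtree_at u T)"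
  by (induction u arbitrary: T) auto

lemma subtree_at_append: "subtree_at (u @ v) T = subtree_at v (subtree_at u T)"
  by (induction u arbitrary: T) auto

lemma is_node_snoc: "is_node (u @ [i]) T \<longleftrightarrow> is_node u T \<and> i < node_degree T u"
  by (simp add: is_node_append node_degree_def)

lemma is_node_take: "is_node u T \<Longrightarrow> is_node (take l u) T"
  by (metis append_take_drop_id is_node_append)

text \<open>Normal form of a cane path: it is determined by the depth \<open>l\<close> of the
  ancestor at which it turns and the index \<open>i\<close> of the child it ends in.\<close>

definition cane :: "node \<Rightarrow> nat \<Rightarrow> nat \<Rightarrow> node list" where
  "cane u l i = map (\<lambda>j. take (length u - j) u) [0..<Suc (length u - l)] @ [take l u @ [i]]"

lemma cane_path_cane:
  assumes "is_node u T" "l < length u" "u ! l < i" "i < node_degree T (take l u)"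
  shows "cane_path T (cane u l i)"
proof -
  \<comment> \<open>The number of steps: \<open>length u - l\<close> upwards and one
    downwards.\<close>
  define k where "k = Suc (length u - l)"
  have len: "length (cane u l i) = k + 1"
    by (simp add: cane_def k_def)
  have nth: "cane u l i ! j = take (length u - j) u" if "j < k" for j
    using that by (simp add: cane_def k_def nth_append del: upt_Suc)
  have nthk: "cane u l i ! k = take l u @ [i]"
    by (simp add: cane_def k_def nth_append)
  have k1: "length u - (k - 1) = l" "length u - (k - 2) = Suc l"
    using assms(2) by (auto simp: k_def)
  show ?thesis
    unfolding cane_path_def
  proof (intro exI[of _ k] conjI ballI allI impI)
    show "2 \<le> k" using assms(2) by (simp add: k_def)
    show "length (cane u l i) = k + 1" by (rule len)
    fix v assume "v \<in> set (cane u l i)"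
    then show "is_node v T"
      using assms is_node_take by (auto simp: cane_def is_node_snoc)
  next
    fix j assume j: "j < k - 1"
    then have "j < length u" using assms(2) by (simp add: k_def)
    then show "cane u l i ! j \<noteq> []" using j nth[of j] by auto
    show "cane u l i ! (j + 1) = butlast (cane u l i ! j)"
      using j nth[of j] nth[of "j + 1"] by (simp add: butlast_take)
  next
    show "cane u l i ! k \<noteq> []" using nthk by simp
    show "butlast (cane u l i ! k) = cane u l i ! (k - 1)"
      using nthk nth[of "k - 1"] k1 by (simp add: k_def)
    have "last (take (Suc l) u) = u ! l"
      using assms(2) by (simp add: take_Suc_conv_app_nth)
    then show "last (cane u l i ! (k - 2)) < last (cane u l i ! k)"
      using nthk nth[of "k - 2"] k1 assms(3) by (simp add: k_def)
  qed
qed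

lemma cane_path_imp_cane:
  assumes "cane_path T vs"
  shows "\<exists>l<length (hd vs). \<exists>i>hd vs ! l. i < node_degree T (take l (hd vs)) \<and> vs = cane (hd vs) l i"
proof -
  from assms obtain k where k: "k \<ge> 2" "length vs = k + 1" "\<forall>v\<in>set vs. is_node v T"
    and step: "\<And>i. i < k - 1 \<Longrightarrow> vs ! i \<noteq> [] \<and> vs ! (i + 1) = butlast (vs ! i)"
    and last: "vs ! k \<noteq> []" "butlast (vs ! k) = vs ! (k - 1)" "last (vs ! (k - 2)) < last (vs ! k)"
    unfolding cane_path_def by blast
  define u where "u = hd vs"
  have u: "vs ! 0 = u" using k by (cases vs) (auto simp: u_def)
  have nth: "j \<le> k - 1 \<Longrightarrow> j \<le> length u \<and> vs ! j = take (length u - j) u" for j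
  proof (induction j)
    case (Suc j)
    then have "vs ! j \<noteq> []" "vs ! (j + 1) = butlast (vs ! j)" "vs ! j = take (length u - j) u" "j \<le> length u"
      using step[of j] by auto
    moreover from this have "j < length u" by auto
    ultimately show ?case by (simp add: butlast_take)
  qed (simp add: u)
  define l where "l = length u - (k - 1)"
  have l: "l < length u" "Suc (length u - l) = k" "length u - (k - 2) = Suc l"
    using nth[of "k - 1"] k by (auto simp: l_def)
  define i where "i = last (vs ! k)"
  have vk: "vs ! k = take l u @ [i]"
    using append_butlast_last_id[OF last(1)] last(2) nth[of "k - 1"] by (simp add: i_def l_def)
  have "last (take (Suc l) u) = u ! l"
    using l by (simp add: take_Suc_conv_app_nth)
  then have "u ! l < i" using last(3) nth[of "k - 2"] l by (simp add: i_def)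
  moreover have "is_node (vs ! k) T" using k by simp
  then have "i < node_degree T (take l u)" using vk by (simp add: is_node_snoc)
  moreover have "vs = cane u l i"
  proof (rule nth_equalityI)
    show "length vs = length (cane u l i)" using k l by (simp add: cane_def)
    fix j assume "j < length vs"
    then consider "j < k" | "j = k" using k by linarith
    then show "vs ! j = cane u l i ! j"
    proof cases
      case 1
      then show ?thesis using nth[of j] l by (simp add: cane_def nth_append del: upt_Suc)
    next
      case 2
      then show ?thesis using vk l by (simp add: cane_def nth_append)
    qed
  qed
  ultimately show ?thesis using l(1) unfolding u_def by blast
qed

text \<open>Cane paths from \<open>u\<close> correspond to pairs of a turning depth \<open>l\<close>
  and a child index larger than \<open>u ! l\<close>, so each ancestor contributes the number of its
  children to the right of the path.\<close>

lemma cane_count_eq: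
  assumes "is_node u T"
  shows "cane_count T u = (\<Sum>l<length u. node_degree T (take l u) - Suc (u ! l))"
proof -
  let ?I = "SIGMA l:{..<length u}. {u ! l<..<node_degree T (take l u)}"
  have hd: "hd (cane u l i) = u" for l i
    by (simp add: cane_def hd_append hd_map del: upt_Suc)
  have "{vs. cane_path T vs \<and> hd vs = u} = (\<lambda>(l, i). cane u l i) ` ?I"
  proof
    show "{vs. cane_path T vs \<and> hd vs = u} \<subseteq> (\<lambda>(l, i). cane u l i) ` ?I"
    proof
      fix vs assume "vs \<in> {vs. cane_path T vs \<and> hd vs = u}"
      then obtain l i where "l < length u" "u ! l < i" "i < node_degree T (take l u)" "vs = cane u l i"
        using cane_path_imp_cane[of T vs] by auto
      then show "vs \<in> (\<lambda>(l, i). cane u l i) ` ?I" by force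
    qed
    show "(\<lambda>(l, i). cane u l i) ` ?I \<subseteq> {vs. cane_path T vs \<and> hd vs = u}"
      using cane_path_cane[OF assms] hd by auto
  qed
  moreover have "inj_on (\<lambda>(l, i). cane u l i) ?I"
  proof (rule inj_onI, clarsimp)
    fix l i l' i' assume "l < length u" "l' < length u" and eq: "cane u l i = cane u l' i'"
    from eq have "take l u @ [i] = take l' u @ [i']"
      by (metis cane_def last_snoc)
    then have "i = i'" "take l u = take l' u" by auto
    moreover from this(2) have "l = l'"
      using \<open>l < length u\<close> \<open>l' < length u\<close> by (metis length_take min.absorb4)
    ultimately show "l = l' \<and> i = i'" by simp
  qed
  ultimately show ?thesis
    by (simp add: cane_count_def card_image)
qed

lemma cane_count_Nil [simp]: "cane_count T [] = 0"
  by (simp add: cane_count_eq)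

text \<open>This is the growth of the stack: below a new child lie its right siblings and everything
  that was below its parent.\<close>

lemma cane_count_snoc:
  assumes "is_node (u @ [i]) T"
  shows "cane_count T (u @ [i]) = cane_count T u + (node_degree T u - Suc i)"
proof -
  have "is_node u T" using assms by (simp add: is_node_snoc)
  then show ?thesis
    using assms by (simp add: cane_count_eq nth_append)
qed

lemma length_nfs_positioned:
  "length (nfs_positioned st) + length st = sum_list (map (node_count \<circ> snd) st)"
proof (induction st rule: nfs_positioned.induct)
  case (2 u ts st)
  have "map (node_count \<circ> snd) (map (\<lambda>i. (u @ [i], ts ! i)) [0..<length ts]) = map node_count (map ((!) ts) [0..<length ts])"
    by (simp add: comp_def)
  also have "\<dots> = map node_count ts" by (simp only: map_nth)
  finally have "sum_list (map (node_count \<circ> snd) (map (\<lambda>i. (u @ [i], ts ! i)) [0..<length ts])) = forest_size ts"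
    by simp
  then show ?case using 2[OF refl] by (simp add: Let_def comp_def)
qed simp

text \<open>
  A stack of addressed subtrees reached in the positioning of \<open>T\<close>, where \<open>pre\<close> lists the nodes
  positioned so far: the nodes below a stack entry are not positioned yet, and the cane count of an
  entry is the number of entries below it.
\<close>

definition nfs_stack :: "ptree \<Rightarrow> node list \<Rightarrow> (node \<times> ptree) list \<Rightarrow> bool" where
  "nfs_stack T pre st \<longleftrightarrow>
     (\<forall>(u, S)\<in>set st. is_node u T \<and> subtree_at u T = S \<and> (\<forall>i w. u @ i # w \<notin> set pre)) \<and>
     (\<forall>j<length st. cane_count T (fst (st ! j)) + Suc j = length st) \<and>
     sorted_wrt (\<lambda>x y. (\<forall>w. fst x @ w \<noteq> fst y) \<and> (\<forall>w. fst y @ w \<noteq> fst x)) st"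

text \<open>Addresses on the stack are pairwise incomparable as prefixes. This passes to the
  children of the active node and keeps everything strictly below a waiting node unpositioned. The
  cane counts match by \<open>cane_count_snoc\<close>.\<close>

lemma nfs_stack_step:
  fixes u ts
  defines "new \<equiv> map (\<lambda>i. (u @ [i], ts ! i)) [0..<length ts]"
  assumes "nfs_stack T pre ((u, Node ts) # st)"
  shows "nfs_stack T (pre @ rev (map fst new)) (new @ st)"
proof -
  have u: "is_node u T" "subtree_at u T = Node ts" "\<And>i w. u @ i # w \<notin> set pre" "cane_count T u = length st"
    and st: "\<And>v S. (v, S) \<in> set st \<Longrightarrow> is_node v T \<and> subtree_at v T = S \<and> (\<forall>i w. v @ i # w \<notin> set pre)"
    and anti: "\<And>v S w. (v, S) \<in> set st \<Longrightarrow> u @ w \<noteq> v \<and> v @ w \<noteq> u"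
    and sorted: "sorted_wrt (\<lambda>x y. (\<forall>w. fst x @ w \<noteq> fst y) \<and> (\<forall>w. fst y @ w \<noteq> fst x)) st"
    using assms(2) by (force simp: nfs_stack_def)+
  have cst: "cane_count T (fst (st ! j)) + Suc j = length st" if "j < length st" for j
    using assms(2) that unfolding nfs_stack_def by (auto dest!: spec[of _ "Suc j"])
  have deg: "node_degree T u = length ts" using u by (simp add: node_degree_def)
  have anti': "u @ [i] \<noteq> v @ w" "u @ i # w \<noteq> v" if v: "(v, S) \<in> set st" for i v S w
  proof -
    show "u @ [i] \<noteq> v @ w"
      using anti[OF v, of "[i]"] anti[OF v, of "butlast w"] by (cases w rule: rev_cases) auto
    show "u @ i # w \<noteq> v" using anti[OF v, of "i # w"] by simp
  qed
  have 1: "is_node v T \<and> subtree_at v T = S \<and> (\<forall>i w. v @ i # w \<notin> set (pre @ rev (map fst new)))"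
    if vS: "(v, S) \<in> set (new @ st)" for v S
  proof (cases "(v, S) \<in> set st")
    case True
    have "v @ i # w \<notin> set (map fst new)" for i w
      using anti'(1)[OF True, of _ "i # w"] by (auto simp: new_def dest: sym)
    then show ?thesis using st[OF True] by simp
  next
    case False
    then obtain i where i: "v = u @ [i]" "S = ts ! i" "i < length ts"
      using vS by (auto simp: new_def)
    then show ?thesis
      using u deg by (auto simp: is_node_snoc subtree_at_append new_def)
  qed
  have 2: "cane_count T (fst ((new @ st) ! j)) + Suc j = length (new @ st)" if "j < length (new @ st)" for j
  proof (cases "j < length ts")
    case True
    then have "is_node (u @ [j]) T" using u deg by (simp add: is_node_snoc)
    then show ?thesis
      using True u deg cane_count_snoc[of u j T] by (simp add: new_def nth_append)
  next
    case False
    moreover from this that have "cane_count T (fst (st ! (j - length ts))) + Suc (j - length ts) = length st"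
      by (intro cst) (simp add: new_def)
    ultimately show ?thesis by (simp add: new_def nth_append)
  qed
  have 3: "sorted_wrt (\<lambda>x y. (\<forall>w. fst x @ w \<noteq> fst y) \<and> (\<forall>w. fst y @ w \<noteq> fst x)) (new @ st)"
    unfolding sorted_wrt_append
  proof (intro conjI)
    show "sorted_wrt (\<lambda>x y. (\<forall>w. fst x @ w \<noteq> fst y) \<and> (\<forall>w. fst y @ w \<noteq> fst x)) new"
      by (auto simp: new_def sorted_wrt_iff_nth_less)
    show "\<forall>x\<in>set new. \<forall>y\<in>set st. (\<forall>w. fst x @ w \<noteq> fst y) \<and> (\<forall>w. fst y @ w \<noteq> fst x)"
    proof (intro ballI)
      fix x y assume "x \<in> set new" and y: "y \<in> set st"
      then obtain i where i: "fst x = u @ [i]" by (auto simp: new_def)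
      from y have "(fst y, snd y) \<in> set st" by simp
      then show "(\<forall>w. fst x @ w \<noteq> fst y) \<and> (\<forall>w. fst y @ w \<noteq> fst x)"
        using anti'(1)[of "fst y" "snd y" i] anti'(2)[of "fst y" "snd y" i] i by (metis append_Cons append_Nil append_assoc)
    qed
  qed (rule sorted)
  show ?thesis
    unfolding nfs_stack_def using 1 2 3 by blast
qed

lemma takeWhile_neq_append: "x \<notin> set xs \<Longrightarrow> takeWhile (\<lambda>v. v \<noteq> x) (xs @ x # ys) = xs"
  by (induction xs) auto

text \<open>Children are listed in reverse, so \<open>length ts - Suc i\<close> siblings come before
  child \<open>i\<close>; \<open>nfs_stack\<close> ensures that the child does not occur
  earlier.\<close>

lemma nfs_position_child:
  assumes ord: "nfs_order T = pre @ nfs_positioned ((u, Node ts) # st)"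
    and ok: "nfs_stack T pre ((u, Node ts) # st)" and i: "i < length ts"
  shows "nfs_position T (u @ [i]) = length pre + (length ts - Suc i)"
proof -
  have "[0..<length ts] = [0..<i] @ i # [Suc i..<length ts]"
    using i upt_add_eq_append[of 0 i "length ts - i"] by (simp add: upt_conv_Cons)
  then have split: "rev (map (\<lambda>j. u @ [j]) [0..<length ts]) =
      rev (map (\<lambda>j. u @ [j]) [Suc i..<length ts]) @ (u @ [i]) # rev (map (\<lambda>j. u @ [j]) [0..<i])"
    by simp
  have fsts: "map fst (map (\<lambda>i. (u @ [i], ts ! i)) [0..<length ts]) = map (\<lambda>j. u @ [j]) [0..<length ts]"
    by simp
  have ord': "nfs_order T = (pre @ rev (map (\<lambda>j. u @ [j]) [Suc i..<length ts])) @ (u @ [i]) #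
      rev (map (\<lambda>j. u @ [j]) [0..<i]) @ nfs_positioned (map (\<lambda>i. (u @ [i], ts ! i)) [0..<length ts] @ st)"
    unfolding ord nfs_positioned.simps Let_def fsts split by simp
  have notin: "u @ [i] \<notin> set (pre @ rev (map (\<lambda>j. u @ [j]) [Suc i..<length ts]))"
    using ok by (auto simp: nfs_stack_def)
  have "takeWhile (\<lambda>v. v \<noteq> u @ [i]) (nfs_order T) = pre @ rev (map (\<lambda>j. u @ [j]) [Suc i..<length ts])"
    unfolding ord' by (rule takeWhile_neq_append[OF notin])
  then show ?thesis by (simp add: nfs_position_def)
qed

section \<open>Forest polytopes as cells\<close>

definition child_ineqs :: "real \<Rightarrow> ptree \<Rightarrow> real list \<Rightarrow> node \<Rightarrow> bool" where
  "child_ineqs t T X u \<longleftrightarrow> sorted ([1]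
     @ map (\<lambda>i. X ! nfs_position T (u @ [i]) / (1 + t) ^ cane_count T (u @ [i])) [0..<node_degree T u]
     @ [1 + t])"

lemma sorted_snoc_iff: "sorted (xs @ [a, b]) \<longleftrightarrow> sorted (xs @ [a]) \<and> a \<le> (b :: 'a :: linorder)"
  by (auto simp: sorted_append)

section \<open>Tree and forest polytopes in the shifted coordinates\<close>

context tutte_parameters
begin

definition to_cell :: "real \<Rightarrow> real" where
  "to_cell x = (x - (1 - q)) / q"

lemma level_to_cell [simp]: "level 1 (to_cell x) = x"
  using q_pos by (simp add: level_def to_cell_def)

text \<open>\<open>b\<close> is the tighter of the two upper bounds on the first sibling, in units
  of \<open>(1 + t) ^ h\<close>. Behind a sibling \<open>x\<close> the predecessor bound is the
  tighter one, since \<open>x\<close> respects its own interval, so the next \<open>b\<close> is the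
  ratio of \<open>x\<close>. The ratios thus decrease in order of position, which is the chain from
  left to right read backwards.\<close>

lemma cell_run:
  assumes "b * (1 + t) ^ h = min ((1 + t) ^ Suc h) ((1 + t) * z)" "1 \<le> b"
  shows "cell 1 (to_cell z) (map Some [h..<h + length zs] @ c) (map to_cell (zs @ xs)) \<longleftrightarrow>
    sorted (1 # rev (map (\<lambda>j. zs ! j / (1 + t) ^ (h + j)) [0..<length zs]) @ [b]) \<and>
    cell 1 (to_cell (last (z # zs))) c (map to_cell xs)"
  using assms
proof (induction zs arbitrary: h b z)
  case (Cons x zs)
  let ?b = "x / (1 + t) ^ h"
  have pos: "0 < (1 + t) ^ h" using t_pos by simp
  have up: "?b \<le> b \<longleftrightarrow> x \<le> (1 + t) ^ Suc h \<and> x \<le> (1 + t) * z"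
    using Cons.prems(1) pos by (simp add: pos_divide_le_eq del: power_Suc)
  have low: "1 \<le> ?b \<longleftrightarrow> (1 + t) ^ h \<le> x"
    using pos by (simp add: pos_le_divide_eq)
  have L: "map (\<lambda>j. (x # zs) ! j / (1 + t) ^ (h + j)) [0..<length (x # zs)] =
      ?b # map (\<lambda>j. zs ! j / (1 + t) ^ (Suc h + j)) [0..<length zs]"
    by (simp add: upt_conv_Cons map_Suc_upt[symmetric] del: upt_Suc power_Suc)
  define R where "R = rev (map (\<lambda>j. zs ! j / (1 + t) ^ (Suc h + j)) [0..<length zs])"
  have "sorted (1 # rev (map (\<lambda>j. (x # zs) ! j / (1 + t) ^ (h + j)) [0..<length (x # zs)]) @ [b]) \<longleftrightarrow>
      sorted ((1 # R) @ [?b, b])"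
    unfolding L R_def by simp
  also have "\<dots> \<longleftrightarrow> sorted ((1 # R) @ [?b]) \<and> ?b \<le> b" by (rule sorted_snoc_iff)
  also have "\<dots> \<longleftrightarrow> 1 \<le> ?b \<and> ?b \<le> b \<and> sorted (1 # R @ [?b])" by auto
  finally have S: "sorted (1 # rev (map (\<lambda>j. (x # zs) ! j / (1 + t) ^ (h + j)) [0..<length (x # zs)]) @ [b]) \<longleftrightarrow>
      1 \<le> ?b \<and> ?b \<le> b \<and> sorted (1 # R @ [?b])" .
  have C: "cell 1 (to_cell z) (map Some [h..<h + length (x # zs)] @ c) (map to_cell ((x # zs) @ xs)) \<longleftrightarrow>
      1 \<le> ?b \<and> ?b \<le> b \<and>
      cell 1 (to_cell x) (map Some [Suc h..<Suc h + length zs] @ c) (map to_cell (zs @ xs))"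
    unfolding low up by (simp add: upt_conv_Cons del: upt_Suc power_Suc)
  show ?case
  proof (cases "1 \<le> ?b \<and> ?b \<le> b")
    case True
    then have "x \<le> (1 + t) ^ Suc h" using up by blast
    then have "?b * (1 + t) ^ Suc h = min ((1 + t) ^ Suc (Suc h)) ((1 + t) * x)"
      using pos t_pos by (simp add: min_absorb2)
    from Cons.IH[OF this] True show ?thesis unfolding C S by (simp add: R_def)
  next
    case False
    then show ?thesis unfolding C S by blast
  qed
qed simp

text \<open>The child with index \<open>j\<close> in order of position has cane count
  \<open>length st + j\<close>, by the invariant of the stack; the reversal accounts for positions
  running from right to left.\<close>

lemma child_ineqs_iff:
  assumes ord: "nfs_order T = pre @ nfs_positioned ((u, Node ts) # st)"
    and ok: "nfs_stack T pre ((u, Node ts) # st)"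
    and X: "length pre = length X" "length zs = length ts"
  shows "child_ineqs t T (X @ zs @ xs) u \<longleftrightarrow>
    sorted (1 # rev (map (\<lambda>j. zs ! j / (1 + t) ^ (length st + j)) [0..<length zs]) @ [1 + t])"
proof -
  have u: "is_node u T" "node_degree T u = length ts" "cane_count T u = length st"
    using ok by (force simp: nfs_stack_def node_degree_def)+
  have "map (\<lambda>i. (X @ zs @ xs) ! nfs_position T (u @ [i]) / (1 + t) ^ cane_count T (u @ [i])) [0..<length ts] =
      rev (map (\<lambda>j. zs ! j / (1 + t) ^ (length st + j)) [0..<length zs])"
  proof (rule nth_equalityI)
    fix i assume "i < length (map (\<lambda>i. (X @ zs @ xs) ! nfs_position T (u @ [i]) / (1 + t) ^ cane_count T (u @ [i])) [0..<length ts])"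
    then have i: "i < length ts" by simp
    then have "cane_count T (u @ [i]) = length st + (length ts - Suc i)"
      using cane_count_snoc[of u i T] u by (simp add: is_node_snoc)
    moreover have "(X @ zs @ xs) ! nfs_position T (u @ [i]) = zs ! (length ts - Suc i)"
    proof -
      define k where "k = length ts - Suc i"
      have "nfs_position T (u @ [i]) = length X + k" "k < length zs"
        using i X nfs_position_child[OF ord ok i] by (simp_all add: k_def)
      then show ?thesis by (simp add: nth_append k_def[symmetric])
    qed
    moreover have "rev (map (\<lambda>j. zs ! j / (1 + t) ^ (length st + j)) [0..<length zs]) ! i =
        zs ! (length ts - Suc i) / (1 + t) ^ (length st + (length ts - Suc i))"
    proof -
      have "length ts - Suc i < length ts" using i by simp
      then show ?thesis using X i by (subst rev_nth) simp_all
    qed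
    ultimately show "map (\<lambda>i. (X @ zs @ xs) ! nfs_position T (u @ [i]) / (1 + t) ^ cane_count T (u @ [i])) [0..<length ts] ! i =
        rev (map (\<lambda>j. zs ! j / (1 + t) ^ (length st + j)) [0..<length zs]) ! i"
      using i by simp
  qed (simp add: X)
  then show ?thesis using u by (simp add: child_ineqs_def)
qed

text \<open>\<open>X\<close> holds the coordinates of the nodes positioned so far. The last
  assumption bounds the preceding coordinate below by (1 + t)^h, where h is the height at which the
  next run starts. Then the predecessor bound at the first sibling is no stronger than its interval,
  and the chain ends in the constant 1 + t.\<close>

lemma tree_cell_stack:
  assumes "nfs_order T = pre @ nfs_positioned st" "nfs_stack T pre st"
    and "length pre = length X" "length xs = length (nfs_positioned st)" "X \<noteq> []"
    and "st \<noteq> [] \<Longrightarrow> (1 + t) ^ (length st - 1) \<le> last X"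
  shows "(\<forall>(u, S)\<in>set st. \<forall>w. is_node w S \<and> node_degree S w > 0 \<longrightarrow> child_ineqs t T (X @ xs) (u @ w)) \<longleftrightarrow>
    cell 1 (to_cell (last X)) (forest_code (map snd st) []) (map to_cell xs)"
  using assms
proof (induction st arbitrary: pre X xs rule: nfs_positioned.induct)
  case (2 u ts st)
  define new where "new = map (\<lambda>i. (u @ [i], ts ! i)) [0..<length ts]"
  define zs where "zs = take (length ts) xs"
  define ys where "ys = drop (length ts) xs"
  have pos: "nfs_positioned ((u, Node ts) # st) = rev (map fst new) @ nfs_positioned (new @ st)"
    by (simp add: new_def Let_def)
  have lens: "length zs = length ts" "length ys = length (nfs_positioned (new @ st))" and xs: "xs = zs @ ys"
    using "2.prems"(4) unfolding pos by (auto simp: zs_def ys_def new_def)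
  have code: "forest_code (map snd ((u, Node ts) # st)) [] =
      map Some [length st..<length st + length zs] @ forest_code (map snd (new @ st)) []"
  proof -
    have "map snd new = map ((!) ts) [0..<length ts]" by (simp add: new_def)
    then have "map snd new = ts" by (simp only: map_nth)
    then show ?thesis using lens by simp
  qed
  have z: "(1 + t) ^ length st \<le> last X" using "2.prems"(6) by simp
  then have "(1 + t) * (1 + t) ^ length st = min ((1 + t) ^ Suc (length st)) ((1 + t) * last X)"
    using t_pos by (simp add: min_absorb1 mult_left_mono)
  note run = cell_run[OF this]
  have cell: "cell 1 (to_cell (last X)) (forest_code (map snd ((u, Node ts) # st)) []) (map to_cell xs) \<longleftrightarrow>
      child_ineqs t T (X @ xs) u \<and> cell 1 (to_cell (last (last X # zs))) (forest_code (map snd (new @ st)) []) (map to_cell ys)"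
    unfolding code unfolding xs
    using child_ineqs_iff[OF "2.prems"(1,2,3) lens(1)] t_pos by (subst run) simp_all
  have nodes: "(\<forall>(v, S)\<in>set ((u, Node ts) # st). \<forall>w. is_node w S \<and> node_degree S w > 0 \<longrightarrow> P (v @ w)) \<longleftrightarrow>
      (ts \<noteq> [] \<longrightarrow> P u) \<and> (\<forall>(v, S)\<in>set (new @ st). \<forall>w. is_node w S \<and> node_degree S w > 0 \<longrightarrow> P (v @ w))"
    (is "?L \<longleftrightarrow> ?R") for P
  proof -
    have "(\<forall>w. is_node w (Node ts) \<and> node_degree (Node ts) w > 0 \<longrightarrow> P (u @ w)) \<longleftrightarrow>
      (ts \<noteq> [] \<longrightarrow> P u) \<and> (\<forall>i<length ts. \<forall>w. is_node w (ts ! i) \<and> node_degree (ts ! i) w > 0 \<longrightarrow> P (u @ i # w))"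
      (is "?A \<longleftrightarrow> ?B")
    proof
      assume A: ?A
      show ?B
      proof (intro conjI impI allI)
        show "P u" if "ts \<noteq> []" using A[rule_format, of "[]"] that by (simp add: node_degree_def)
        show "P (u @ i # w)" if "i < length ts" "is_node w (ts ! i) \<and> node_degree (ts ! i) w > 0" for i w
          using A[rule_format, of "i # w"] that by (simp add: node_degree_def)
      qed
    next
      assume B: ?B
      show ?A
      proof (intro allI impI)
        fix w assume "is_node w (Node ts) \<and> node_degree (Node ts) w > 0"
        then show "P (u @ w)" using B by (cases w) (auto simp: node_degree_def)
      qed
    qed
    then show ?thesis by (auto simp: new_def ball_Un)
  qed
  \<comment> \<open>For a leaf the chain consists only of 1 \<le> 1 + t.\<close>
  have triv: "ts = [] \<Longrightarrow> child_ineqs t T (X @ xs) u"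
    using child_ineqs_iff[OF "2.prems"(1,2,3) lens(1), of ys] xs lens t_pos by simp
  show ?case
  proof (cases "child_ineqs t T (X @ xs) u")
    case False
    then show ?thesis unfolding nodes cell using triv by blast
  next
    case True
    have last: "last (last X # zs) = last (X @ zs)" by simp
    \<comment> \<open>The invariant survives: a leaf shrinks the stack, and otherwise the leftmost
      child, positioned last, has height one less than the new stack size and lies above the lower
      end of its interval.\<close>
    have "(1 + t) ^ (length (new @ st) - 1) \<le> last (X @ zs)" if "new @ st \<noteq> []"
    proof (cases "zs = []")
      case True
      then have "length (new @ st) - 1 \<le> length st" using lens by (simp add: new_def)
      then have "(1 + t) ^ (length (new @ st) - 1) \<le> (1 + t) ^ length st"
        using t_pos by (intro power_increasing) auto
      then show ?thesis using z True by simp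
    next
      case False
      have "sorted (1 # rev (map (\<lambda>j. zs ! j / (1 + t) ^ (length st + j)) [0..<length zs]) @ [1 + t])"
        using True child_ineqs_iff[OF "2.prems"(1,2,3) lens(1), of ys] unfolding xs[symmetric] by blast
      then have "1 \<le> zs ! (length zs - 1) / (1 + t) ^ (length st + (length zs - 1))"
        using False by (auto simp: sorted_append)
      then have "(1 + t) ^ (length st + (length zs - 1)) \<le> last zs"
        using t_pos False by (simp add: pos_le_divide_eq last_conv_nth)
      moreover have "length (new @ st) - 1 = length st + (length zs - 1)"
        using False lens by (cases zs) (auto simp: new_def)
      ultimately show ?thesis using False by simp
    qed
    note z' = this
    have ord': "nfs_order T = (pre @ rev (map fst new)) @ nfs_positioned (new @ st)"
      using "2.prems"(1) pos by simp
    have ok': "nfs_stack T (pre @ rev (map fst new)) (new @ st)"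
      using nfs_stack_step[OF "2.prems"(2)] by (simp add: new_def)
    have "(\<forall>(u, S)\<in>set (new @ st). \<forall>w. is_node w S \<and> node_degree S w > 0 \<longrightarrow> child_ineqs t T ((X @ zs) @ ys) (u @ w)) \<longleftrightarrow>
      cell 1 (to_cell (last (X @ zs))) (forest_code (map snd (new @ st)) []) (map to_cell ys)"
      by (rule "2.IH"[OF new_def ord' ok' _ lens(2) _ z']) (use "2.prems"(3,5) lens in \<open>simp_all add: new_def\<close>)
    then show ?thesis unfolding nodes cell last using True xs by simp
  qed
qed simp

lemma tree_polytope_cell:
  "tree_polytope t T = {xs. cell 1 1 (forest_code [T] []) (map to_cell xs)}"
proof -
  have one: "to_cell 1 = 1" using q_pos by (simp add: to_cell_def)
  have eq: "tree_polytope t T = {xs. length xs = node_count T - 1 \<and>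
      (\<forall>w. is_node w T \<and> node_degree T w > 0 \<longrightarrow> child_ineqs t T (1 # xs) w)}"
    by (simp add: tree_polytope_def child_ineqs_def)
  have len: "length xs = node_count T - 1" if "cell 1 1 (forest_code [T] []) (map to_cell xs)" for xs
    using cell_length[OF that] length_forest_code[of "[T]" "[]"] by simp
  have "(\<forall>w. is_node w T \<and> node_degree T w > 0 \<longrightarrow> child_ineqs t T (1 # xs) w) \<longleftrightarrow>
      cell 1 1 (forest_code [T] []) (map to_cell xs)" if "length xs = node_count T - 1" for xs
    using tree_cell_stack[of T "[[]]" "[([], T)]" "[1]" xs] that one length_nfs_positioned[of "[([], T)]"]
    by (auto simp: nfs_order_def nfs_stack_def)
  then show ?thesis unfolding eq using len by blast
qed

text \<open>In the shifted coordinates the affine map in \<open>cone_q\<close> becomes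
  multiplication by the root coordinate, so the induction over the components rests on the
  homogeneity of cells and a separate look at the apex.\<close>

lemma forest_polytope_cell:
  "forest_polytope q t (T # F) = {xs. cell 1 1 (forest_code [T] F) (map to_cell xs)}"
proof (induction F arbitrary: T)
  case Nil
  show ?case by (simp add: tree_polytope_cell)
next
  case (Cons T' F)
  define P where "P = forest_polytope q t (T' # F)"
  define c where "c = forest_code [T'] F"
  have P: "P = {xs. cell 1 1 c (map to_cell xs)}"
    unfolding P_def c_def by (rule Cons)
  have nonempty: "\<exists>ys. cell 1 1 c ys"
    using cell_nonempty[of 0 c 1 1] valid_forest_code[of "[T']" 0 F] t_pos by (simp add: c_def)
  have to_cell_onto: "\<exists>xs. ys = map to_cell xs" for ys
    using q_pos by (intro exI[of _ "map (\<lambda>y. 1 - q + q * y) ys"]) (simp add: to_cell_def comp_def)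
  have cone: "x # xs \<in> cone_q q P \<longleftrightarrow> 0 \<le> to_cell x \<and> to_cell x \<le> 1 \<and> cell (to_cell x) (to_cell x) c (map to_cell xs)"
    for x xs
  proof -
    define y where "y = to_cell x"
    have y: "x = 1 - q + q * y" using q_pos by (simp add: y_def to_cell_def)
    \<comment> \<open>With x = 1 - q + q y both sides are q (1 - q) plus q^2 times a shifted
      coordinate, on the right multiplied by y, so the constants cancel.\<close>
    have coord_eq: "q * v = (x - 1 + q) * w + (1 - q) * (1 - x) \<longleftrightarrow> to_cell v = y * to_cell w" for v w
    proof -
      have "q * v - ((x - 1 + q) * w + (1 - q) * (1 - x)) = q\<^sup>2 * (to_cell v - y * to_cell w)"
        using q_pos by (simp add: y to_cell_def field_simps power2_eq_square)
      then show ?thesis using q_pos by (metis eq_iff_diff_eq_0 mult_eq_0_iff less_irrefl power_eq_0_iff)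
    qed
    have map_eq: "map (\<lambda>x. q * x) vs = map (\<lambda>w. (x - 1 + q) * w + (1 - q) * (1 - x)) ws \<longleftrightarrow>
        map to_cell vs = map ((*) y) (map to_cell ws)" for vs ws
    proof (induction vs arbitrary: ws)
      case (Cons v vs)
      then show ?case by (cases ws) (simp_all only: list.map list.inject coord_eq list.distinct)
    qed auto
    have "x # xs \<in> cone_q q P \<longleftrightarrow> 1 - q \<le> x \<and> x \<le> 1 \<and>
        (\<exists>ws. cell 1 1 c (map to_cell ws) \<and> map to_cell xs = map ((*) y) (map to_cell ws))"
      unfolding map_eq[symmetric] by (auto simp: cone_q_def P)
    also have "1 - q \<le> x \<longleftrightarrow> 0 \<le> y" using q_pos by (simp add: y zero_le_mult_iff)
    also have "x \<le> 1 \<longleftrightarrow> y \<le> 1" using q_pos by (simp add: y algebra_simps)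
    also have "(\<exists>ws. cell 1 1 c (map to_cell ws) \<and> map to_cell xs = map ((*) y) (map to_cell ws)) \<longleftrightarrow>
        (\<exists>ys. cell 1 1 c ys \<and> map to_cell xs = map ((*) y) ys)"
      using to_cell_onto by metis
    also have "0 \<le> y \<and> y \<le> 1 \<and> (\<exists>ys. cell 1 1 c ys \<and> map to_cell xs = map ((*) y) ys) \<longleftrightarrow>
        0 \<le> y \<and> y \<le> 1 \<and> cell y y c (map to_cell xs)"
    \<comment> \<open>At the apex every point of the cell is mapped to the zero list, which
      therefore belongs to the cone because the cell has a point.\<close>
    proof (cases "y = 0")
      case True
      have "map ((*) 0) ys = replicate (length ys) 0" for ys :: "real list"
        by (induction ys) auto
      then show ?thesis
        using True nonempty cell_length by (auto simp: cell_zero)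
    next
      case False
      have "(\<exists>ys. cell 1 1 c ys \<and> map to_cell xs = map ((*) y) ys) \<longleftrightarrow> cell y y c (map to_cell xs)" if "0 < y"
      proof
        assume "cell y y c (map to_cell xs)"
        moreover have eq: "map to_cell xs = map ((*) y) (map (\<lambda>v. v / y) (map to_cell xs))"
          using that by (simp add: comp_def)
        ultimately have "cell 1 1 c (map (\<lambda>v. v / y) (map to_cell xs))"
          using cell_scale[OF that, of 1 1 c "map (\<lambda>v. v / y) (map to_cell xs)"]
            unfolding mult_1_right eq[symmetric] by blast
        with eq show "\<exists>ys. cell 1 1 c ys \<and> map to_cell xs = map ((*) y) ys" by blast
      next
        assume "\<exists>ys. cell 1 1 c ys \<and> map to_cell xs = map ((*) y) ys"
        then show "cell y y c (map to_cell xs)" using cell_scale[OF that, of 1 1 c] by auto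
      qed
      then show ?thesis using False by auto
    qed
    finally show ?thesis by (simp add: y_def)
  qed
  have code: "forest_code [T] (T' # F) = forest_code [T] [] @ None # c"
    by (subst forest_code_split) (simp add: c_def)
  show ?case
  proof (intro set_eqI iffI)
    fix xs assume "xs \<in> forest_polytope q t (T # T' # F)"
    then obtain as bs where xs: "xs = as @ bs" "as \<in> tree_polytope t T" "bs \<in> cone_q q P"
      by (auto simp: P_def)
    then obtain x ys where bs: "bs = x # ys" by (auto simp: cone_q_def)
    have as: "cell 1 1 (forest_code [T] []) (map to_cell as)"
      using xs by (simp add: tree_polytope_cell)
    show "xs \<in> {xs. cell 1 1 (forest_code [T] (T' # F)) (map to_cell xs)}"
      using cell_append_root[OF None_notin_forest_code cell_length[OF as]] as xs bs cone
      by (simp add: code)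
  next
    fix xs assume "xs \<in> {xs. cell 1 1 (forest_code [T] (T' # F)) (map to_cell xs)}"
    then have xs: "cell 1 1 (forest_code [T] [] @ None # c) (map to_cell xs)" by (simp add: code)
    let ?k = "length (forest_code [T] [])"
    have len: "?k < length xs" using cell_length[OF xs] by simp
    then have split: "xs = take ?k xs @ xs ! ?k # drop (Suc ?k) xs" by (rule id_take_nth_drop)
    have "map to_cell xs = map to_cell (take ?k xs) @ to_cell (xs ! ?k) # map to_cell (drop (Suc ?k) xs)"
      by (subst split) simp
    moreover have "length (map to_cell (take ?k xs)) = ?k" using len by simp
    ultimately have "cell 1 1 (forest_code [T] []) (map to_cell (take ?k xs))" "xs ! ?k # drop (Suc ?k) xs \<in> cone_q q P"
      using xs cell_append_root[OF None_notin_forest_code, of "map to_cell (take ?k xs)" "[T]"] cone by auto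
    then show "xs \<in> forest_polytope q t (T # T' # F)"
      using split by (auto simp: tree_polytope_cell P_def)
  qed
qed

text \<open>The running minimum unfolds into one inequality for the initial value \<open>m\<close>
  and one for each earlier coordinate, because multiplication by t (1 - q) \<ge> 0 commutes with the
  minimum.\<close>

lemma tutte_region_iff:
  "tutte_region p m ys \<longleftrightarrow> (\<forall>y\<in>set ys. 0 \<le> y) \<and>
     (\<forall>i<length ys. q * ys ! i \<le> q * (1 + t) * (p # ys) ! i + t * (1 - q) * m \<and>
        (\<forall>j<i. q * ys ! i \<le> q * (1 + t) * (p # ys) ! i + t * (1 - q) * ys ! j))"
proof (induction ys arbitrary: p m)
  case (Cons y ys)
  have "t * (1 - q) * min m y = min (t * (1 - q) * m) (t * (1 - q) * y)"
    using t_pos q_le_1 by (simp add: min_mult_distrib_left)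
  then have min: "a \<le> b + t * (1 - q) * min m y \<longleftrightarrow> a \<le> b + t * (1 - q) * m \<and> a \<le> b + t * (1 - q) * y" for a b
    by auto
  show ?case
    unfolding tutte_region.simps Cons.IH min length_Cons All_less_Suc2 by auto
qed simp

text \<open>\<open>T_polytope\<close> bounds only the last coordinate from below,
  \<open>tutte_region\<close> all of them. The case j = i reads q y_i \<le> (q + t) y_(i-1), so
  nonnegativity passes from the last coordinate to all earlier ones.\<close>

lemma T_polytope_tutte_region:
  "T_polytope n q t = {xs. length xs = n \<and> tutte_region 1 1 (map to_cell xs)}"
proof (intro set_eqI)
  fix xs :: "real list"
  define ys where "ys = map to_cell xs"
  show "xs \<in> T_polytope n q t \<longleftrightarrow> xs \<in> {xs. length xs = n \<and> tutte_region 1 1 (map to_cell xs)}"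
  proof (cases "length xs = n")
    case True
    define x where "x i = (1 # xs) ! i" for i
    define y where "y i = (1 # ys) ! i" for i
    have xy: "x i = 1 - q + q * y i" if "i \<le> n" for i
      using that True q_pos by (cases i) (auto simp: x_def y_def ys_def to_cell_def)
    have step: "q * x i \<le> q * (1 + t) * x (i - 1) - t * (1 - q) * (1 - x (j - 1)) \<longleftrightarrow>
        q * y i \<le> q * (1 + t) * y (i - 1) + t * (1 - q) * y (j - 1)" if "j \<le> i" "i \<le> n" for i j
    proof -
      have "q * x i - (q * (1 + t) * x (i - 1) - t * (1 - q) * (1 - x (j - 1))) =
          q * (q * y i - (q * (1 + t) * y (i - 1) + t * (1 - q) * y (j - 1)))"
        using that by (simp add: xy algebra_simps)
      then show ?thesis using q_pos by (smt (verit) mult_le_0_iff zero_less_mult_iff)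
    qed
    have T: "xs \<in> T_polytope n q t \<longleftrightarrow> 0 \<le> y n \<and> (\<forall>i j. 1 \<le> j \<and> j \<le> i \<and> i \<le> n \<longrightarrow>
        q * y i \<le> q * (1 + t) * y (i - 1) + t * (1 - q) * y (j - 1))"
    proof -
      have "xs \<in> T_polytope n q t \<longleftrightarrow> 1 - q \<le> x n \<and> (\<forall>i j. 1 \<le> j \<and> j \<le> i \<and> i \<le> n \<longrightarrow>
          q * x i \<le> q * (1 + t) * x (i - 1) - t * (1 - q) * (1 - x (j - 1)))"
        unfolding x_def by (simp add: T_polytope_def True Let_def)
      also have "1 - q \<le> x n \<longleftrightarrow> 0 \<le> y n"
        using q_pos xy[of n] by (simp add: zero_le_mult_iff)
      finally show ?thesis using step by auto
    qed
    have R: "tutte_region 1 1 ys \<longleftrightarrow> (\<forall>i\<in>{1..n}. 0 \<le> y i) \<and> (\<forall>i j. 1 \<le> j \<and> j \<le> i \<and> i \<le> n \<longrightarrow>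
        q * y i \<le> q * (1 + t) * y (i - 1) + t * (1 - q) * y (j - 1))"
    proof -
      have len: "length ys = n" using True by (simp add: ys_def)
      have "(\<forall>y\<in>set ys. 0 \<le> y) \<longleftrightarrow> (\<forall>i<n. 0 \<le> y (Suc i))"
        by (simp add: all_set_conv_all_nth len y_def)
      also have "\<dots> \<longleftrightarrow> (\<forall>i\<in>{1..n}. 0 \<le> y i)"
        using image_Suc_lessThan[of n] by (metis (no_types, lifting) imageE image_eqI lessThan_iff)
      finally have 1: "(\<forall>y\<in>set ys. 0 \<le> y) \<longleftrightarrow> (\<forall>i\<in>{1..n}. 0 \<le> y i)" .
      have 2: "(\<forall>i<length ys. q * ys ! i \<le> q * (1 + t) * (1 # ys) ! i + t * (1 - q) * 1 \<and>
          (\<forall>j<i. q * ys ! i \<le> q * (1 + t) * (1 # ys) ! i + t * (1 - q) * ys ! j)) \<longleftrightarrow>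
        (\<forall>i j. 1 \<le> j \<and> j \<le> i \<and> i \<le> n \<longrightarrow> q * y i \<le> q * (1 + t) * y (i - 1) + t * (1 - q) * y (j - 1))"
        (is "?L \<longleftrightarrow> ?R")
      proof
        assume L: ?L
        show ?R
        proof (intro allI impI)
          fix i j :: nat assume ij: "1 \<le> j \<and> j \<le> i \<and> i \<le> n"
          then obtain i' where "i = Suc i'" by (cases i) auto
          then show "q * y i \<le> q * (1 + t) * y (i - 1) + t * (1 - q) * y (j - 1)"
            using ij L len by (cases "j - 1") (auto simp: y_def)
        qed
      next
        assume R: ?R
        show ?L
        proof (intro allI impI conjI)
          fix i assume "i < length ys"
          then show "q * ys ! i \<le> q * (1 + t) * (1 # ys) ! i + t * (1 - q) * 1"
            using R[rule_format, of 1 "Suc i"] len by (simp add: y_def)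
          fix j assume "j < i"
          then show "q * ys ! i \<le> q * (1 + t) * (1 # ys) ! i + t * (1 - q) * ys ! j"
            using R[rule_format, of "Suc (Suc j)" "Suc i"] len \<open>i < length ys\<close> by (simp add: y_def)
        qed
      qed
      show ?thesis unfolding tutte_region_iff[of 1 1 ys] 1 2 by simp
    qed
    have nonneg: "0 \<le> y (n - k)"
      if "0 \<le> y n" "k \<le> n" and H: "\<And>i j. 1 \<le> j \<and> j \<le> i \<and> i \<le> n \<Longrightarrow>
        q * y i \<le> q * (1 + t) * y (i - 1) + t * (1 - q) * y (j - 1)" for k
      using that(2)
    proof (induction k)
      case (Suc k)
      define i where "i = n - k"
      have i: "1 \<le> i" "i \<le> n" "n - Suc k = i - 1" using Suc.prems by (auto simp: i_def)
      have "0 \<le> q * y i" using Suc q_pos by (simp add: i_def)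
      also have "\<dots> \<le> q * (1 + t) * y (i - 1) + t * (1 - q) * y (i - 1)"
        using H[of i i] i by simp
      also have "\<dots> = (q + t) * y (i - 1)" by (simp add: algebra_simps)
      finally show ?case using q_pos t_pos i(3) by (simp add: zero_le_mult_iff)
    qed (use that in simp)
    define H where "H \<longleftrightarrow> (\<forall>i j. 1 \<le> j \<and> j \<le> i \<and> i \<le> n \<longrightarrow>
        q * y i \<le> q * (1 + t) * y (i - 1) + t * (1 - q) * y (j - 1))"
    have "0 \<le> y i" if "0 \<le> y n" H "i \<in> {1..n}" for i
      using nonneg[of "n - i"] that by (simp add: H_def)
    moreover have "0 \<le> y n" if "\<forall>i\<in>{1..n}. 0 \<le> y i"
    proof (cases "n = 0")
      case True
      then show ?thesis by (simp add: y_def)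
    next
      case False
      then show ?thesis using that by simp
    qed
    ultimately have "xs \<in> T_polytope n q t \<longleftrightarrow> tutte_region 1 1 ys"
      unfolding T R H_def[symmetric] by blast
    then show ?thesis using True by (simp add: ys_def)
  qed (simp add: T_polytope_def)
qed

text \<open>Both inclusions go through codes: a point of the region has a valid code, which is
  decoded to a forest. The starting values are 1, 1 and bound 0 because x_0 = 1 acts as the first
  root.\<close>

lemma T_polytope_eq_Union: "T_polytope n q t = (\<Union>F\<in>plane_forests (Suc n). forest_polytope q t F)"
proof (intro subset_antisym subsetI)
  fix xs assume "xs \<in> T_polytope n q t"
  then have xs: "length xs = n" "tutte_region 1 1 (map to_cell xs)"
    by (auto simp: T_polytope_tutte_region)
  then obtain c where c: "valid_code 0 c" "cell 1 1 c (map to_cell xs)"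
    using tutte_region_imp_cell[of 1 1 "map to_cell xs" 0] by auto
  then obtain T F where "T # F \<in> plane_forests (Suc (length c))" "forest_code [T] F = c"
    using valid_code_forest by blast
  then show "xs \<in> (\<Union>F\<in>plane_forests (Suc n). forest_polytope q t F)"
    using c xs cell_length[OF c(2)] forest_polytope_cell by auto
next
  fix xs assume "xs \<in> (\<Union>F\<in>plane_forests (Suc n). forest_polytope q t F)"
  then obtain G where G: "G \<in> plane_forests (Suc n)" "xs \<in> forest_polytope q t G" by blast
  then obtain T F where F: "G = T # F" by (cases G) auto
  then have cell: "cell 1 1 (forest_code [T] F) (map to_cell xs)"
    using G by (simp add: forest_polytope_cell)
  then have "length xs = n"
    using cell_length[OF cell] length_forest_code[of "[T]" F] G F by (simp add: plane_forests_def)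
  then show "xs \<in> T_polytope n q t"
    using cell_imp_tutte_region[OF cell] by (simp add: T_polytope_tutte_region)
qed

end

section \<open>Volumes\<close>

primrec list_volume :: "nat \<Rightarrow> real list set \<Rightarrow> ennreal" where
  "list_volume 0 P = indicator P []"
| "list_volume (Suc n) P = (\<integral>\<^sup>+ x. list_volume n {xs. x # xs \<in> P} \<partial>lborel)"

lemma list_volume_empty [simp]: "list_volume n {} = 0"
  by (induction n) auto

text \<open>Tonelli, one coordinate at a time. The index list \<open>is\<close> is arbitrary so that
  the induction can remove its head; slices are measurable as preimages under the update of one
  coordinate.\<close>

lemma emeasure_PiM_list_volume:
  "distinct is \<Longrightarrow> {f \<in> space (PiM (set is) (\<lambda>_. lborel)). map f is \<in> P} \<in> sets (PiM (set is) (\<lambda>_. lborel)) \<Longrightarrow>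
   emeasure (PiM (set is) (\<lambda>_. lborel)) {f \<in> space (PiM (set is) (\<lambda>_. lborel)). map f is \<in> P}
     = list_volume (length is) P"
proof (induction "is" arbitrary: P)
  case Nil
  then show ?case
    by (cases "[] \<in> P") (simp_all add: PiM_empty emeasure_count_space_finite)
next
  case (Cons i "is")
  interpret product_sigma_finite "\<lambda>_. lborel :: real measure" ..
  let ?M = "PiM (set is) (\<lambda>_. lborel :: real measure)"
  let ?M' = "PiM (insert i (set is)) (\<lambda>_. lborel :: real measure)"
  define S where "S = {f \<in> space ?M'. map f (i # is) \<in> P}"
  have S: "S \<in> sets ?M'" using Cons.prems by (simp add: S_def)
  have i: "i \<notin> set is" using Cons.prems by simp
  define Sy where "Sy y = {f \<in> space ?M. map f is \<in> {xs. y # xs \<in> P}}" for y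
  have upd: "x(i := y) \<in> S \<longleftrightarrow> x \<in> Sy y" if "x \<in> space ?M" for x y
  proof -
    have "map (x(i := y)) (i # is) = y # map x is" using i by auto
    moreover have "x(i := y) \<in> space ?M'"
      using that by (simp add: space_PiM PiE_fun_upd)
    ultimately show ?thesis using that by (simp add: S_def Sy_def del: list.map)
  qed
  have Sy: "Sy y \<in> sets ?M" for y
  proof -
    have "(\<lambda>x. x(i := y)) \<in> ?M \<rightarrow>\<^sub>M ?M'"
      by (rule measurable_fun_upd[where J = "set is"]) auto
    from measurable_sets[OF this S] have "(\<lambda>x. x(i := y)) -` S \<inter> space ?M \<in> sets ?M" .
    also have "(\<lambda>x. x(i := y)) -` S \<inter> space ?M = Sy y" using upd by (auto simp: Sy_def)
    finally show ?thesis .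
  qed
  have "emeasure ?M' S = (\<integral>\<^sup>+ f. indicator S f \<partial>?M')" using S by simp
  also have "\<dots> = (\<integral>\<^sup>+ y. (\<integral>\<^sup>+ x. indicator S (x(i := y)) \<partial>?M) \<partial>lborel)"
    using S i by (intro product_nn_integral_insert_rev) auto
  also have "\<dots> = (\<integral>\<^sup>+ y. (\<integral>\<^sup>+ x. indicator (Sy y) x \<partial>?M) \<partial>lborel)"
    using upd by (intro nn_integral_cong) (simp add: indicator_def)
  also have "\<dots> = (\<integral>\<^sup>+ y. list_volume (length is) {xs. y # xs \<in> P} \<partial>lborel)"
  proof (intro nn_integral_cong)
    fix y :: real
    have "emeasure ?M (Sy y) = list_volume (length is) {xs. y # xs \<in> P}"
      unfolding Sy_def by (rule Cons.IH) (use Cons.prems Sy[of y] in \<open>simp_all only: Sy_def distinct.simps\<close>)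
    then show "(\<integral>\<^sup>+ x. indicator (Sy y) x \<partial>?M) = list_volume (length is) {xs. y # xs \<in> P}"
      using Sy by simp
  qed
  finally show ?case by (simp add: S_def)
qed

section \<open>Lebesgue measure in coordinates\<close>

definition vec_of :: "nat \<Rightarrow> (nat \<Rightarrow> 'n) \<Rightarrow> (nat \<Rightarrow> real) \<Rightarrow> real ^ 'n::finite" where
  "vec_of n e f = (\<chi> i. f (the_inv_into {1..n} e i))"

lemma the_inv_into_bij:
  assumes "bij_betw e {1..n} UNIV"
  shows "the_inv_into {1..n} e i \<in> {1..n}" "e (the_inv_into {1..n} e i) = i"
    "k \<in> {1..n} \<Longrightarrow> the_inv_into {1..n} e (e k) = k"
  using assms the_inv_into_into[of e "{1..n}" i "{1..n}"] f_the_inv_into_f[of e "{1..n}" i]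
    the_inv_into_f_f[of e "{1..n}" k]
  by (auto simp: bij_betw_def)

lemma measurable_vec_of:
  fixes e :: "nat \<Rightarrow> 'n::finite"
  assumes "bij_betw e {1..n} UNIV"
  shows "vec_of n e \<in> PiM {1..n} (\<lambda>_. lborel) \<rightarrow>\<^sub>M borel"
  unfolding borel_measurable_euclidean_space[where 'c = "real ^ 'n"]
proof
  fix b :: "real ^ 'n" assume "b \<in> Basis"
  then obtain i where "b = axis i 1" by (auto simp: Basis_vec_def)
  then have "(\<lambda>f. vec_of n e f \<bullet> b) = (\<lambda>f. f (the_inv_into {1..n} e i))"
    by (simp add: vec_of_def inner_axis)
  moreover have "(\<lambda>f. f (the_inv_into {1..n} e i)) \<in> PiM {1..n} (\<lambda>_. lborel :: real measure) \<rightarrow>\<^sub>M lborel"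
    by (rule measurable_component_singleton) (rule the_inv_into_bij[OF assms])
  ultimately show "(\<lambda>f. vec_of n e f \<bullet> b) \<in> borel_measurable (PiM {1..n} (\<lambda>_. lborel))"
    by simp
qed

text \<open>It suffices to compare the measures of open boxes, whose preimages are products of
  intervals.\<close>

lemma lborel_eq_distr_PiM:
  fixes e :: "nat \<Rightarrow> 'n::finite"
  assumes "bij_betw e {1..n} UNIV"
  shows "lborel = distr (PiM {1..n} (\<lambda>_. lborel)) borel (vec_of n e)"
proof (rule lborel_eqI)
  interpret product_sigma_finite "\<lambda>_. lborel :: real measure" ..
  let ?M = "PiM {1..n} (\<lambda>_. lborel :: real measure)"
  show "sets (distr ?M borel (vec_of n e)) = sets borel" by simp
  fix l u :: "real ^ 'n" assume le: "\<And>b. b \<in> Basis \<Longrightarrow> l \<bullet> b \<le> u \<bullet> b"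
  have le': "l $ i \<le> u $ i" for i
    using le[of "axis i 1"] by (simp add: inner_axis axis_in_Basis_iff)
  have "vec_of n e -` box l u \<inter> space ?M = (\<Pi>\<^sub>E i\<in>{1..n}. {l $ e i<..<u $ e i})"
  proof (intro set_eqI iffI)
    fix f assume f: "f \<in> vec_of n e -` box l u \<inter> space ?M"
    then have "l $ e i < f i \<and> f i < u $ e i" if "i \<in> {1..n}" for i
      using that the_inv_into_bij(3)[OF assms that] by (auto simp: vec_of_def mem_box_cart dest!: spec[of _ "e i"])
    then show "f \<in> (\<Pi>\<^sub>E i\<in>{1..n}. {l $ e i<..<u $ e i})"
      using f by (auto simp: space_PiM PiE_def)
  next
    fix f assume f: "f \<in> (\<Pi>\<^sub>E i\<in>{1..n}. {l $ e i<..<u $ e i})"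
    have "l $ i < f (the_inv_into {1..n} e i) \<and> f (the_inv_into {1..n} e i) < u $ i" for i
      using PiE_mem[OF f the_inv_into_bij(1)[OF assms, of i]] the_inv_into_bij(2)[OF assms, of i] by simp
    then show "f \<in> vec_of n e -` box l u \<inter> space ?M"
      using f by (auto simp: vec_of_def mem_box_cart space_PiM PiE_def)
  qed
  then have "emeasure (distr ?M borel (vec_of n e)) (box l u) = emeasure ?M (\<Pi>\<^sub>E i\<in>{1..n}. {l $ e i<..<u $ e i})"
    using measurable_vec_of[OF assms] by (simp add: emeasure_distr)
  also have "\<dots> = (\<Prod>i\<in>{1..n}. emeasure lborel {l $ e i<..<u $ e i})"
    by (rule emeasure_PiM) auto
  also have "\<dots> = (\<Prod>i\<in>{1..n}. ennreal ((u - l) $ e i))"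
    using le' by simp
  also have "\<dots> = (\<Prod>i\<in>UNIV. ennreal ((u - l) $ i))"
    using prod.reindex_bij_betw[OF assms, of "\<lambda>i. ennreal ((u - l) $ i)"] by simp
  also have "\<dots> = ennreal (\<Prod>i\<in>UNIV. (u - l) $ i)"
    using le' by (intro prod_ennreal) simp
  also have "(\<Prod>i\<in>UNIV. (u - l) $ i) = (\<Prod>b\<in>Basis. (u - l) \<bullet> b)"
  proof -
    have B: "Basis = range (\<lambda>i. axis i 1 :: real ^ 'n)" by (auto simp: Basis_vec_def)
    have inj: "inj (\<lambda>i. axis i 1 :: real ^ 'n)" by (auto simp: inj_def axis_eq_axis)
    show ?thesis unfolding B prod.reindex[OF inj] by (simp add: inner_axis)
  qed
  finally show "emeasure (distr ?M borel (vec_of n e)) (box l u) = (\<Prod>b\<in>Basis. (u - l) \<bullet> b)" .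
qed

lemma emeasure_in_space:
  fixes e :: "nat \<Rightarrow> 'n::finite"
  assumes e: "bij_betw e {1..n} UNIV" and meas: "in_space n e P \<in> sets borel"
  shows "emeasure lborel (in_space n e P) = list_volume n P"
proof -
  let ?M = "PiM {1..n} (\<lambda>_. lborel :: real measure)"
  have set: "set [1..<n + 1] = {1..n}" by auto
  have maps: "map (\<lambda>i. vec_of n e f $ e i) [1..<n + 1] = map f [1..<n + 1]" for f
    unfolding map_eq_conv set using the_inv_into_bij(3)[OF e] by (simp add: vec_of_def del: One_nat_def)
  have eq: "vec_of n e -` in_space n e P \<inter> space ?M = {f \<in> space ?M. map f [1..<n + 1] \<in> P}"
    by (intro set_eqI) (simp only: in_space_def Int_iff vimage_eq mem_Collect_eq maps conj_commute)
  have "emeasure lborel (in_space n e P) = emeasure ?M (vec_of n e -` in_space n e P \<inter> space ?M)"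
    using measurable_vec_of[OF e] meas by (subst lborel_eq_distr_PiM[OF e]) (simp add: emeasure_distr)
  also have "\<dots> = list_volume (length [1..<n + 1]) P"
    using emeasure_PiM_list_volume[of "[1..<n + 1]" P] measurable_sets[OF measurable_vec_of[OF e] meas] unfolding eq set
    by simp
  finally show ?thesis by (simp del: upt_Suc)
qed

lemma DERIV_power_affine:
  fixes a b d :: real
  assumes "a \<noteq> 0"
  shows "((\<lambda>x. (a * x + b) ^ Suc k / (a * real (Suc k)) * d) has_real_derivative (a * x + b) ^ k * d) (at x)"
  using assms by (auto intro!: derivative_eq_intros simp del: power_Suc)

section \<open>Volumes of cells\<close>

context tutte_parameters
begin

text \<open>The volume at \<rho> = 1. Divided by their powers of 1 + t, the levels of k siblings run
  through the ordered points of [1, 1 + t], a set of volume t^k / k!; undoing the division gives the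
  powers of 1 + t, and passing from levels to coordinates puts q^k into the denominator. A root
  followed by d nodes contributes the integral of y^d over [0, 1].\<close>

fun cell_volume :: "pforest \<Rightarrow> pforest \<Rightarrow> real" where
  "cell_volume [] [] = 1"
| "cell_volume [] (T # F) = cell_volume [T] F / real (forest_size (T # F))"
| "cell_volume (Node ts # st) F =
     (t / q) ^ length ts / fact (length ts) * (1 + t) ^ (\<Sum>i<length ts. length st + i) *
     cell_volume (ts @ st) F"

lemma cell_volume_pos: "0 < cell_volume st F"
proof (induction st F rule: cell_volume.induct)
  case (2 T F)
  then show ?case by (simp add: add_pos_nonneg)
qed (use q_pos t_pos in auto)

text \<open>The previous coordinate only matters for the first of the siblings, hence the minimum.\<close>

lemma list_volume_run:
  assumes \<rho>: "0 \<le> \<rho>" and L: "0 \<le> L"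
    and c: "\<And>z. (1 + t) ^ (h + k) * \<rho> \<le> (1 + t) * level \<rho> z \<Longrightarrow> list_volume (length c) {ys. cell \<rho> z c ys} = ennreal L"
    and z: "(1 + t) ^ h * \<rho> \<le> (1 + t) * level \<rho> z"
  shows "list_volume (k + length c) {ys. cell \<rho> z (map Some [h..<h + k] @ c) ys} =
    ennreal (((1 + t) * min ((1 + t) ^ h * \<rho>) (level \<rho> z) / (1 + t) ^ h - \<rho>) ^ k / (q ^ k * fact k)
      * ((1 + t) ^ (\<Sum>i<k. h + i) * L))"
  using c z
proof (induction k arbitrary: h z)
  case 0
  then show ?case by simp
next
  case (Suc k)
  \<comment> \<open>The tighter upper bound on the level of the first sibling.\<close>
  define B where "B = (1 + t) * min ((1 + t) ^ h * \<rho>) (level \<rho> z)"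
  define M where "M = (1 + t) ^ (\<Sum>i<k. Suc h + i) * L / (q ^ k * fact k)"
  have M: "0 \<le> M" using L q_pos t_pos by (simp add: M_def)
  have B: "(1 + t) ^ h * \<rho> \<le> B"
    using Suc.prems(2) \<rho> t_pos by (auto simp: B_def min_def algebra_simps)
  define lo where "lo = ((1 + t) ^ h * \<rho> - (1 - q) * \<rho>) / q"
  define hi where "hi = (B - (1 - q) * \<rho>) / q"
  have lohi: "level \<rho> lo = (1 + t) ^ h * \<rho>" "level \<rho> hi = B"
    using q_pos by (simp_all add: level_def lo_def hi_def)
  have range: "y \<in> {lo..hi} \<longleftrightarrow> (1 + t) ^ h * \<rho> \<le> level \<rho> y \<and> level \<rho> y \<le> B" for y
    using level_le_iff[of \<rho> lo y] level_le_iff[of \<rho> y hi] by (simp add: lohi)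
  have le: "lo \<le> hi" using B level_le_iff[of \<rho> lo hi] by (simp add: lohi)
  \<comment> \<open>In the variable \<open>a * y + b\<close>, which is the level over
    \<open>(1 + t) ^ h\<close> minus \<rho>, the volume of the slice is a constant times a power
    that, once integrated, vanishes at the lower end of the interval.\<close>
  define a where "a = q / (1 + t) ^ h"
  define b where "b = (1 - q) * \<rho> / (1 + t) ^ h - \<rho>"
  have a: "0 < a" using q_pos t_pos by (simp add: a_def)
  have lin: "a * y + b = level \<rho> y / (1 + t) ^ h - \<rho>" for y
    by (simp add: a_def b_def level_def add_divide_distrib)
  have slice: "list_volume (k + length c) {ys. cell \<rho> z (map Some [h..<h + Suc k] @ c) (y # ys)} =
      ennreal ((a * y + b) ^ k * M) * indicator {lo..hi} y" for y
  proof (cases "y \<in> {lo..hi}")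
    case True
    then have y: "(1 + t) ^ h * \<rho> \<le> level \<rho> y" "level \<rho> y \<le> (1 + t) ^ Suc h * \<rho>" "level \<rho> y \<le> (1 + t) * level \<rho> z"
      using range[of y] t_pos by (auto simp: B_def min_def mult.assoc split: if_splits intro: order_trans mult_left_mono)
    have "(1 + t) ^ Suc h * \<rho> \<le> (1 + t) * level \<rho> y"
      using y(1) t_pos by (simp add: mult.assoc mult_left_mono)
    then have "list_volume (k + length c) {ys. cell \<rho> y (map Some [Suc h..<Suc h + k] @ c) ys} =
      ennreal (((1 + t) * min ((1 + t) ^ Suc h * \<rho>) (level \<rho> y) / (1 + t) ^ Suc h - \<rho>) ^ k / (q ^ k * fact k)
        * ((1 + t) ^ (\<Sum>i<k. Suc h + i) * L))"
      using Suc.prems by (intro Suc.IH) auto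
    \<comment> \<open>For the later siblings the predecessor bound is the tighter one, so the
      minimum disappears.\<close>
    moreover have "min ((1 + t) ^ Suc h * \<rho>) (level \<rho> y) = level \<rho> y" using y by (simp add: min_def)
    moreover have "(1 + t) * level \<rho> y / (1 + t) ^ Suc h = level \<rho> y / (1 + t) ^ h" using t_pos by simp
    moreover have "{ys. cell \<rho> z (map Some [h..<h + Suc k] @ c) (y # ys)} =
        {ys. cell \<rho> y (map Some [Suc h..<Suc h + k] @ c) ys}"
      using y by (simp add: upt_conv_Cons del: upt_Suc power_Suc)
    ultimately show ?thesis using True by (simp add: lin M_def del: power_Suc)
  next
    case False
    have "level \<rho> y \<le> B" if "level \<rho> y \<le> (1 + t) ^ Suc h * \<rho>" "level \<rho> y \<le> (1 + t) * level \<rho> z"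
      using that by (simp add: B_def min_def mult.assoc)
    then have "{ys. cell \<rho> z (map Some [h..<h + Suc k] @ c) (y # ys)} = {}"
      using False range[of y] by (auto simp: upt_conv_Cons simp del: upt_Suc power_Suc)
    then show ?thesis using False by simp
  qed
  define F where "F y = (a * y + b) ^ Suc k / (a * real (Suc k)) * M" for y
  have "list_volume (Suc k + length c) {ys. cell \<rho> z (map Some [h..<h + Suc k] @ c) ys} =
      (\<integral>\<^sup>+ y. ennreal ((a * y + b) ^ k * M) * indicator {lo..hi} y \<partial>lborel)"
    using slice by simp
  also have "\<dots> = ennreal (F hi - F lo)"
  proof (rule nn_integral_FTC_Icc)
    show "(\<lambda>y. (a * y + b) ^ k * M) \<in> borel_measurable borel" by simp
    fix y assume "y \<in> {lo..hi}"
    then have "(1 + t) ^ h * \<rho> \<le> level \<rho> y" using range[of y] by simp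
    then have "\<rho> \<le> level \<rho> y / (1 + t) ^ h" using t_pos by (simp add: pos_le_divide_eq mult.commute)
    then have "0 \<le> a * y + b" by (simp add: lin)
    then show "0 \<le> (a * y + b) ^ k * M" using M by simp
    show "(F has_real_derivative (a * y + b) ^ k * M) (at y)"
      unfolding F_def using DERIV_power_affine[of a b k M y] a by blast
  qed (rule le)
  also have "F lo = 0" using t_pos by (simp add: F_def lin lohi)
  also have "F hi - 0 = (B / (1 + t) ^ h - \<rho>) ^ Suc k / (q ^ Suc k * fact (Suc k)) * ((1 + t) ^ (\<Sum>i<Suc k. h + i) * L)"
  proof -
    have "(\<Sum>i<Suc k. h + i) = h + (\<Sum>i<k. Suc h + i)"
      by (subst sum.lessThan_Suc_shift) simp
    then have W: "(1 + t) ^ (\<Sum>i<Suc k. h + i) = (1 + t) ^ h * (1 + t) ^ (\<Sum>i<k. Suc h + i)"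
      by (simp only: power_add)
    have F: "F hi = (B / (1 + t) ^ h - \<rho>) ^ Suc k / (a * real (Suc k)) * M"
      by (simp only: F_def lin lohi)
    have "x ^ Suc k / (q / w * real (Suc k)) * (s * L / (q ^ k * fact k)) = x ^ Suc k / (q ^ Suc k * fact (Suc k)) * (w * s * L)"
      if "0 < w" for x w s :: real
      using that q_pos by (simp add: divide_simps)
    then show ?thesis
      unfolding W F a_def M_def diff_0_right using t_pos by simp
  qed
  finally show ?case by (simp only: B_def)
qed

text \<open>The assumption on \<open>z\<close> removes the minimum from
  \<open>list_volume_run\<close>, so the base of the power there becomes t \<rho>. The powers of
  \<rho> collect by homogeneity and form the integrand y^d at a root.\<close>

lemma list_volume_cell:
  assumes "0 \<le> \<rho>" "st \<noteq> [] \<Longrightarrow> (1 + t) ^ length st * \<rho> \<le> (1 + t) * level \<rho> z"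
  shows "list_volume (length (forest_code st F)) {ys. cell \<rho> z (forest_code st F) ys} =
    ennreal (\<rho> ^ length (forest_code st F) * cell_volume st F)"
  using assms
proof (induction st F arbitrary: \<rho> z rule: forest_code.induct)
  case 1
  then show ?case by simp
next
  case (2 T F)
  let ?c = "forest_code [T] F"
  let ?d = "length ?c"
  define V where "V = cell_volume [T] F"
  have V: "0 \<le> V" using cell_volume_pos[of "[T]" F] by (simp add: V_def)
  have size: "forest_size (T # F) = Suc ?d"
    using length_forest_code[of "[T]" F] by simp
  have slice: "list_volume ?d {ys. cell \<rho> z (None # ?c) (y # ys)} = ennreal (y ^ ?d * V) * indicator {0..\<rho>} y" for y
  proof (cases "y \<in> {0..\<rho>}")
    case True
    then show ?thesis using "2.IH"[of y y] by (simp add: V_def)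
  qed auto
  have "list_volume (Suc ?d) {ys. cell \<rho> z (None # ?c) ys} = (\<integral>\<^sup>+ y. ennreal (y ^ ?d * V) * indicator {0..\<rho>} y \<partial>lborel)"
    using slice by simp
  also have "\<dots> = ennreal (\<rho> ^ Suc ?d / real (Suc ?d) * V - 0 ^ Suc ?d / real (Suc ?d) * V)"
  proof (rule nn_integral_FTC_Icc)
    show "((\<lambda>y. y ^ Suc ?d / real (Suc ?d) * V) has_real_derivative y ^ ?d * V) (at y)" for y
      using DERIV_power_affine[where a = 1 and b = 0 and k = ?d and d = V and x = y]
      by (simp only: mult_1 add_0_right one_neq_zero not_False_eq_True)
  qed (use V \<open>0 \<le> \<rho>\<close> in auto)
  finally show ?case unfolding forest_code.simps cell_volume.simps size by (simp add: V_def)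
next
  case (3 ts st F)
  let ?c = "forest_code (ts @ st) F"
  define L where "L = \<rho> ^ length ?c * cell_volume (ts @ st) F"
  have L: "0 \<le> L" using 3(2) cell_volume_pos[of "ts @ st" F] by (simp add: L_def)
  have z: "(1 + t) ^ length st * \<rho> \<le> level \<rho> z"
    using 3(3) t_pos by (simp add: mult.assoc)
  have z': "(1 + t) ^ length st * \<rho> \<le> (1 + t) * level \<rho> z"
  proof -
    have "0 \<le> (1 + t) ^ length st * \<rho>" using 3(2) t_pos by simp
    then have "0 \<le> t * level \<rho> z" using z t_pos by simp
    then show ?thesis using z by (simp add: distrib_right)
  qed
  have IH: "list_volume (length ?c) {ys. cell \<rho> z' ?c ys} = ennreal L"
    if "(1 + t) ^ (length st + length ts) * \<rho> \<le> (1 + t) * level \<rho> z'" for z'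
    using 3(1)[of \<rho> z'] 3(2) that by (simp add: L_def add.commute)
  have "list_volume (length ts + length ?c) {ys. cell \<rho> z (map Some [length st..<length st + length ts] @ ?c) ys} =
    ennreal (((1 + t) * min ((1 + t) ^ length st * \<rho>) (level \<rho> z) / (1 + t) ^ length st - \<rho>) ^ length ts / (q ^ length ts * fact (length ts))
      * ((1 + t) ^ (\<Sum>i<length ts. length st + i) * L))"
    using 3(2) L IH z' by (rule list_volume_run)
  also have "(1 + t) * min ((1 + t) ^ length st * \<rho>) (level \<rho> z) / (1 + t) ^ length st - \<rho> = t * \<rho>"
  proof -
    have "1 + t \<noteq> 0" using t_pos by simp
    then show ?thesis using z by (simp add: min_absorb1) (simp add: algebra_simps)
  qed
  finally show ?case
    by (simp add: L_def power_mult_distrib power_divide power_add mult_ac)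
qed

end

section \<open>Polyhedra\<close>

definition affine_functional :: "('a::euclidean_space \<Rightarrow> real) \<Rightarrow> bool" where
  "affine_functional f \<longleftrightarrow> (\<exists>a b. \<forall>x. f x = a \<bullet> x + b)"

lemma affine_functional_const: "affine_functional (\<lambda>x. c)"
  unfolding affine_functional_def by (rule exI[of _ 0]) simp

lemma affine_functional_nth: "affine_functional (\<lambda>x :: real ^ 'n. x $ i)"
  unfolding affine_functional_def
  by (rule exI[of _ "axis i 1"], rule exI[of _ 0]) (simp add: inner_axis')

lemma affine_functional_add:
  assumes "affine_functional f" "affine_functional g"
  shows "affine_functional (\<lambda>x. f x + g x)"
proof -
  from assms obtain a b a' b' where "\<And>x. f x = a \<bullet> x + b" "\<And>x. g x = a' \<bullet> x + b'"
    unfolding affine_functional_def by blast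
  then show ?thesis unfolding affine_functional_def
    by (intro exI[of _ "a + a'"] exI[of _ "b + b'"]) (simp add: inner_add_left)
qed

lemma affine_functional_cmult:
  assumes "affine_functional f"
  shows "affine_functional (\<lambda>x. c * f x)"
proof -
  from assms obtain a b where "\<And>x. f x = a \<bullet> x + b"
    unfolding affine_functional_def by blast
  then show ?thesis unfolding affine_functional_def
    by (intro exI[of _ "c *\<^sub>R a"] exI[of _ "c * b"]) (simp add: algebra_simps)
qed

lemma affine_functional_diff:
  "affine_functional f \<Longrightarrow> affine_functional g \<Longrightarrow> affine_functional (\<lambda>x. f x - g x)"
  using affine_functional_add[of f "\<lambda>x. -1 * g x"] affine_functional_cmult[of g "-1"] by simp

lemmas affine_functional_intros = affine_functional_const affine_functional_nth
  affine_functional_add affine_functional_cmult affine_functional_diff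

lemma polyhedron_affine_le:
  assumes "affine_functional f" "affine_functional g"
  shows "polyhedron {x. f x \<le> g x}"
proof -
  from assms obtain a b a' b' where "\<And>x. f x = a \<bullet> x + b" "\<And>x. g x = a' \<bullet> x + b'"
    unfolding affine_functional_def by blast
  then have "{x. f x \<le> g x} = {x. (a - a') \<bullet> x \<le> b' - b}"
    by (auto simp: inner_diff_left)
  then show ?thesis by (simp add: polyhedron_halfspace_le)
qed

lemma borel_polytope: "polytope (S :: 'a::euclidean_space set) \<Longrightarrow> S \<in> sets borel"
  by (intro borel_closed polytope_imp_closed)

text \<open>A convex set with empty interior is negligible.\<close>

lemma full_dimensional_polytope:
  fixes S :: "'a::euclidean_space set"
  assumes "convex S" "0 < measure lborel S" "S \<in> sets borel"
  shows "aff_dim S = int DIM('a)"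
proof -
  have "\<not> negligible S"
    using assms by (auto simp: negligible_iff_null_sets null_sets_def measure_def emeasure_completion)
  then have "interior S \<noteq> {}" using negligible_convex_interior[OF assms(1)] by simp
  then show ?thesis by (rule aff_dim_nonempty_interior)
qed

section \<open>Cells as polyhedra, and a bound for the Tutte region\<close>

context tutte_parameters
begin

text \<open>Further down the recursion, root and predecessor are coordinates of the point, so they
  enter as arbitrary affine functionals.\<close>

lemma polyhedron_cell:
  "affine_functional r \<Longrightarrow> affine_functional z \<Longrightarrow> (\<And>i. affine_functional (y i)) \<Longrightarrow>
     polyhedron {x. cell (r x) (z x) c (map (\<lambda>i. y i x) is)}"
proof (induction c arbitrary: r z "is")
  case Nil
  then show ?case by (cases "is") auto
next
  case (Cons a c)
  show ?case
  proof (cases "is")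
    case Nil
    then show ?thesis by (cases a) auto
  next
    case (Cons i js)
    have lev: "affine_functional (\<lambda>x. level (r x) (f x))" if "affine_functional f" for f
      unfolding level_def by (intro affine_functional_intros that Cons.prems)
    show ?thesis
    proof (cases a)
      case None
      have "{x. cell (r x) (z x) (a # c) (map (\<lambda>i. y i x) is)} =
          {x. 0 \<le> y i x} \<inter> {x. y i x \<le> r x} \<inter> {x. cell (y i x) (y i x) c (map (\<lambda>i. y i x) js)}"
        using None Cons by auto
      then show ?thesis
        using Cons.prems by (auto intro!: polyhedron_Int polyhedron_affine_le affine_functional_intros Cons.IH)
    next
      case (Some h)
      have "{x. cell (r x) (z x) (a # c) (map (\<lambda>i. y i x) is)} =
          {x. (1 + t) ^ h * r x \<le> level (r x) (y i x)} \<inter> {x. level (r x) (y i x) \<le> (1 + t) ^ Suc h * r x} \<inter>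
          {x. level (r x) (y i x) \<le> (1 + t) * level (r x) (z x)} \<inter> {x. cell (r x) (y i x) c (map (\<lambda>i. y i x) js)}"
        using Some Cons by auto
      then show ?thesis
        using Cons.prems lev by (auto intro!: polyhedron_Int polyhedron_affine_le affine_functional_cmult Cons.IH simp del: power_Suc)
    qed
  qed
qed

text \<open>If the earlier values are at most C, the next one satisfies q y \<le> (q (1 + t) + t (1
  - q)) C = (q + t) C; each step costs the factor (q + t) / q \<ge> 1.\<close>

lemma tutte_region_bounded:
  "tutte_region p m ys \<Longrightarrow> p \<le> C \<Longrightarrow> m \<le> C \<Longrightarrow> 0 \<le> C \<Longrightarrow> y \<in> set ys \<Longrightarrow>
     0 \<le> y \<and> y \<le> ((q + t) / q) ^ length ys * C"
proof (induction ys arbitrary: p m C)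
  case (Cons x xs)
  let ?K = "(q + t) / q"
  have K: "1 \<le> ?K" using q_pos t_pos by simp
  have "q * x \<le> q * (1 + t) * p + t * (1 - q) * m" using Cons.prems by simp
  also have "\<dots> \<le> q * (1 + t) * C + t * (1 - q) * C"
    using Cons.prems q_pos q_le_1 t_pos by (intro add_mono mult_left_mono) auto
  also have "\<dots> = (q + t) * C" by (simp add: algebra_simps)
  finally have x: "x \<le> ?K * C" using q_pos by (simp add: field_simps)
  have KC: "C \<le> ?K * C" using mult_right_mono[OF K] Cons.prems(4) by simp
  show ?case
  proof (cases "y = x")
    case True
    have "?K * C \<le> ?K ^ length xs * (?K * C)"
      using mult_right_mono[OF one_le_power[OF K], of "?K * C" "length xs"] Cons.prems KC by simp
    then show ?thesis using True x Cons.prems by (simp add: mult_ac)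
  next
    case False
    then have "0 \<le> y \<and> y \<le> ?K ^ length xs * (?K * C)"
      using Cons.prems x KC by (intro Cons.IH[of x "min m x"]) auto
    then show ?thesis by (simp add: mult_ac)
  qed
qed simp

end

section \<open>Cells as polytopes in n-dimensional space\<close>

locale tutte_space = tutte_parameters +
  fixes n :: nat and e :: "nat \<Rightarrow> 'n::finite"
  assumes bij_e: "bij_betw e {1..n} (UNIV :: 'n set)"
begin

abbreviation forest_cell :: "pforest \<Rightarrow> (real ^ 'n) set" where
  "forest_cell F \<equiv> in_space n e (forest_polytope q t F)"

lemma card_n: "CARD('n) = n"
  using bij_betw_same_card[OF bij_e] by simp

lemma bounded_T: "bounded (in_space n e (T_polytope n q t))"
proof -
  let ?K = "((q + t) / q) ^ n"
  have "in_space n e (T_polytope n q t) \<subseteq> cbox (\<chi> i. 1 - q) (\<chi> i. 1 - q + q * ?K)"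
  proof
    fix x assume x: "x \<in> in_space n e (T_polytope n q t)"
    have "1 - q \<le> x $ i \<and> x $ i \<le> 1 - q + q * ?K" for i
    proof -
      obtain k where k: "k \<in> {1..n}" "i = e k"
        using bij_e by (metis UNIV_I bij_betw_def imageE)
      let ?ys = "map to_cell (map (\<lambda>i. x $ e i) [1..<n + 1])"
      have "to_cell (x $ i) \<in> set ?ys" using k by (auto simp del: upt_Suc)
      then have "0 \<le> to_cell (x $ i) \<and> to_cell (x $ i) \<le> ((q + t) / q) ^ length ?ys * 1"
        using x by (intro tutte_region_bounded[of 1 1]) (auto simp: in_space_def T_polytope_tutte_region)
      moreover have "length ?ys = n" by (simp del: upt_Suc)
      ultimately have "0 \<le> to_cell (x $ i) \<and> to_cell (x $ i) \<le> ?K" by (simp only: mult_1_right)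
      moreover have "1 - q \<le> v \<and> v \<le> 1 - q + q * K" if "0 \<le> to_cell v \<and> to_cell v \<le> K" for v K
        using that q_pos by (simp add: to_cell_def field_simps)
      ultimately show ?thesis by blast
    qed
    then show "x \<in> cbox (\<chi> i. 1 - q) (\<chi> i. 1 - q + q * ?K)" by (simp add: mem_box_cart)
  qed
  then show ?thesis by (rule bounded_subset[OF bounded_cbox])
qed

lemma polytope_T: "polytope (in_space n e (T_polytope n q t))"
proof -
  define X where "X i x = (1 # map (\<lambda>i. x $ e i) [1..<n + 1]) ! i" for i and x :: "real ^ 'n"
  have X: "affine_functional (X i)" if "i \<le> n" for i
  proof (cases i)
    case 0
    then have "X i = (\<lambda>x. 1)" by (simp add: X_def fun_eq_iff)
    then show ?thesis by (simp add: affine_functional_const)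
  next
    case (Suc k)
    then have "X i = (\<lambda>x. x $ e i)" using that by (simp add: X_def fun_eq_iff del: upt_Suc)
    then show ?thesis by (simp add: affine_functional_nth)
  qed
  let ?I = "{(i, j). 1 \<le> j \<and> j \<le> i \<and> i \<le> n}"
  have "?I \<subseteq> {..n} \<times> {..n}" by auto
  then have fin: "finite ?I" by (rule finite_subset) simp
  have mem: "x \<in> in_space n e (T_polytope n q t) \<longleftrightarrow> 1 - q \<le> X n x \<and> (\<forall>i j. 1 \<le> j \<and> j \<le> i \<and> i \<le> n \<longrightarrow>
      q * X i x \<le> q * (1 + t) * X (i - 1) x - t * (1 - q) * (1 - X (j - 1) x))" for x
    by (simp only: in_space_def T_polytope_def X_def Let_def mem_Collect_eq length_map length_upt) simp
  have "in_space n e (T_polytope n q t) = {x. 1 - q \<le> X n x} \<inter>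
      (\<Inter>(i, j)\<in>?I. {x. q * X i x \<le> q * (1 + t) * X (i - 1) x - t * (1 - q) * (1 - X (j - 1) x)})"
    using mem by auto
  moreover have "polyhedron \<dots>"
    using fin by (auto intro!: polyhedron_Int polyhedron_Inter polyhedron_affine_le affine_functional_intros X)
  ultimately show ?thesis
    using bounded_T by (simp add: polytope_eq_bounded_polyhedron)
qed

lemma forest_cell_subset_T: "F \<in> plane_forests (n + 1) \<Longrightarrow> forest_cell F \<subseteq> in_space n e (T_polytope n q t)"
  using T_polytope_eq_Union[of n] by (auto simp: in_space_def)

lemma Union_forest_cell: "\<Union>(forest_cell ` plane_forests (n + 1)) = in_space n e (T_polytope n q t)"
  using T_polytope_eq_Union[of n] by (auto simp: in_space_def)

lemma polytope_forest_cell: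
  assumes "F \<in> plane_forests (n + 1)"
  shows "polytope (forest_cell F)"
proof -
  obtain T F' where F: "F = T # F'" using assms by (cases F) (auto simp: plane_forests_def)
  have "forest_cell F = {x. cell 1 1 (forest_code [T] F') (map (\<lambda>i. to_cell (x $ e i)) [1..<n + 1])}"
    by (simp add: in_space_def F forest_polytope_cell comp_def del: upt_Suc forest_polytope.simps)
  moreover have "polyhedron \<dots>"
  proof (rule polyhedron_cell[of "\<lambda>_. 1" "\<lambda>_. 1"])
    show "affine_functional (\<lambda>x. to_cell (x $ e i))" for i
    proof -
      have "(\<lambda>x. to_cell (x $ e i)) = (\<lambda>x. (1 / q) * (x $ e i - (1 - q)))"
        by (simp add: to_cell_def)
      then show ?thesis by (simp only:) (intro affine_functional_intros)
    qed
  qed (rule affine_functional_const)+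
  ultimately show ?thesis
    using bounded_subset[OF bounded_T forest_cell_subset_T[OF assms]]
    by (simp add: polytope_eq_bounded_polyhedron)
qed

text \<open>The change of coordinates x = q y + (1 - q) scales volume by q^n.\<close>

lemma measure_forest_cell:
  assumes "T # F \<in> plane_forests (n + 1)"
  shows "measure lborel (forest_cell (T # F)) = q ^ n * cell_volume [T] F"
proof -
  define c where "c = forest_code [T] F"
  have len: "length c = n"
    using assms length_forest_code[of "[T]" F] by (simp add: c_def plane_forests_def)
  define Y where "Y = in_space n e {ys. cell 1 1 c ys}"
  have xY: "x \<in> forest_cell (T # F) \<longleftrightarrow> (\<chi> i. to_cell (x $ i)) \<in> Y" for x
    by (simp add: in_space_def Y_def c_def forest_polytope_cell comp_def del: upt_Suc forest_polytope.simps)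
  have img: "forest_cell (T # F) = (\<lambda>y. q *\<^sub>R y + (\<chi> i. 1 - q)) ` Y"
  proof (intro set_eqI iffI)
    fix x assume "x \<in> forest_cell (T # F)"
    then have "(\<chi> i. to_cell (x $ i)) \<in> Y" by (simp only: xY)
    moreover have "x = q *\<^sub>R (\<chi> i. to_cell (x $ i)) + (\<chi> i. 1 - q)"
      using q_pos by (simp add: vec_eq_iff to_cell_def)
    ultimately show "x \<in> (\<lambda>y. q *\<^sub>R y + (\<chi> i. 1 - q)) ` Y" by blast
  next
    fix x assume "x \<in> (\<lambda>y. q *\<^sub>R y + (\<chi> i. 1 - q)) ` Y"
    then obtain y where y: "y \<in> Y" "x = q *\<^sub>R y + (\<chi> i. 1 - q)" by blast
    then have "(\<chi> i. to_cell (x $ i)) = y" using q_pos by (simp add: vec_eq_iff to_cell_def)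
    then show "x \<in> forest_cell (T # F)" using y xY by simp
  qed
  have "polyhedron Y"
  proof -
    have "Y = {x. cell 1 1 c (map (\<lambda>i. x $ e i) [1..<n + 1])}" by (simp add: Y_def in_space_def)
    then show ?thesis using polyhedron_cell[of "\<lambda>_. 1" "\<lambda>_. 1" "\<lambda>i x. x $ e i" c "[1..<n + 1]"]
      by (simp add: affine_functional_const affine_functional_nth del: upt_Suc)
  qed
  then have Y: "Y \<in> sets borel" by (intro borel_closed polyhedron_imp_closed)
  have "emeasure lborel Y = list_volume n {ys. cell 1 1 c ys}"
    using emeasure_in_space[OF bij_e] Y by (simp add: Y_def)
  also have "\<dots> = ennreal (cell_volume [T] F)"
    using list_volume_cell[of 1 "[T]" 1 F] len by (simp add: c_def)
  finally have "measure lebesgue Y = cell_volume [T] F"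
    using Y cell_volume_pos[of "[T]" F] by (simp add: measure_def)
  then have "measure lebesgue (forest_cell (T # F)) = q ^ n * cell_volume [T] F"
    using measure_lebesgue_affine[of q "\<chi> i. 1 - q" Y] img card_n q_pos by simp
  moreover have "forest_cell (T # F) \<in> sets borel"
    using polytope_forest_cell[OF assms] by (rule borel_polytope)
  ultimately show ?thesis by simp
qed

text \<open>By \<open>cell_inter_hyperplane\<close> the intersection lies in a hyperplane. Its
  normal vector is nonzero because \<open>j \<le> p\<close> makes the coordinate of the root
  different from the one it determines.\<close>

lemma negligible_forest_cell_Int:
  assumes "F \<in> plane_forests (n + 1)" "G \<in> plane_forests (n + 1)" "F \<noteq> G"
  shows "negligible (forest_cell F \<inter> forest_cell G)"
proof -
  obtain S F' where F: "F = S # F'" using assms(1) by (cases F) (auto simp: plane_forests_def)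
  obtain T G' where G: "G = T # G'" using assms(2) by (cases G) (auto simp: plane_forests_def)
  define c where "c = forest_code [S] F'"
  define d where "d = forest_code [T] G'"
  have len: "length c = n" "length d = n"
    using assms length_forest_code[of "[S]" F'] length_forest_code[of "[T]" G']
    by (auto simp: c_def d_def F G plane_forests_def)
  have "c \<noteq> d" using assms(3) forest_code_inject[of "[S]" F' "[T]" G'] by (auto simp: c_def d_def F G)
  from cell_inter_hyperplane[OF this] have "\<exists>p<n. \<exists>j\<le>p. \<exists>K. \<forall>\<rho> z ys.
      0 \<le> \<rho> \<longrightarrow> cell \<rho> z c ys \<longrightarrow> cell \<rho> z d ys \<longrightarrow> ys ! p = K * (\<rho> # ys) ! j"
    unfolding len by simp
  then obtain p j K where pj: "p < n" "j \<le> p"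
    and H: "\<And>\<rho> z ys. 0 \<le> \<rho> \<Longrightarrow> cell \<rho> z c ys \<Longrightarrow> cell \<rho> z d ys \<Longrightarrow> ys ! p = K * (\<rho> # ys) ! j"
    by blast
  \<comment> \<open>The relation between the shifted coordinates rewritten in x. List index
    \<open>p\<close> is coordinate p + 1, and j = 0 stands for the constant 1 in front of the
    list.\<close>
  define a :: "real ^ 'n" where "a = axis (e (Suc p)) 1 - (if j = 0 then 0 else K *\<^sub>R axis (e j) 1)"
  define b where "b = (if j = 0 then 1 - q + q * K else (1 - q) * (1 - K))"
  have "e j \<noteq> e (Suc p)" if "j \<noteq> 0"
    using inj_on_eq_iff[OF bij_betw_imp_inj_on[OF bij_e], of j "Suc p"] pj that by simp
  then have "a $ e (Suc p) = 1" by (auto simp: a_def axis_def)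
  then have a: "a \<noteq> 0" by auto
  have "forest_cell F \<inter> forest_cell G \<subseteq> {x. a \<bullet> x = b}"
  proof
    fix x assume x: "x \<in> forest_cell F \<inter> forest_cell G"
    let ?ys = "map to_cell (map (\<lambda>i. x $ e i) [1..<n + 1])"
    have "cell 1 1 c ?ys" "cell 1 1 d ?ys"
      using x by (simp_all add: in_space_def F G c_def d_def forest_polytope_cell del: upt_Suc forest_polytope.simps)
    then have "?ys ! p = K * (1 # ?ys) ! j" by (intro H) auto
    moreover have nth: "?ys ! i = to_cell (x $ e (Suc i))" if "i < n" for i
      using that by (simp del: upt_Suc)
    ultimately have eq: "to_cell (x $ e (Suc p)) = K * (if j = 0 then 1 else to_cell (x $ e j))"
      using pj by (cases j) (simp_all del: upt_Suc)
    have "a \<bullet> x = x $ e (Suc p) - (if j = 0 then 0 else K * x $ e j)"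
      by (simp add: a_def inner_diff_left inner_axis')
    also have "\<dots> = b"
      using eq q_pos by (auto simp: b_def to_cell_def field_simps split: if_splits)
    finally show "x \<in> {x. a \<bullet> x = b}" by simp
  qed
  then show ?thesis using negligible_hyperplane[of a b] a negligible_subset by blast
qed

end

section \<open>The search as a recursion on plane forests\<close>

abbreviation unvisited :: "nat \<Rightarrow> nat set \<Rightarrow> nat set" where
  "unvisited N X \<equiv> {1..N} - X"

abbreviation nfs_new :: "nat \<Rightarrow> edges \<Rightarrow> nat set \<Rightarrow> nat \<Rightarrow> nat set" where
  "nfs_new N E X v \<equiv> {w \<in> unvisited N X. {v, w} \<in> E}"

lemma card_unvisited_insert_Max:
  "unvisited N X \<noteq> {} \<Longrightarrow> card (unvisited N (insert (Max (unvisited N X)) X)) < card (unvisited N X)"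
proof -
  assume "unvisited N X \<noteq> {}"
  then have "Max (unvisited N X) \<in> unvisited N X" by (intro Max_in) simp_all
  then have "unvisited N (insert (Max (unvisited N X)) X) \<subset> unvisited N X" by blast
  then show ?thesis by (intro psubset_card_mono) simp_all
qed

lemma card_unvisited_Un:
  assumes "A \<subseteq> unvisited N X"
  shows "card (unvisited N (X \<union> A)) = card (unvisited N X) - card A"
proof -
  have "unvisited N (X \<union> A) = unvisited N X - A" by blast
  moreover have "finite A" using assms finite_subset by blast
  ultimately show ?thesis using card_Diff_subset[of A "unvisited N X"] assms by simp
qed

text \<open>
  The plane trees grown from the stack by the search, followed by those of the components begun
  after the stack is exhausted.
\<close>

function nfs_forest :: "nat \<Rightarrow> edges \<Rightarrow> nat set \<Rightarrow> nat list \<Rightarrow> pforest" where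
  "nfs_forest N E X [] =
     (if unvisited N X = {} then []
      else nfs_forest N E (insert (Max (unvisited N X)) X) [Max (unvisited N X)])"
| "nfs_forest N E X (v # st) =
     (let A = nfs_new N E X v; F = nfs_forest N E (X \<union> A) (sorted_list_of_set A @ st)
      in Node (take (card A) F) # drop (card A) F)"
  by pat_completeness auto

lemma nfs_step_decreases:
  "A = nfs_new N E X v \<Longrightarrow> card (unvisited N (X \<union> A)) < card (unvisited N X) \<or>
     A = {}"
proof (cases "A = {}")
  case False
  assume A: "A = nfs_new N E X v"
  then have "A \<subseteq> unvisited N X" "finite A" by auto
  moreover from this have "0 < card A" "card A \<le> card (unvisited N X)"
    using False by (auto simp: card_gt_0_iff intro: card_mono)
  ultimately show ?thesis using card_unvisited_Un[of A N X] by auto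
qed auto

termination nfs_forest
proof (relation "measures [\<lambda>(N, E, X, st). card (unvisited N X), \<lambda>(N, E, X, st). length st]", goal_cases)
  case (2 N X E)
  then show ?case using card_unvisited_insert_Max by simp
next
  case 3
  from nfs_step_decreases[OF 3] show ?case by auto
qed simp

text \<open>The labels at which components are begun once the stack is exhausted; they label the
  roots of the trees that \<open>nfs_forest\<close> lists after those of the stack.\<close>

function nfs_roots :: "nat \<Rightarrow> edges \<Rightarrow> nat set \<Rightarrow> nat list \<Rightarrow> nat list" where
  "nfs_roots N E X [] =
     (if unvisited N X = {} then []
      else Max (unvisited N X) # nfs_roots N E (insert (Max (unvisited N X)) X) [Max (unvisited N X)])"
| "nfs_roots N E X (v # st) =
     (let A = nfs_new N E X v in nfs_roots N E (X \<union> A) (sorted_list_of_set A @ st))"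
  by pat_completeness auto

termination nfs_roots
proof (relation "measures [\<lambda>(N, E, X, st). card (unvisited N X), \<lambda>(N, E, X, st). length st]", goal_cases)
  case (2 N X E)
  then show ?case using card_unvisited_insert_Max by simp
next
  case 3
  from nfs_step_decreases[OF 3] show ?case by auto
qed simp

lemmas nfs_simps [simp del] = nfs_forest.simps nfs_roots.simps nfs_edges.simps

text \<open>\<open>N\<close> and \<open>E\<close> stay fixed during the search. The rule keeps them
  out of the induction and names the new root and the set of new nodes.\<close>

lemma nfs_induct [case_names finished root active]:
  assumes "\<And>X. unvisited N X = {} \<Longrightarrow> P X []"
    and "\<And>X r. unvisited N X \<noteq> {} \<Longrightarrow> r = Max (unvisited N X) \<Longrightarrow> r \<in> unvisited N X \<Longrightarrow>
      P (insert r X) [r] \<Longrightarrow> P X []"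
    and "\<And>X v st A. A = nfs_new N E X v \<Longrightarrow> P (X \<union> A) (sorted_list_of_set A @ st) \<Longrightarrow> P X (v # st)"
  shows "P X st"
proof -
  have "N' = N \<Longrightarrow> E' = E \<Longrightarrow> P X st" for N' E'
  proof (induction N' E' X st rule: nfs_roots.induct)
    case (1 N' E' X)
    have "P X []" if X: "unvisited N X \<noteq> {}"
      by (rule assms(2)[OF X refl Max_in[OF _ X]]) (use 1 X in \<open>simp_all del: atLeastAtMost_iff\<close>)
    then show ?case using assms(1) by blast
  next
    case (2 N' E' X v st)
    from 2(1)[OF refl 2(2,3)] show ?case unfolding 2(2,3) by (rule assms(3)[OF refl])
  qed
  then show ?thesis by blast
qed

lemma nfs_new_component:
  assumes "unvisited N X \<noteq> {}" "r = Max (unvisited N X)"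
  shows "nfs_roots N E X [] = r # nfs_roots N E (insert r X) [r]"
    "nfs_forest N E X [] = nfs_forest N E (insert r X) [r]"
    "nfs_edges N E X [] = nfs_edges N E (insert r X) [r]"
  using assms by (simp_all add: nfs_simps(1,3) nfs_edges.simps(1) Let_def)

lemma nfs_finished:
  assumes "unvisited N X = {}"
  shows "nfs_roots N E X [] = []" "nfs_forest N E X [] = []" "nfs_edges N E X [] = {}"
  using assms by (simp_all add: nfs_simps(1,3) nfs_edges.simps(1))

lemma nfs_active:
  assumes "A = nfs_new N E X v"
  shows "nfs_roots N E X (v # st) = nfs_roots N E (X \<union> A) (sorted_list_of_set A @ st)"
    "nfs_forest N E X (v # st) =
      (let F = nfs_forest N E (X \<union> A) (sorted_list_of_set A @ st)
       in Node (take (card A) F) # drop (card A) F)"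
    "nfs_edges N E X (v # st) = (\<lambda>w. {v, w}) ` A \<union> nfs_edges N E (X \<union> A) (sorted_list_of_set A @ st)"
  unfolding assms by (simp_all add: nfs_roots.simps(2) nfs_forest.simps(2) nfs_edges.simps(2) Let_def)

lemma length_nfs_forest: "length (nfs_forest N E X st) = length st + length (nfs_roots N E X st)"
proof (induction X st rule: nfs_induct[where N = N and E = E])
  case (finished X)
  then show ?case by (simp add: nfs_finished)
next
  case (root X r)
  then show ?case by (simp add: nfs_new_component)
next
  case (active X v st A)
  then show ?case by (simp add: nfs_active[OF active(1)] Let_def)
qed

lemma forest_size_nfs_forest:
  "forest_size (nfs_forest N E X st) = length st + card (unvisited N X)"
proof (induction X st rule: nfs_induct[where N = N and E = E])
  case (finished X)
  then show ?case by (simp add: nfs_finished)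
next
  case (root X r)
  have "unvisited N (insert r X) = unvisited N X - {r}" by blast
  then have "card (unvisited N X) = Suc (card (unvisited N (insert r X)))"
    by (simp only: card_Suc_Diff1 root(3) finite_Diff finite_atLeastAtMost)
  then show ?case using root(4) by (simp add: nfs_new_component[OF root(1,2)])
next
  case (active X v st A)
  let ?F = "nfs_forest N E (X \<union> A) (sorted_list_of_set A @ st)"
  have A: "A \<subseteq> unvisited N X" using active(1) by blast
  have "card A \<le> card (unvisited N X)" using A by (intro card_mono) auto
  moreover have "forest_size (take (card A) ?F) + forest_size (drop (card A) ?F) = forest_size ?F"
    by (metis append_take_drop_id map_append sum_list_append)
  ultimately show ?case
    using active(2) card_unvisited_Un[OF A] by (simp add: nfs_active[OF active(1)] Let_def)
qed

text \<open>Each search edge still to be found leads to a node that is unvisited now; this keeps it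
  away from nodes that have already been active.\<close>

lemma nfs_edges_subset:
  "e \<in> nfs_edges N E X st \<Longrightarrow>
     e \<in> E \<and> (\<exists>a b. e = {a, b} \<and> a \<in> set st \<union> unvisited N X \<and> b \<in> unvisited N X)"
proof (induction X st rule: nfs_induct[where N = N and E = E])
  case (finished X)
  then show ?case by (simp add: nfs_finished)
next
  case (root X r)
  then have "e \<in> nfs_edges N E (insert r X) [r]" by (simp add: nfs_new_component)
  with root(3,4) show ?case by fastforce
next
  case (active X v st A)
  from active.prems consider w where "w \<in> A" "e = {v, w}"
    | "e \<in> nfs_edges N E (X \<union> A) (sorted_list_of_set A @ st)"
    unfolding nfs_active[OF active(1)] by blast
  then show ?case
  proof cases
    case 1
    then show ?thesis using active(1) by auto
  next
    case 2
    have "finite A" using active(1) by simp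
    then obtain a b where ab: "e \<in> E" "e = {a, b}" "a \<in> A \<union> set st \<union> unvisited N (X \<union> A)" "b \<in> unvisited N (X \<union> A)"
      using active(2)[OF 2] by auto
    have "A \<subseteq> unvisited N X" using active(1) by blast
    with ab(3) have "a \<in> set (v # st) \<union> unvisited N X" by auto
    with ab show ?thesis by blast
  qed
qed

text \<open>The rest of the search consults only edges from a stack entry or an unvisited node to an
  unvisited node. Edges at nodes that have been active can therefore be discarded.\<close>

lemma nfs_forest_cong:
  assumes "\<And>a b. a \<in> set st \<union> unvisited N X \<Longrightarrow> b \<in> unvisited N X \<Longrightarrow> a \<noteq> b \<Longrightarrow> {a, b} \<in> E \<longleftrightarrow> {a, b} \<in> E'"
    and "set st \<subseteq> X"
  shows "nfs_forest N E X st = nfs_forest N E' X st"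
  using assms
proof (induction X st rule: nfs_induct[where N = N and E = E])
  case (finished X)
  then show ?case by (simp add: nfs_finished)
next
  case (root X r)
  have "nfs_forest N E (insert r X) [r] = nfs_forest N E' (insert r X) [r]"
    using root(3) root.prems by (intro root.IH) auto
  then show ?case using root(1,2) by (simp add: nfs_new_component)
next
  case (active X v st A)
  have A': "A = nfs_new N E' X v" using active by auto
  have "finite A" using active(1) by simp
  have "A \<subseteq> unvisited N X" using active(1) by blast
  have "nfs_forest N E (X \<union> A) (sorted_list_of_set A @ st) = nfs_forest N E' (X \<union> A) (sorted_list_of_set A @ st)"
    using active.prems \<open>finite A\<close> \<open>A \<subseteq> unvisited N X\<close> by (intro active.IH) auto
  then show ?case by (simp only: nfs_active[OF active(1)] nfs_active[OF A'])
qed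

lemma plane_tree_below_eq:
  "finite Y \<Longrightarrow> v \<in> Y \<Longrightarrow> plane_tree_below S Y v =
     Node (map (plane_tree_below S (Y - {v})) (sorted_list_of_set {w \<in> Y - {v}. {v, w} \<in> S}))"
  by (subst plane_tree_below.simps) simp

text \<open>
  \<open>S\<^sub>0\<close> are the search edges found so far and \<open>Ys\<close> lists, for each stack entry, the nodes that are
  not its proper ancestors.
\<close>

lemma nfs_forest_eq_plane_trees:
  assumes "distinct st" "set st \<subseteq> X" "length Ys = length st"
    and "\<And>i. i < length st \<Longrightarrow> finite (Ys ! i) \<and> st ! i \<in> Ys ! i \<and> unvisited N X \<subseteq> Ys ! i \<and>
      (\<forall>w\<in>Ys ! i. w \<noteq> st ! i \<longrightarrow> {st ! i, w} \<notin> S\<^sub>0)"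
    and "\<And>e. e \<in> S\<^sub>0 \<Longrightarrow> e \<inter> unvisited N X = {}"
    and S: "S = S\<^sub>0 \<union> nfs_edges N E X st"
  shows "nfs_forest N E X st =
    map2 (plane_tree_below S) Ys st @ map (plane_tree_below S {1..N}) (nfs_roots N E X st)"
  using assms
proof (induction X st arbitrary: Ys S\<^sub>0 rule: nfs_induct[where N = N and E = E])
  case (finished X)
  then show ?case by (simp add: nfs_finished)
next
  case (root X r)
  have "nfs_forest N E (insert r X) [r] =
      map2 (plane_tree_below S) [{1..N}] [r] @ map (plane_tree_below S {1..N}) (nfs_roots N E (insert r X) [r])"
  proof (rule root.IH)
    show "S = S\<^sub>0 \<union> nfs_edges N E (insert r X) [r]" using root by (simp add: nfs_new_component)
    show "e \<inter> unvisited N (insert r X) = {}" if "e \<in> S\<^sub>0" for e using root.prems(5)[OF that] by blast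
    show "finite ([{1..N}] ! i) \<and> [r] ! i \<in> [{1..N}] ! i \<and> unvisited N (insert r X) \<subseteq> [{1..N}] ! i \<and>
      (\<forall>w\<in>[{1..N}] ! i. w \<noteq> [r] ! i \<longrightarrow> {[r] ! i, w} \<notin> S\<^sub>0)" if "i < length [r]" for i
    proof -
      have "{r, w} \<notin> S\<^sub>0" for w using root.prems(5)[of "{r, w}"] root(3) by blast
      then show ?thesis using that root(3) by auto
    qed
  qed auto
  then show ?case using root(1,2) by (simp add: nfs_new_component)
next
  case (active X v st A)
  obtain Y Yt where Ys: "Ys = Y # Yt" "length Yt = length st"
    using active.prems(3) by (cases Ys) auto
  have Y: "finite Y" "v \<in> Y" "unvisited N X \<subseteq> Y" "\<And>w. w \<in> Y \<Longrightarrow> w \<noteq> v \<Longrightarrow> {v, w} \<notin> S\<^sub>0"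
    using active.prems(4)[of 0] Ys by auto
  have Yt: "finite (Yt ! i) \<and> st ! i \<in> Yt ! i \<and> unvisited N X \<subseteq> Yt ! i \<and>
      (\<forall>w\<in>Yt ! i. w \<noteq> st ! i \<longrightarrow> {st ! i, w} \<notin> S\<^sub>0)" if "i < length st" for i
    using active.prems(4)[of "Suc i"] Ys that by auto
  have vst: "v \<notin> set st" "distinct st" "v \<in> X" "set st \<subseteq> X" using active.prems(1,2) by auto
  have A: "finite A" "A \<subseteq> unvisited N X" using active(1) by auto
  let ?st = "sorted_list_of_set A @ st"
  define S1 where "S1 = S\<^sub>0 \<union> (\<lambda>w. {v, w}) ` A"
  \<comment> \<open>Siblings have the same proper ancestors: those of \<open>v\<close>, and
    \<open>v\<close> itself.\<close>
  let ?Ys = "replicate (card A) (Y - {v}) @ Yt"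
  have S: "S = S1 \<union> nfs_edges N E (X \<union> A) ?st"
    using active.prems(6) nfs_active(3)[OF active(1)] by (auto simp: S1_def)
  have IH: "nfs_forest N E (X \<union> A) ?st =
      map2 (plane_tree_below S) ?Ys ?st @ map (plane_tree_below S {1..N}) (nfs_roots N E (X \<union> A) ?st)"
  proof (rule active.IH)
    show "distinct ?st" using A vst by auto
    show "set ?st \<subseteq> X \<union> A" using A vst by auto
    show "length ?Ys = length ?st" using Ys(2) by simp
    show "e \<inter> unvisited N (X \<union> A) = {}" if "e \<in> S1" for e
      using that active.prems(5) vst(3) by (auto simp: S1_def)
    show "finite (?Ys ! i) \<and> ?st ! i \<in> ?Ys ! i \<and> unvisited N (X \<union> A) \<subseteq> ?Ys ! i \<and>
      (\<forall>w\<in>?Ys ! i. w \<noteq> ?st ! i \<longrightarrow> {?st ! i, w} \<notin> S1)" if i: "i < length ?st" for i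
    proof (cases "i < card A")
      case True
      define u where "u = ?st ! i"
      have nth: "?st ! i = sorted_list_of_set A ! i" "?Ys ! i = Y - {v}"
        using True by (simp_all add: nth_append)
      have "u \<in> set (sorted_list_of_set A)" unfolding u_def nth using True by (intro nth_mem) simp
      then have u: "u \<in> A" using A by simp
      have "{u, w} \<notin> S1" if "w \<in> Y - {v}" "w \<noteq> u" for w
        using that u A vst(3) active.prems(5)[of "{u, w}"] by (auto simp: S1_def doubleton_eq_iff)
      moreover have "u \<noteq> v" using u A vst(3) by auto
      ultimately show ?thesis using Y u A vst(3) nth(2) unfolding u_def[symmetric] by auto
    next
      case False
      define k where "k = i - card A"
      have k: "?st ! i = st ! k" "?Ys ! i = Yt ! k" "k < length st"
        using False i by (auto simp: nth_append k_def)
      have "st ! k \<noteq> v" "st ! k \<in> X" using vst nth_mem[OF k(3)] by auto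
      then have "{st ! k, w} \<notin> (\<lambda>w. {v, w}) ` A" for w
        using A by (auto simp: doubleton_eq_iff)
      then show ?thesis unfolding k using Yt[OF k(3)] by (auto simp: S1_def)
    qed
  qed (rule S)
  \<comment> \<open>The edges to \<open>A\<close> are the only search edges from \<open>v\<close>
    into \<open>Y - {v}\<close>: earlier ones leave \<open>Y\<close>, and later ones avoid
    \<open>v\<close>.\<close>
  have nbrs: "{w \<in> Y - {v}. {v, w} \<in> S} = A"
  proof -
    have "{v, w} \<notin> nfs_edges N E (X \<union> A) ?st" for w
      using nfs_edges_subset[of "{v, w}" N E "X \<union> A" ?st] vst A by (auto simp: doubleton_eq_iff)
    then have "{v, w} \<in> S \<longleftrightarrow> w \<in> A" if "w \<in> Y - {v}" for w
      using that Y(4) unfolding S S1_def by (auto simp: doubleton_eq_iff)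
    moreover have "A \<subseteq> Y - {v}" using A Y vst(3) by auto
    ultimately show ?thesis by blast
  qed
  have tree: "plane_tree_below S Y v = Node (map (plane_tree_below S (Y - {v})) (sorted_list_of_set A))"
    using plane_tree_below_eq[OF Y(1,2), of S] nbrs by simp
  have zip: "map2 (plane_tree_below S) ?Ys ?st =
      map (plane_tree_below S (Y - {v})) (sorted_list_of_set A) @ map2 (plane_tree_below S) Yt st"
    by (simp add: zip_append zip_replicate1 min_def comp_def)
  show ?case
    unfolding nfs_active[OF active(1)] IH zip by (simp add: Let_def Ys tree)
qed

section \<open>Components\<close>

abbreviation adjacency :: "edges \<Rightarrow> (nat \<times> nat) set" where
  "adjacency E \<equiv> {(x, y). {x, y} \<in> E}"

lemma adjacency_sym: "(x, y) \<in> (adjacency E)\<^sup>* \<Longrightarrow> (y, x) \<in> (adjacency E)\<^sup>*"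
proof -
  have "sym (adjacency E)" by (auto simp: sym_def insert_commute)
  then show "(x, y) \<in> (adjacency E)\<^sup>* \<Longrightarrow> (y, x) \<in> (adjacency E)\<^sup>*"
    by (meson sym_rtrancl symE)
qed

lemma adjacency_mono: "E \<subseteq> E' \<Longrightarrow> (adjacency E)\<^sup>* \<subseteq> (adjacency E')\<^sup>*"
  by (rule rtrancl_mono) auto

lemma nfs_roots_unvisited: "set (nfs_roots N E X st) \<subseteq> unvisited N X"
proof (induction X st rule: nfs_induct[where N = N and E = E])
  case (finished X)
  then show ?case by (simp add: nfs_finished)
next
  case (root X r)
  then show ?case using root(3,4) by (auto simp: nfs_new_component[OF root(1,2)])
next
  case (active X v st A)
  then show ?case using nfs_active(1)[OF active(1)] by auto
qed

text \<open>A later root was still unvisited when an earlier one was chosen as the maximum.\<close>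

lemma sorted_nfs_roots: "sorted_wrt (>) (nfs_roots N E X st)"
proof (induction X st rule: nfs_induct[where N = N and E = E])
  case (finished X)
  then show ?case by (simp add: nfs_finished)
next
  case (root X r)
  have "x < r" if "x \<in> set (nfs_roots N E (insert r X) [r])" for x
  proof -
    from that have "x \<in> unvisited N X" "x \<noteq> r" using nfs_roots_unvisited by blast+
    moreover from this(1) have "x \<le> r" unfolding root(2) by (intro Max_ge) simp_all
    ultimately show ?thesis by simp
  qed
  then show ?case using root(4) by (simp add: nfs_new_component[OF root(1,2)])
next
  case (active X v st A)
  then show ?case by (simp add: nfs_active(1)[OF active(1)])
qed

text \<open>A node that the rest of the search links to a child of \<open>v\<close> is linked to
  \<open>v\<close> by one more search edge.\<close>

lemma nfs_connected_root:
  "u \<in> set st \<union> unvisited N X \<Longrightarrow>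
     \<exists>r\<in>set st \<union> set (nfs_roots N E X st). (u, r) \<in> (adjacency (nfs_edges N E X st))\<^sup>*"
proof (induction X st arbitrary: u rule: nfs_induct[where N = N and E = E])
  case (finished X)
  then show ?case by (simp only: list.set Un_empty_left empty_iff)
next
  case (root X r)
  have "u \<in> set [r] \<union> unvisited N (insert r X)" using root.prems by auto
  from root.IH[OF this] show ?case by (auto simp: nfs_new_component[OF root(1,2)])
next
  case (active X v st A)
  let ?st = "sorted_list_of_set A @ st"
  let ?S = "nfs_edges N E (X \<union> A) ?st" and ?S' = "nfs_edges N E X (v # st)"
  have A: "finite A" using active(1) by simp
  show ?case
  proof (cases "u = v")
    case False
    then have "u \<in> set ?st \<union> unvisited N (X \<union> A)" using active.prems A by auto
    from active.IH[OF this] A obtain r where r: "r \<in> A \<union> set st \<union> set (nfs_roots N E (X \<union> A) ?st)"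
      "(u, r) \<in> (adjacency ?S)\<^sup>*" by auto
    have "?S \<subseteq> ?S'" by (auto simp: nfs_active(3)[OF active(1)])
    then have ur: "(u, r) \<in> (adjacency ?S')\<^sup>*" using r(2) adjacency_mono by blast
    show ?thesis
    proof (cases "r \<in> A")
      case True
      then have "(r, v) \<in> adjacency ?S'" by (auto simp: nfs_active(3)[OF active(1)] insert_commute)
      with ur have "(u, v) \<in> (adjacency ?S')\<^sup>*" by (rule rtrancl_into_rtrancl)
      then show ?thesis by auto
    next
      case False
      then show ?thesis using ur r(1) by (auto simp: nfs_active(1)[OF active(1)])
    qed
  qed auto
qed

text \<open>The last assumption says that visited nodes off the stack have only visited neighbours.
  Once the stack is empty, no edge leaves \<open>X\<close>, so the whole component of the new root
  is unvisited, and the maximum of the unvisited labels is its maximum.\<close>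

lemma nfs_root_is_Max:
  assumes "E \<subseteq> complete_edges N" "r \<in> set (nfs_roots N E X st)" "(r, w) \<in> (adjacency E)\<^sup>*"
    and "set st \<subseteq> X" "\<And>u w. u \<in> X - set st \<Longrightarrow> w \<in> {1..N} \<Longrightarrow> {u, w} \<in> E \<Longrightarrow> w \<in> X"
  shows "w \<in> {1..N} \<and> w \<le> r"
  using assms(2-)
proof (induction X st rule: nfs_induct[where N = N and E = E])
  case (finished X)
  then show ?case by (simp add: nfs_finished)
next
  case (root X r0)
  show ?case
  proof (cases "r = r0")
    case True
    from root.prems(2) have "w \<in> unvisited N X"
    proof (induction rule: rtrancl_induct)
      case base
      then show ?case using root(3) True by blast
    next
      case (step a b)
      then have ab: "{a, b} \<in> E" "{b, a} \<in> E" by (auto simp: insert_commute)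
      then have "b \<in> {1..N}" using assms(1) by (auto simp: complete_edges_def)
      moreover have "b \<notin> X" using root.prems(4)[of b a] ab step(3) by auto
      ultimately show ?case by blast
    qed
    moreover from this have "w \<le> r" unfolding True root(2) by (intro Max_ge) simp_all
    ultimately show ?thesis by blast
  next
    case False
    then have "r \<in> set (nfs_roots N E (insert r0 X) [r0])"
      using root.prems(1) by (simp add: nfs_new_component[OF root(1,2)])
    then show ?thesis
    proof (rule root.IH)
      fix u w assume "u \<in> insert r0 X - set [r0]" "w \<in> {1..N}" "{u, w} \<in> E"
      then show "w \<in> insert r0 X" using root.prems(4)[of u w] by auto
    qed (use root.prems(2) in auto)
  qed
next
  case (active X v st A)
  have A: "finite A" using active(1) by simp
  have "r \<in> set (nfs_roots N E (X \<union> A) (sorted_list_of_set A @ st))"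
    using active.prems(1) by (simp add: nfs_active(1)[OF active(1)])
  then show ?case
  proof (rule active.IH)
    show "set (sorted_list_of_set A @ st) \<subseteq> X \<union> A" using active.prems(3) A by auto
    fix u w assume u: "u \<in> X \<union> A - set (sorted_list_of_set A @ st)" and w: "w \<in> {1..N}" "{u, w} \<in> E"
    show "w \<in> X \<union> A"
    proof (cases "u = v")
      case True
      then show ?thesis using w active(1) by blast
    next
      case False
      then show ?thesis using active.prems(4)[of u w] u w A by auto
    qed
  qed (rule active.prems(2))
qed

text \<open>\<open>S\<close> may be anything between the search forest and the graph: the search
  forest gives the roots in \<open>Psi\<close>, the whole graph the number of components. Connection
  to a root uses the lower inclusion, maximality of the root the upper one.\<close>

lemma components_search:
  assumes E: "E \<subseteq> complete_edges N" and S: "nfs_edges N E {} [] \<subseteq> S" "S \<subseteq> E"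
  shows "bij_betw Max (components_of_graph {1..N} S) (set (nfs_roots N E {} []))"
proof -
  let ?R = "set (nfs_roots N E {} [])"
  define comp where "comp u = {w \<in> {1..N}. (u, w) \<in> (adjacency S)\<^sup>*}" for u
  have comps: "components_of_graph {1..N} S = comp ` {1..N}"
    by (auto simp: components_of_graph_def quotient_def comp_def)
  have RV: "?R \<subseteq> {1..N}" using nfs_roots_unvisited[of N E "{}" "[]"] by auto
  have Max: "Max (comp r) = r" if r: "r \<in> ?R" for r
  proof (rule Max_eqI)
    show "finite (comp r)" by (simp add: comp_def)
    show "r \<in> comp r" using RV r by (auto simp: comp_def)
    fix w assume "w \<in> comp r"
    then have "(r, w) \<in> (adjacency E)\<^sup>*" using adjacency_mono[OF S(2)] by (auto simp: comp_def)
    then show "w \<le> r" using nfs_root_is_Max[OF E r] by simp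
  qed
  have "comp ` {1..N} = comp ` ?R"
  proof
    show "comp ` {1..N} \<subseteq> comp ` ?R"
    proof
      fix C assume "C \<in> comp ` {1..N}"
      then obtain u where u: "u \<in> {1..N}" "C = comp u" by blast
      then obtain r where r: "r \<in> ?R" "(u, r) \<in> (adjacency (nfs_edges N E {} []))\<^sup>*"
        using nfs_connected_root[of u "[]" N "{}" E] by auto
      then have ur: "(u, r) \<in> (adjacency S)\<^sup>*" using adjacency_mono[OF S(1)] by blast
      have "comp u = comp r"
        using ur adjacency_sym[OF ur] by (auto simp: comp_def intro: rtrancl_trans)
      then show "C \<in> comp ` ?R" using u r by blast
    qed
  qed (use RV in blast)
  then have "components_of_graph {1..N} S = comp ` ?R" using comps by simp
  then show ?thesis
    using Max by (auto simp: bij_betw_def inj_on_def image_image)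
qed

text \<open>The roots are begun in decreasing order, which is the order in which
  \<open>plane_forest_of\<close> lists the components.\<close>

lemma Psi_eq_nfs_forest:
  assumes E: "E \<subseteq> complete_edges N"
  shows "Psi N E = nfs_forest N E {} []"
proof -
  let ?S = "nfs_edges N E {} []" and ?roots = "nfs_roots N E {} []"
  have "?S \<subseteq> E" using nfs_edges_subset by blast
  then have img: "Max ` components_of_graph {1..N} ?S = set ?roots"
    using components_search[OF E order_refl] by (simp add: bij_betw_def)
  have "sorted_wrt (<) (rev ?roots)" using sorted_nfs_roots by (simp add: sorted_wrt_rev)
  then have "sorted (rev ?roots)" "distinct (rev ?roots)" by (simp_all add: strict_sorted_iff)
  then have "sorted_list_of_set (set (rev ?roots)) = rev ?roots"
    by (rule sorted_list_of_set.idem_if_sorted_distinct)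
  then have "rev (sorted_list_of_set (set ?roots)) = ?roots" by simp
  then have "Psi N E = map (plane_tree_below ?S {1..N}) ?roots"
    by (simp only: Psi_def plane_forest_of_def search_forest_def img)
  also have "\<dots> = nfs_forest N E {} []"
    using nfs_forest_eq_plane_trees[of "[]" "{}" "[]" N "{}" ?S E] by simp
  finally show ?thesis .
qed

lemma num_comps_eq_length_Psi:
  assumes E: "E \<subseteq> complete_edges N"
  shows "num_comps {1..N} E = length (Psi N E)"
proof -
  have "distinct (nfs_roots N E {} [])"
    using sorted_nfs_roots[of N E "{}" "[]"] by (metis distinct_rev sorted_wrt_rev strict_sorted_iff)
  moreover have "nfs_edges N E {} [] \<subseteq> E" using nfs_edges_subset by blast
  ultimately show ?thesis
    using bij_betw_same_card[OF components_search[OF E _ order_refl]]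
    by (simp add: num_comps_def Psi_eq_nfs_forest[OF E] length_nfs_forest distinct_card)
qed

lemma Psi_in_plane_forests: "E \<in> labeled_graphs N \<Longrightarrow> Psi N E \<in> plane_forests N"
  using forest_size_nfs_forest[of N E "{}" "[]"]
  by (simp add: labeled_graphs_def Psi_eq_nfs_forest plane_forests_def)

lemma num_comps_complete: "1 \<le> N \<Longrightarrow> num_comps {1..N} (complete_edges N) = 1"
proof -
  assume N: "1 \<le> N"
  have "(u, v) \<in> (adjacency (complete_edges N))\<^sup>*" if "u \<in> {1..N}" "v \<in> {1..N}" for u v
  proof (cases "u = v")
    case False
    then have "(u, v) \<in> adjacency (complete_edges N)" using that by (auto simp: complete_edges_def)
    then show ?thesis by blast
  qed simp
  then have "components_of_graph {1..N} (complete_edges N) = {{1..N}}"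
    using N by (auto simp: components_of_graph_def quotient_def)
  then show ?thesis by (simp add: num_comps_def)
qed

lemma finite_labeled_graphs [simp]: "finite (labeled_graphs N)"
proof -
  have "complete_edges N \<subseteq> Pow {1..N}" by (auto simp: complete_edges_def)
  then show ?thesis unfolding labeled_graphs_def using finite_subset by blast
qed

section \<open>Sums over edge sets, split at a vertex\<close>

definition pairs :: "nat set \<Rightarrow> edges" where
  "pairs W = {e. e \<subseteq> W \<and> card e = 2}"

lemma finite_pairs [simp]: "finite W \<Longrightarrow> finite (pairs W)"
  by (rule finite_subset[of _ "Pow W"]) (auto simp: pairs_def)

definition star :: "nat \<Rightarrow> nat set \<Rightarrow> edges" where
  "star v A = (\<lambda>w. {v, w}) ` A"

lemma pairs_insert: "v \<notin> W \<Longrightarrow> pairs (insert v W) = star v W \<union> pairs W"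
proof (intro set_eqI iffI)
  fix e assume v: "v \<notin> W" and "e \<in> pairs (insert v W)"
  then obtain a b where e: "e = {a, b}" "a \<noteq> b" "a \<in> insert v W" "b \<in> insert v W"
    by (auto simp: pairs_def card_2_iff)
  then consider "a = v" "b \<in> W" | "b = v" "a \<in> W" | "a \<in> W" "b \<in> W" by auto
  then show "e \<in> star v W \<union> pairs W"
    using e by cases (auto simp: star_def pairs_def insert_commute)
next
  fix e assume "v \<notin> W" "e \<in> star v W \<union> pairs W"
  then show "e \<in> pairs (insert v W)" by (auto simp: star_def pairs_def card_insert_if)
qed

lemma star_pairs_disjoint: "v \<notin> W \<Longrightarrow> star v A \<inter> pairs W = {}"
  by (auto simp: star_def pairs_def)

lemma sum_Pow_Un:
  assumes "finite A" "finite B" "A \<inter> B = {}"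
  shows "(\<Sum>E\<in>Pow (A \<union> B). f E) = (\<Sum>E\<in>Pow A. \<Sum>E'\<in>Pow B. f (E \<union> E'))"
proof -
  have "bij_betw (\<lambda>(E, E'). E \<union> E') (Pow A \<times> Pow B) (Pow (A \<union> B))"
  proof (rule bij_betw_byWitness[where f' = "\<lambda>E. (E \<inter> A, E \<inter> B)"])
    show "\<forall>p\<in>Pow A \<times> Pow B. (\<lambda>E. (E \<inter> A, E \<inter> B)) ((\<lambda>(E, E'). E \<union> E') p) = p"
      using assms(3) by auto
  qed auto
  from sum.reindex_bij_betw[OF this, of f] show ?thesis
    by (simp add: sum.cartesian_product case_prod_unfold)
qed

lemma inj_star: "inj (star v)"
proof (rule injI)
  have "{v, w} \<in> star v A \<longleftrightarrow> w \<in> A" for w A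
    by (auto simp: star_def doubleton_eq_iff)
  then show "A = B" if "star v A = star v B" for A B
    using that by (metis set_eqI)
qed

lemma card_star: "finite A \<Longrightarrow> card (star v A) = card A"
  unfolding star_def by (rule card_image) (auto simp: inj_on_def doubleton_eq_iff)

lemma sum_Pow_star: "(\<Sum>E\<in>Pow (star v A). f E) = (\<Sum>B\<in>Pow A. f (star v B))"
proof -
  have "star v = (`) (\<lambda>w. {v, w})" by (simp add: star_def fun_eq_iff)
  then have "Pow (star v A) = star v ` Pow A"
    using image_Pow_surj[OF refl, of "\<lambda>w. {v, w}" A] by simp
  then show ?thesis by (simp add: sum.reindex[OF inj_on_subset[OF inj_star subset_UNIV]])
qed

lemma sum_Pow_card: "finite A \<Longrightarrow> (\<Sum>B\<in>Pow A. t ^ card B) = (1 + t :: real) ^ card A"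
proof (induction A rule: finite_induct)
  case (insert x A)
  have "(\<Sum>B\<in>Pow (insert x A). t ^ card B) = (\<Sum>B\<in>Pow A. t ^ card B) + (\<Sum>B\<in>insert x ` Pow A. t ^ card B)"
    using insert by (subst Pow_insert, intro sum.union_disjoint) auto
  also have "(\<Sum>B\<in>insert x ` Pow A. t ^ card B) = (\<Sum>B\<in>Pow A. t ^ card (insert x B))"
    using insert by (subst sum.reindex) (auto simp: inj_on_def)
  also have "\<dots> = (\<Sum>B\<in>Pow A. t * t ^ card B)"
    using insert by (intro sum.cong refl) (metis PowD card_insert_disjoint finite_subset power_Suc subsetD)
  finally show ?case using insert by (simp add: sum_distrib_left[symmetric] algebra_simps)
qed simp

section \<open>Weighted counts of graphs\<close>

lemma take_drop_eq_iff:
  "k \<le> length L \<Longrightarrow> take k L = xs \<and> drop k L = ys \<longleftrightarrow> length xs = k \<and> L = xs @ ys"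
  by (auto simp: min_def)

context tutte_parameters
begin

text \<open>The code has one entry per unvisited node, so the binomial coefficient chooses the
  children of the active node. The power of t belongs to the edges to them, that of 1 + t to the
  free edges to the other stack entries.\<close>

fun graph_weight :: "pforest \<Rightarrow> pforest \<Rightarrow> real" where
  "graph_weight [] [] = 1"
| "graph_weight [] (T # F) = graph_weight [T] F"
| "graph_weight (Node ts # st) F =
     real (length (forest_code (Node ts # st) F) choose length ts) * t ^ length ts * (1 + t) ^ length st *
     graph_weight (ts @ st) F"

text \<open>The edges at the active node \<open>v\<close> are split off: those to \<open>A\<close>
  decide its children, those to \<open>B\<close> on the stack change nothing, and by
  \<open>nfs_forest_cong\<close> the remaining search sees only \<open>E'\<close>.\<close>

lemma nfs_forest_star:
  assumes A: "A \<subseteq> unvisited N X" and B: "B \<subseteq> set st" and E': "E' \<subseteq> pairs (set st \<union> unvisited N X)"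
    and st: "distinct (v # st)" "set (v # st) \<subseteq> X"
  shows "nfs_forest N (star v (A \<union> B) \<union> E') X (v # st) = Node ts # F \<longleftrightarrow>
    card A = length ts \<and> nfs_forest N E' (X \<union> A) (sorted_list_of_set A @ st) = ts @ F"
proof -
  let ?E = "star v (A \<union> B) \<union> E'"
  have fin: "finite A" using A finite_subset by blast
  have v: "v \<notin> set st \<union> unvisited N X" using st by auto
  have notin: "{a, b} \<notin> star v C" if "a \<noteq> v" "b \<noteq> v" for a b C
    using that by (auto simp: star_def doubleton_eq_iff)
  have "nfs_new N ?E X v = A"
  proof -
    have "{v, w} \<notin> E'" for w using E' v by (auto simp: pairs_def)
    moreover have "{v, w} \<in> star v C \<longleftrightarrow> w \<in> C" for w C by (auto simp: star_def doubleton_eq_iff)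
    ultimately have "nfs_new N ?E X v = unvisited N X \<inter> (A \<union> B)" by auto
    also have "\<dots> = A" using A B st by auto
    finally show ?thesis .
  qed
  note act = nfs_active(2)[OF this[symmetric]]
  have cong: "nfs_forest N ?E (X \<union> A) (sorted_list_of_set A @ st) = nfs_forest N E' (X \<union> A) (sorted_list_of_set A @ st)"
  proof (rule nfs_forest_cong)
    fix a b assume "a \<in> set (sorted_list_of_set A @ st) \<union> unvisited N (X \<union> A)" "b \<in> unvisited N (X \<union> A)"
    then have "a \<noteq> v" "b \<noteq> v" using v A fin by auto
    then show "{a, b} \<in> ?E \<longleftrightarrow> {a, b} \<in> E'" using notin by blast
  qed (use fin st in auto)
  show ?thesis
    unfolding act cong Let_def list.inject ptree.inject
    by (subst take_drop_eq_iff) (auto simp: length_nfs_forest)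
qed

text \<open>The sum runs over the edges not yet examined, which lie within the stack and the
  unvisited nodes. Making \<open>v\<close> active reveals its edges to the rest and leaves a problem
  of the same kind without \<open>v\<close>.\<close>

lemma sum_graph_weight:
  assumes "distinct st" "set st \<subseteq> X" "length fs = length st"
    and "card (unvisited N X) = length (forest_code fs F)"
  shows "(\<Sum>E\<in>Pow (pairs (set st \<union> unvisited N X)). if nfs_forest N E X st = fs @ F then t ^ card E else 0)
    = graph_weight fs F"
  using assms
proof (induction fs F arbitrary: X st rule: forest_code.induct)
  case 1
  then have st: "st = []" and U: "unvisited N X = {}" by auto
  have "pairs {} = {}" by (auto simp: pairs_def)
  then have "pairs (set st \<union> unvisited N X) = {}" unfolding st U by simp
  then show ?case using nfs_finished(2)[OF U, of E] st by (simp add: nfs_finished(2)[OF U])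
next
  case (2 T F)
  then have st: "st = []" by simp
  have "card (unvisited N X) \<noteq> 0" using 2(5) by simp
  then have ne: "unvisited N X \<noteq> {}" by (metis card.empty)
  define r where "r = Max (unvisited N X)"
  have r: "r \<in> unvisited N X" using Max_in[OF _ ne] by (simp add: r_def)
  have U: "set [r] \<union> unvisited N (insert r X) = unvisited N X" using r by auto
  have "unvisited N X = insert r (unvisited N (insert r X))" using r by auto
  then have "card (unvisited N X) = Suc (card (unvisited N (insert r X)))"
    by (metis Diff_iff card_insert_disjoint finite_Diff finite_atLeastAtMost insertI1)
  then have "(\<Sum>E\<in>Pow (pairs (set [r] \<union> unvisited N (insert r X))).
      if nfs_forest N E (insert r X) [r] = [T] @ F then t ^ card E else 0) = graph_weight [T] F"
    using 2 by (intro 2(1)) auto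
  then show ?case unfolding U st by (simp add: nfs_new_component[OF ne r_def])
next
  case (3 ts fs F)
  obtain v st' where st: "st = v # st'" using 3(4) by (cases st) auto
  let ?U = "unvisited N X" and ?k = "length ts"
  let ?W = "set st' \<union> ?U"
  have v: "v \<notin> ?W" using 3(2,3) st by auto
  have disj: "?U \<inter> set st' = {}" using 3(3) st by auto
  define f where "f E = (if nfs_forest N E X st = (Node ts # fs) @ F then t ^ card E else 0)" for E
  define g where "g = graph_weight (ts @ fs) F"
  \<comment> \<open>For every \<open>A\<close> of the right size the induction hypothesis gives the
    same value \<open>g\<close>, so only the size of \<open>A\<close> matters.\<close>
  have inner: "(\<Sum>E'\<in>Pow (pairs ?W). f (star v (A \<union> B) \<union> E')) = (if card A = ?k then t ^ ?k * g else 0) * t ^ card B"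
    if A: "A \<in> Pow ?U" and B: "B \<in> Pow (set st')" for A B
  proof -
    have finA: "finite A" using A finite_subset by blast
    have finB: "finite B" using B finite_subset by blast
    have "f (star v (A \<union> B) \<union> E') = (if card A = ?k then t ^ ?k * t ^ card B else 0) *
        (if nfs_forest N E' (X \<union> A) (sorted_list_of_set A @ st') = (ts @ fs) @ F then t ^ card E' else 0)"
      if E': "E' \<in> Pow (pairs ?W)" for E'
    proof -
      have "finite E'" using E' finite_subset[of E' "pairs ?W"] by simp
      moreover have "star v (A \<union> B) \<inter> E' = {}" using star_pairs_disjoint[OF v] E' by blast
      ultimately have "card (star v (A \<union> B) \<union> E') = card (A \<union> B) + card E'"
        using finA finB card_star[of "A \<union> B" v] by (subst card_Un_disjoint) (auto simp: star_def)
      also have "card (A \<union> B) = card A + card B"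
        using finA finB A B disj by (intro card_Un_disjoint) auto
      finally have card: "card (star v (A \<union> B) \<union> E') = card A + card B + card E'" .
      have "nfs_forest N (star v (A \<union> B) \<union> E') X (v # st') = Node ts # (fs @ F) \<longleftrightarrow>
          card A = ?k \<and> nfs_forest N E' (X \<union> A) (sorted_list_of_set A @ st') = ts @ fs @ F"
        using A B E' 3(2,3) st by (intro nfs_forest_star) auto
      then show ?thesis unfolding f_def card st by (simp add: power_add)
    qed
    then have "(\<Sum>E'\<in>Pow (pairs ?W). f (star v (A \<union> B) \<union> E')) = (if card A = ?k then t ^ ?k * t ^ card B else 0) *
        (\<Sum>E'\<in>Pow (pairs ?W). if nfs_forest N E' (X \<union> A) (sorted_list_of_set A @ st') = (ts @ fs) @ F then t ^ card E' else 0)"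
      by (simp add: sum_distrib_left)
    moreover have "(\<Sum>E'\<in>Pow (pairs ?W). if nfs_forest N E' (X \<union> A) (sorted_list_of_set A @ st') = (ts @ fs) @ F then t ^ card E' else 0) = g"
      if "card A = ?k"
    proof -
      have W: "?W = set (sorted_list_of_set A @ st') \<union> unvisited N (X \<union> A)" using A finA by auto
      have "card (unvisited N (X \<union> A)) = length (forest_code (ts @ fs) F)"
        using card_unvisited_Un[of A N X] A 3(5) that by simp
      then show ?thesis
        unfolding W g_def using 3(2,3,4) st finA A that by (intro 3(1)) auto
    qed
    ultimately show ?thesis by simp
  qed
  have "(\<Sum>E\<in>Pow (pairs (set st \<union> ?U)). f E) = (\<Sum>E\<in>Pow (star v ?W \<union> pairs ?W). f E)"
    using pairs_insert[OF v] st by simp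
  also have "\<dots> = (\<Sum>E\<in>Pow (star v ?W). \<Sum>E'\<in>Pow (pairs ?W). f (E \<union> E'))"
    by (intro sum_Pow_Un star_pairs_disjoint v) (simp_all add: star_def)
  also have "\<dots> = (\<Sum>C\<in>Pow (?U \<union> set st'). \<Sum>E'\<in>Pow (pairs ?W). f (star v C \<union> E'))"
    by (simp only: sum_Pow_star Un_commute[of ?U])
  also have "\<dots> = (\<Sum>A\<in>Pow ?U. \<Sum>B\<in>Pow (set st'). \<Sum>E'\<in>Pow (pairs ?W). f (star v (A \<union> B) \<union> E'))"
    using disj by (intro sum_Pow_Un) auto
  also have "\<dots> = (\<Sum>A\<in>Pow ?U. \<Sum>B\<in>Pow (set st'). (if card A = ?k then t ^ ?k * g else 0) * t ^ card B)"
    using inner by (intro sum.cong refl)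
  also have "\<dots> = (\<Sum>A\<in>Pow ?U. if card A = ?k then t ^ ?k * g else 0) * (1 + t) ^ card (set st')"
    by (simp add: sum_distrib_left[symmetric] sum_distrib_right[symmetric] sum_Pow_card)
  also have "card (set st') = length fs" using 3(2,4) st distinct_card[of st'] by simp
  also have "(\<Sum>A\<in>Pow ?U. if card A = ?k then t ^ ?k * g else 0) = real (card {A \<in> Pow ?U. card A = ?k}) * (t ^ ?k * g)"
    by (simp add: sum.If_cases Int_def)
  also have "card {A \<in> Pow ?U. card A = ?k} = card ?U choose ?k"
    using n_subsets[of ?U ?k] by (simp add: Pow_def)
  finally show ?case using 3(5) by (simp add: f_def g_def mult_ac)
qed

text \<open>On a fibre of \<open>Psi\<close> the number of components is constant, so the power of q
  can be taken out.\<close>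

lemma sum_Psi_eq_graph_weight:
  assumes "T # F \<in> plane_forests (Suc n)"
  shows "(\<Sum>G | G \<in> labeled_graphs (Suc n) \<and> Psi (Suc n) G = T # F. q ^ (num_comps {1..Suc n} G - 1) * t ^ card G)
    = q ^ length F * graph_weight [T] F"
proof -
  let ?N = "Suc n"
  have pairs: "labeled_graphs ?N = Pow (pairs {1..?N})"
    by (simp add: labeled_graphs_def complete_edges_def pairs_def)
  have "(\<Sum>G | G \<in> labeled_graphs ?N \<and> Psi ?N G = T # F. q ^ (num_comps {1..?N} G - 1) * t ^ card G) =
      (\<Sum>G | G \<in> labeled_graphs ?N \<and> Psi ?N G = T # F. q ^ length F * t ^ card G)"
    using num_comps_eq_length_Psi[of _ ?N] by (intro sum.cong refl) (auto simp: labeled_graphs_def)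
  also have "\<dots> = q ^ length F * (\<Sum>G | G \<in> labeled_graphs ?N \<and> Psi ?N G = T # F. t ^ card G)"
    by (simp add: sum_distrib_left)
  also have "(\<Sum>G | G \<in> labeled_graphs ?N \<and> Psi ?N G = T # F. t ^ card G) =
      (\<Sum>G\<in>labeled_graphs ?N. if Psi ?N G = T # F then t ^ card G else 0)"
    by (subst sum.inter_filter[symmetric]) auto
  also have "\<dots> = (\<Sum>G\<in>labeled_graphs ?N. if nfs_forest ?N G {} [] = T # F then t ^ card G else 0)"
    using Psi_eq_nfs_forest[of _ ?N] by (intro sum.cong refl) (simp add: labeled_graphs_def)
  also have "\<dots> = graph_weight [] (T # F)"
    using sum_graph_weight[of "[]" "{}" "[]" ?N "T # F"] assms length_forest_code[of "[]" "T # F"]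
    unfolding pairs by (simp add: plane_forests_def)
  finally show ?thesis by simp
qed

text \<open>\<open>graph_weight\<close> still has to charge the pairs within the present stack,
  which the volume charged when the nodes were positioned; hence the exponent
  \<open>length st choose 2\<close>, which is 0 for a single root. The binomial coefficients combine
  the factors 1/k! into one factorial, and each root absorbs one power of q.\<close>

lemma graph_weight_eq_cell_volume:
  "graph_weight st F * q ^ length F =
     fact (length (forest_code st F)) * q ^ length (forest_code st F) * (1 + t) ^ (length st choose 2) * cell_volume st F"
proof (induction st F rule: graph_weight.induct)
  case 1
  then show ?case by (simp add: numeral_2_eq_2)
next
  case (2 T F)
  have "forest_size (T # F) = Suc (length (forest_code [T] F))"
    using length_forest_code[of "[T]" F] by simp
  then show ?case using 2 by (simp add: field_simps numeral_2_eq_2 del: of_nat_Suc)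
next
  case (3 ts st F)
  define k where "k = length ts"
  define s where "s = length st"
  define l where "l = length (forest_code (ts @ st) F)"
  define V where "V = cell_volume (ts @ st) F"
  have IH: "graph_weight (ts @ st) F * q ^ length F = fact l * q ^ l * (1 + t) ^ ((k + s) choose 2) * V"
    using 3 by (simp add: l_def k_def s_def V_def)
  have "(k + l) choose k = fact (k + l) / (fact k * fact l :: real)"
    by (simp add: binomial_fact)
  then have binom: "real ((k + l) choose k) * fact l = fact (k + l) / fact k" by simp
  \<comment> \<open>Pairs of \<open>v\<close> with the stack below it and pairs in the new stack,
    against pairs in the old stack and pairs of a child with an entry below it.\<close>
  have expo: "s + ((k + s) choose 2) = (Suc s choose 2) + (\<Sum>i<k. s + i)"
  proof (induction k)
    case 0
    then show ?case by (simp add: numeral_2_eq_2)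
  next
    case (Suc k)
    then show ?case by (simp add: numeral_2_eq_2)
  qed
  have "graph_weight (Node ts # st) F * q ^ length F =
      real ((k + l) choose k) * t ^ k * (1 + t) ^ s * (graph_weight (ts @ st) F * q ^ length F)"
    by (simp add: k_def l_def s_def mult_ac)
  also have "\<dots> = (real ((k + l) choose k) * fact l) * t ^ k * q ^ l * ((1 + t) ^ s * (1 + t) ^ ((k + s) choose 2)) * V"
    unfolding IH by (simp add: mult_ac)
  also have "\<dots> = fact (k + l) / fact k * t ^ k * q ^ l * ((1 + t) ^ (Suc s choose 2) * (1 + t) ^ (\<Sum>i<k. s + i)) * V"
    unfolding binom by (simp only: power_add[symmetric] expo)
  also have "\<dots> = fact (k + l) * q ^ (k + l) * (1 + t) ^ (Suc s choose 2) * ((t / q) ^ k / fact k * (1 + t) ^ (\<Sum>i<k. s + i) * V)"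
    using q_pos by (simp add: power_divide power_add)
  finally show ?case by (simp add: k_def l_def s_def V_def)
qed

end

section \<open>The closed form\<close>

abbreviation degrees :: "pforest \<Rightarrow> nat list" where
  "degrees F \<equiv> concat (map degree_seq F)"

lemma length_degree_seq: "length (degree_seq T) = node_count T"
proof (induction T)
  case (Node ts)
  then show ?case by (simp add: length_concat comp_def cong: map_cong)
qed

lemma sum_list_degree_seq: "Suc (sum_list (degree_seq T)) = node_count T"
proof (induction T)
  case (Node ts)
  have "sum_list (degrees ts) + length ts = forest_size ts"
    using Node by (induction ts) force+
  then show ?case by simp
qed

text \<open>The last node in preorder is a leaf, so deleting the final entry changes neither sums
  nor products of factorials.\<close>

lemma degree_seq_butlast: "degree_seq T = butlast (degree_seq T) @ [0]"
proof (induction T)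
  case (Node ts)
  show ?case
  proof (cases ts rule: rev_cases)
    case (snoc us U)
    then have "degree_seq U = butlast (degree_seq U) @ [0]" using Node by simp
    then obtain ds where "degree_seq U = ds @ [0]" by blast
    then show ?thesis unfolding snoc by (simp add: butlast_append)
  qed simp
qed

lemma sum_list_degrees: "sum_list (degrees F) + length F = forest_size F"
proof (induction F)
  case (Cons T F)
  then show ?case using sum_list_degree_seq[of T] by simp
qed simp

lemma reduced_degree_seq_Nil [simp]: "reduced_degree_seq [] = []"
  by (simp add: reduced_degree_seq_def)

lemma reduced_degree_seq_Cons:
  "reduced_degree_seq (T # F) = butlast (degree_seq T) @ reduced_degree_seq F"
  by (simp add: reduced_degree_seq_def)

lemma length_reduced: "length (reduced_degree_seq F) + length F = forest_size F"
proof (induction F)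
  case (Cons T F)
  obtain k where "node_count T = Suc k" by (cases T) simp
  then show ?case using Cons by (simp add: reduced_degree_seq_Cons length_degree_seq)
qed simp

lemma sum_list_reduced: "sum_list (reduced_degree_seq F) = sum_list (degrees F)"
proof (induction F)
  case (Cons T F)
  have "sum_list (degree_seq T) = sum_list (butlast (degree_seq T))"
    by (subst degree_seq_butlast) simp
  then show ?case using Cons by (simp add: reduced_degree_seq_Cons)
qed simp

lemma prod_list_fact_reduced:
  "prod_list (map fact (reduced_degree_seq F)) = (prod_list (map fact (degrees F)) :: real)"
proof (induction F)
  case (Cons T F)
  have "prod_list (map fact (degree_seq T)) = (prod_list (map fact (butlast (degree_seq T))) :: real)"
    by (subst degree_seq_butlast) simp
  then show ?case using Cons by (simp add: reduced_degree_seq_Cons)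
qed simp

text \<open>Every entry is counted once for each suffix that contains it, so its weight is its
  position, starting from 1.\<close>

primrec weighted_sum :: "nat list \<Rightarrow> nat" where
  "weighted_sum [] = 0"
| "weighted_sum (x # xs) = x + sum_list xs + weighted_sum xs"

lemma weighted_sum_append: "weighted_sum (xs @ ys) = weighted_sum xs + weighted_sum ys + length xs * sum_list ys"
  by (induction xs) auto

lemma weighted_sum_conv_sum: "weighted_sum xs = (\<Sum>i<length xs. Suc i * xs ! i)"
proof (induction xs)
  case (Cons x xs)
  have "(\<Sum>i<length (x # xs). Suc i * (x # xs) ! i) = x + (\<Sum>i<length xs. Suc (Suc i) * xs ! i)"
    by (simp add: sum.lessThan_Suc_shift del: sum.lessThan_Suc)
  also have "(\<Sum>i<length xs. Suc (Suc i) * xs ! i) = (\<Sum>i<length xs. Suc i * xs ! i) + (\<Sum>i<length xs. xs ! i)"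
    by (simp add: sum.distrib algebra_simps)
  also have "(\<Sum>i<length xs. xs ! i) = sum_list xs"
    by (simp add: sum_list_sum_nth atLeast0LessThan)
  finally show ?case using Cons by simp
qed simp

text \<open>The exponent of 1 + t in \<open>graph_weight\<close>.\<close>

fun stack_sum :: "pforest \<Rightarrow> pforest \<Rightarrow> nat" where
  "stack_sum [] [] = 0"
| "stack_sum [] (T # F) = stack_sum [T] F"
| "stack_sum (Node ts # st) F = length st + stack_sum (ts @ st) F"

lemma stack_sum_split: "stack_sum st F = stack_sum st [] + stack_sum [] F"
proof (induction st "[] :: pforest" rule: stack_sum.induct)
  case (3 ts st)
  then show ?case by simp
qed auto

text \<open>Nodes become active in preorder, so one step removes the first degree. The entries left
  on the stack, the children of the active node and the degrees still to come add up to the number M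
  of nodes left, and M + (M choose 2) = (M + 1) choose 2.\<close>

lemma stack_sum_weighted_sum: "stack_sum st [] + weighted_sum (degrees st) = forest_size st choose 2"
proof (induction st "[] :: pforest" rule: stack_sum.induct)
  case (3 ts st)
  then show ?case using sum_list_degrees[of "ts @ st"] by (simp add: numeral_2_eq_2)
qed (auto simp: numeral_2_eq_2)

lemma choose_two_add: "Suc (a + b) choose 2 = (Suc a choose 2) + (Suc b choose 2) + a * b"
  by (induction a) (auto simp: numeral_2_eq_2)

text \<open>The identity for one tree is added up over the components. Putting b entries in front
  shifts all later weights by b, and as the L reduced degrees of the rest sum to L, this costs b L,
  the mixed term of \<open>choose_two_add\<close>.\<close>

lemma stack_sum_reduced:
  "stack_sum [] F + weighted_sum (reduced_degree_seq F) = Suc (length (reduced_degree_seq F)) choose 2"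
proof (induction F)
  case (Cons T F)
  define b where "b = length (butlast (degree_seq T))"
  define L where "L = length (reduced_degree_seq F)"
  have b: "node_count T = Suc b" using sum_list_degree_seq[of T] by (auto simp: b_def length_degree_seq)
  have "weighted_sum (degree_seq T) = weighted_sum (butlast (degree_seq T))"
    by (subst degree_seq_butlast) (simp add: weighted_sum_append)
  then have T: "stack_sum [T] [] + weighted_sum (butlast (degree_seq T)) = Suc b choose 2"
    using stack_sum_weighted_sum[of "[T]"] b by simp
  have L: "sum_list (reduced_degree_seq F) = L"
    using sum_list_reduced[of F] sum_list_degrees[of F] length_reduced[of F] by (simp add: L_def)
  have "stack_sum [] (T # F) = stack_sum [T] [] + stack_sum [] F"
    using stack_sum_split[of "[T]" F] by simp
  moreover have "weighted_sum (reduced_degree_seq (T # F)) =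
      weighted_sum (butlast (degree_seq T)) + weighted_sum (reduced_degree_seq F) + b * L"
    unfolding reduced_degree_seq_Cons weighted_sum_append L b_def by simp
  moreover have "length (reduced_degree_seq (T # F)) = b + L"
    by (simp add: reduced_degree_seq_Cons b_def L_def)
  ultimately show ?case using T Cons choose_two_add[of b L] by (simp add: L_def)
qed (simp add: numeral_2_eq_2)

text \<open>Applied to the forest without its first tree, it is the product over j from 2 to m in
  the closed form.\<close>

primrec hook_product :: "pforest \<Rightarrow> nat" where
  "hook_product [] = 1"
| "hook_product (T # F) = forest_size (T # F) * hook_product F"

lemma hook_product_eq_prod: "hook_product F = (\<Prod>j<length F. forest_size (drop j F))"
proof (induction F)
  case (Cons T F)
  then show ?case by (simp add: prod.lessThan_Suc_shift del: prod.lessThan_Suc)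
qed simp

lemma sum_node_count_eq_forest_size:
  "1 \<le> j \<Longrightarrow> (\<Sum>i = j..length F. node_count (F ! (i - 1))) = forest_size (drop (j - 1) F)"
proof (induction F arbitrary: j)
  case (Cons T F)
  show ?case
  proof (cases "j = 1")
    case True
    have "(\<Sum>i = 1..length (T # F). node_count ((T # F) ! (i - 1))) = node_count T + (\<Sum>i = 2..Suc (length F). node_count ((T # F) ! (i - 1)))"
      by (subst sum.atLeast_Suc_atMost) (simp_all add: numeral_2_eq_2)
    also have "(\<Sum>i = 2..Suc (length F). node_count ((T # F) ! (i - 1))) = (\<Sum>i = 1..length F. node_count ((T # F) ! i))"
      using sum.shift_bounds_cl_Suc_ivl[of "\<lambda>i. node_count ((T # F) ! (i - 1))" 1 "length F"] by (simp add: numeral_2_eq_2)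
    also have "\<dots> = (\<Sum>i = 1..length F. node_count (F ! (i - 1)))"
      by (intro sum.cong) auto
    finally show ?thesis using Cons.IH[of 1] True by simp
  next
    case False
    then obtain k where k: "j = Suc k" "1 \<le> k" using Cons.prems by (cases j) auto
    have "(\<Sum>i = j..length (T # F). node_count ((T # F) ! (i - 1))) = (\<Sum>i = k..length F. node_count ((T # F) ! i))"
      using sum.shift_bounds_cl_Suc_ivl[of "\<lambda>i. node_count ((T # F) ! (i - 1))" k "length F"] k by simp
    also have "\<dots> = (\<Sum>i = k..length F. node_count (F ! (i - 1)))"
      using k by (intro sum.cong) auto
    also have "\<dots> = forest_size (drop (k - 1) F)" using Cons.IH k by simp
    also have "\<dots> = forest_size (drop (j - 1) (T # F))" using k by (cases k) auto
    finally show ?thesis .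
  qed
qed simp

lemma hook_product_tail:
  "real (hook_product F) = (\<Prod>j = 2..Suc (length F). real (\<Sum>i = j..Suc (length F). node_count ((T # F) ! (i - 1))))"
proof -
  have "(\<Prod>j = 2..Suc (length F). real (\<Sum>i = j..Suc (length F). node_count ((T # F) ! (i - 1)))) =
      (\<Prod>j = 2..Suc (length F). real (forest_size (drop (j - 1) (T # F))))"
  proof (intro prod.cong refl)
    fix j assume "j \<in> {2..Suc (length F)}"
    then show "real (\<Sum>i = j..Suc (length F). node_count ((T # F) ! (i - 1))) = real (forest_size (drop (j - 1) (T # F)))"
      using sum_node_count_eq_forest_size[of j "T # F"] by simp
  qed
  \<comment> \<open>Component \<open>j\<close> of \<open>T # F\<close>, counted from 1, is entry
    \<open>j - 2\<close> of \<open>F\<close>, counted from 0.\<close>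
  also have "\<dots> = (\<Prod>j<length F. real (forest_size (drop j F)))"
    by (rule prod.reindex_bij_witness[where i = "\<lambda>j. j + 2" and j = "\<lambda>j. j - 2"])
       (auto simp: numeral_2_eq_2 drop_Cons')
  finally show ?thesis by (simp add: hook_product_eq_prod)
qed

context tutte_parameters
begin

text \<open>The binomial coefficients telescope to a multinomial coefficient, because (k + l choose
  k) l! = (k + l)! / k!. At a root the factorial jumps from l! to (l + 1)!, and the new factor l + 1
  of \<open>hook_product\<close> compensates.\<close>

lemma graph_weight_closed_form:
  "graph_weight st F = fact (length (forest_code st F)) / prod_list (map fact (degrees (st @ F))) / real (hook_product F)
     * t ^ sum_list (degrees (st @ F)) * (1 + t) ^ stack_sum st F"
proof (induction st F rule: graph_weight.induct)
  case 1
  then show ?case by simp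
next
  case (2 T F)
  define l where "l = length (forest_code [T] F)"
  have size: "forest_size (T # F) = Suc l"
    using length_forest_code[of "[T]" F] by (simp add: l_def)
  have hook: "hook_product (T # F) = Suc l * hook_product F"
    unfolding hook_product.simps size ..
  have len: "length (forest_code [] (T # F)) = Suc l" by (simp add: l_def)
  have "fact (Suc l) / x / real (Suc l * h) = fact l / x / real h" for x :: real and h :: nat
    unfolding fact_Suc of_nat_mult by (simp add: mult.left_commute del: of_nat_Suc)
  then show ?case using 2 unfolding len hook by (simp add: l_def)
next
  case (3 ts st F)
  define k where "k = length ts"
  define l where "l = length (forest_code (ts @ st) F)"
  have len: "length (forest_code (Node ts # st) F) = k + l" by (simp add: k_def l_def)
  have "(k + l) choose k = fact (k + l) / (fact k * fact l :: real)"
    by (simp add: binomial_fact)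
  then show ?case using 3 unfolding graph_weight.simps len by (simp add: k_def l_def power_add mult_ac)
qed

end

context tutte_parameters
begin

lemma sum_Psi_closed_form:
  assumes F: "F \<in> plane_forests (n + 1)"
  defines "m \<equiv> length F" and "d \<equiv> \<lambda>i. reduced_degree_seq F ! (i - 1)"
  shows "(\<Sum>G | G \<in> labeled_graphs (n + 1) \<and> Psi (n + 1) G = F. q ^ (num_comps {1..n + 1} G - 1) * t ^ card G)
    = (fact n / (\<Prod>i = 1..n + 1 - m. fact (d i)))
      / (\<Prod>j = 2..m. real (\<Sum>i = j..m. node_count (F ! (i - 1))))
      * q ^ (m - 1) * t ^ (\<Sum>i = 1..n + 1 - m. d i)
      * (1 + t) powi (int ((n + 2 - m) choose 2) - int (\<Sum>i = 1..n + 1 - m. i * d i))"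
proof -
  obtain T F' where TF: "F = T # F'" using F by (cases F) (auto simp: plane_forests_def)
  let ?R = "reduced_degree_seq F"
  have size: "forest_size F = n + 1" using F by (simp add: plane_forests_def)
  have len: "length ?R = n + 1 - m" using length_reduced[of F] size by (simp add: m_def)
  have m: "m = Suc (length F')" "m \<le> n + 1"
    using length_reduced[of F] size by (simp_all add: m_def TF)
  have code: "length (forest_code [T] F') = n"
    using length_forest_code[of "[T]" F'] size by (simp add: TF)
  have shift: "bij_betw Suc {..<n + 1 - m} {1..n + 1 - m}"
    by (simp add: bij_betw_def image_Suc_lessThan)
  have facts: "prod_list (map fact (degrees F)) = (\<Prod>i = 1..n + 1 - m. fact (d i) :: real)"
  proof -
    have "prod_list (map fact ?R) = (\<Prod>i<n + 1 - m. fact (?R ! i) :: real)"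
      by (simp add: prod.list_conv_set_nth len atLeast0LessThan)
    also have "\<dots> = (\<Prod>i = 1..n + 1 - m. fact (d i))"
      using prod.reindex_bij_betw[OF shift, of "\<lambda>i. fact (d i) :: real"] by (simp add: d_def)
    finally show ?thesis by (simp only: prod_list_fact_reduced)
  qed
  have degs: "sum_list (degrees F) = (\<Sum>i = 1..n + 1 - m. d i)"
  proof -
    have "sum_list ?R = (\<Sum>i<n + 1 - m. ?R ! i)"
      by (simp add: sum_list_sum_nth len atLeast0LessThan)
    also have "\<dots> = (\<Sum>i = 1..n + 1 - m. d i)"
      using sum.reindex_bij_betw[OF shift, of d] by (simp add: d_def)
    finally show ?thesis by (simp only: sum_list_reduced)
  qed
  have "weighted_sum ?R = (\<Sum>i = 1..n + 1 - m. i * d i)"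
    using sum.reindex_bij_betw[OF shift, of "\<lambda>i. i * d i"] by (simp add: weighted_sum_conv_sum len d_def)
  moreover have "Suc (length ?R) = n + 2 - m" using len m by simp
  moreover have "stack_sum [] F = stack_sum [T] F'" by (simp add: TF)
  ultimately have "stack_sum [T] F' + (\<Sum>i = 1..n + 1 - m. i * d i) = (n + 2 - m) choose 2"
    using stack_sum_reduced[of F] by (simp only:)
  then have "int (stack_sum [T] F') + int (\<Sum>i = 1..n + 1 - m. i * d i) = int ((n + 2 - m) choose 2)"
    by (simp only: of_nat_add[symmetric])
  then have "int (stack_sum [T] F') = int ((n + 2 - m) choose 2) - int (\<Sum>i = 1..n + 1 - m. i * d i)"
    by linarith
  \<comment> \<open>The exponent in the claim is a difference of integers; it equals
    \<open>stack_sum\<close>, so it is nonnegative and the integer power is an ordinary one.\<close>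
  then have expo: "(1 + t) ^ stack_sum [T] F' = (1 + t) powi (int ((n + 2 - m) choose 2) - int (\<Sum>i = 1..n + 1 - m. i * d i))"
    by (metis power_int_of_nat)
  have hook: "real (hook_product F') = (\<Prod>j = 2..m. real (\<Sum>i = j..m. node_count (F ! (i - 1))))"
    using hook_product_tail[of F' T] by (simp only: TF m(1))
  have "(\<Sum>G | G \<in> labeled_graphs (n + 1) \<and> Psi (n + 1) G = F. q ^ (num_comps {1..n + 1} G - 1) * t ^ card G)
      = q ^ (m - 1) * graph_weight [T] F'"
    using sum_Psi_eq_graph_weight[of T F' n] F by (simp add: TF m(1))
  also have "graph_weight [T] F' = fact n / prod_list (map fact (degrees F)) / real (hook_product F')
      * t ^ sum_list (degrees F) * (1 + t) ^ stack_sum [T] F'"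
    using graph_weight_closed_form[of "[T]" F'] code by (simp add: TF)
  finally show ?thesis
    unfolding facts degs hook expo by (simp add: mult_ac)
qed

end

section \<open>The subdivision and the volume of the Tutte polytope\<close>

context tutte_space
begin

lemma measure_forest_cell_pos: "F \<in> plane_forests (n + 1) \<Longrightarrow> 0 < measure lborel (forest_cell F)"
proof -
  assume F: "F \<in> plane_forests (n + 1)"
  obtain T F' where TF: "F = T # F'" using F by (cases F) (auto simp: plane_forests_def)
  then show ?thesis using measure_forest_cell[of T F'] F q_pos cell_volume_pos by simp
qed

lemma fact_measure_forest_cell:
  assumes F: "F \<in> plane_forests (n + 1)"
  shows "fact n * measure lborel (forest_cell F) =
    (\<Sum>G | G \<in> labeled_graphs (n + 1) \<and> Psi (n + 1) G = F. q ^ (num_comps {1..n + 1} G - 1) * t ^ card G)"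
proof -
  obtain T F' where TF: "F = T # F'" using F by (cases F) (auto simp: plane_forests_def)
  have code: "length (forest_code [T] F') = n"
    using length_forest_code[of "[T]" F'] F by (simp add: TF plane_forests_def)
  have "(\<Sum>G | G \<in> labeled_graphs (n + 1) \<and> Psi (n + 1) G = F. q ^ (num_comps {1..n + 1} G - 1) * t ^ card G)
      = q ^ length F' * graph_weight [T] F'"
    using sum_Psi_eq_graph_weight[of T F' n] F by (simp add: TF)
  also have "\<dots> = fact n * q ^ n * cell_volume [T] F'"
    using graph_weight_eq_cell_volume[of "[T]" F'] code by (simp add: mult.commute numeral_2_eq_2)
  finally show ?thesis using measure_forest_cell[of T F'] F by (simp add: TF)
qed

text \<open>Equal cells of different forests would intersect in a set of positive volume.\<close>

lemma inj_on_forest_cell: "inj_on forest_cell (plane_forests (n + 1))"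
proof (rule inj_onI, rule ccontr)
  fix F G assume F: "F \<in> plane_forests (n + 1)" and G: "G \<in> plane_forests (n + 1)"
    and eq: "forest_cell F = forest_cell G" and "F \<noteq> G"
  then have "negligible (forest_cell F)" using negligible_forest_cell_Int[OF F G] by simp
  then have "measure lebesgue (forest_cell F) = 0" by (simp add: negligible_imp_measure0)
  then have "measure lborel (forest_cell F) = 0"
    using borel_polytope[OF polytope_forest_cell[OF F]] by simp
  then show False using measure_forest_cell_pos[OF F] by simp
qed

lemma subdivision_T: "subdivision (forest_cell ` plane_forests (n + 1)) (in_space n e (T_polytope n q t))"
  unfolding subdivision_def
proof (intro conjI ballI)
  show "polytope (in_space n e (T_polytope n q t))" by (rule polytope_T)
  show "finite (forest_cell ` plane_forests (n + 1))" using finite_plane_forests by blast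
  show "\<Union> (forest_cell ` plane_forests (n + 1)) = in_space n e (T_polytope n q t)" by (rule Union_forest_cell)
  fix Q assume "Q \<in> forest_cell ` plane_forests (n + 1)"
  then obtain F where F: "F \<in> plane_forests (n + 1)" "Q = forest_cell F" by blast
  then show P: "polytope Q" using polytope_forest_cell by simp
  show "aff_dim Q = int DIM(real ^ 'n)"
    using full_dimensional_polytope[of Q] P polytope_imp_convex[OF P] borel_polytope[OF P] measure_forest_cell_pos F
    by simp
next
  show "pairwise (\<lambda>Q R. interior Q \<inter> interior R = {}) (forest_cell ` plane_forests (n + 1))"
  proof (rule pairwiseI, elim imageE)
    fix Q R F G assume FG: "F \<in> plane_forests (n + 1)" "G \<in> plane_forests (n + 1)" "Q = forest_cell F" "R = forest_cell G" "Q \<noteq> R"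
    then have "negligible (Q \<inter> R)" using negligible_forest_cell_Int[of F G] by auto
    then have "negligible (interior Q \<inter> interior R)"
      by (rule negligible_subset) (use interior_subset in blast)
    \<comment> \<open>An open negligible set is empty.\<close>
    then show "interior Q \<inter> interior R = {}"
      using open_not_negligible[of "interior Q \<inter> interior R"] by blast
  qed
qed

lemma measure_T:
  "measure lborel (in_space n e (T_polytope n q t)) = (\<Sum>F\<in>plane_forests (n + 1). measure lborel (forest_cell F))"
proof -
  have borel: "forest_cell F \<in> sets borel" if "F \<in> plane_forests (n + 1)" for F
    using borel_polytope[OF polytope_forest_cell[OF that]] .
  have "measure lebesgue (\<Union> (forest_cell ` plane_forests (n + 1))) =
      (\<Sum>F\<in>plane_forests (n + 1). measure lebesgue (forest_cell F))"
  proof (rule measure_negligible_finite_Union_image)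
    show "finite (plane_forests (n + 1))" by (rule finite_plane_forests)
    show "forest_cell F \<in> lmeasurable" if "F \<in> plane_forests (n + 1)" for F
      using polytope_forest_cell[OF that] polytope_imp_compact lmeasurable_compact by blast
    show "pairwise (\<lambda>F G. negligible (forest_cell F \<inter> forest_cell G)) (plane_forests (n + 1))"
      using negligible_forest_cell_Int by (auto simp: pairwise_def)
  qed
  also have "\<dots> = (\<Sum>F\<in>plane_forests (n + 1). measure lborel (forest_cell F))"
    using borel by (intro sum.cong refl) simp
  finally show ?thesis
    using borel_polytope[OF polytope_T] unfolding Union_forest_cell by simp
qed

text \<open>The fibres of \<open>Psi\<close> partition the labeled graphs.\<close>

lemma fact_measure_T:
  "fact n * measure lborel (in_space n e (T_polytope n q t)) =
    (\<Sum>G\<in>labeled_graphs (n + 1). q ^ (num_comps {1..n + 1} G - 1) * t ^ card G)"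
proof -
  have "fact n * measure lborel (in_space n e (T_polytope n q t)) =
      (\<Sum>F\<in>plane_forests (n + 1). fact n * measure lborel (forest_cell F))"
    unfolding measure_T by (simp add: sum_distrib_left)
  also have "\<dots> = (\<Sum>F\<in>plane_forests (n + 1). \<Sum>G | G \<in> labeled_graphs (n + 1) \<and> Psi (n + 1) G = F.
      q ^ (num_comps {1..n + 1} G - 1) * t ^ card G)"
    by (intro sum.cong refl fact_measure_forest_cell)
  also have "\<dots> = (\<Sum>G\<in>labeled_graphs (n + 1). q ^ (num_comps {1..n + 1} G - 1) * t ^ card G)"
    using Psi_in_plane_forests by (intro sum.group finite_plane_forests finite_labeled_graphs) blast
  finally show ?thesis .
qed

end

theorem theorem7p3:
  fixes n :: nat and q t :: real and e :: "nat \<Rightarrow> 'n::finite"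
    and D :: "pforest \<Rightarrow> (real ^ 'n) set" and T :: "(real ^ 'n) set"
  assumes "1 \<le> n" and "0 < q" and "q \<le> 1" and "0 < t"
    and "bij_betw e {1..n} (UNIV :: 'n set)"
    and "D = (\<lambda>F. in_space n e (forest_polytope q t F))"
    and "T = in_space n e (T_polytope n q t)"
  shows
    "(\<forall>F \<in> plane_forests (n + 1).
        let m = length F;
            a = (\<lambda>j. node_count (F ! (j - 1)));
            d = (\<lambda>i. reduced_degree_seq F ! (i - 1))
        in polytope (D F) \<and> bounded (D F) \<and>
           fact n * measure lborel (D F)
             = (\<Sum>G | G \<in> labeled_graphs (n + 1) \<and> Psi (n + 1) G = F.
                  q ^ (num_comps {1..n + 1} G - 1) * t ^ card G) \<and>
           (\<Sum>G | G \<in> labeled_graphs (n + 1) \<and> Psi (n + 1) G = F.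
                  q ^ (num_comps {1..n + 1} G - 1) * t ^ card G)
             = (fact n / (\<Prod>i = 1..n + 1 - m. fact (d i)))
                 / (\<Prod>j = 2..m. real (\<Sum>i = j..m. a i))
                 * q ^ (m - 1)
                 * t ^ (\<Sum>i = 1..n + 1 - m. d i)
                 * (1 + t) powi (int ((n + 2 - m) choose 2)
                                   - int (\<Sum>i = 1..n + 1 - m. i * d i)))
     \<and> inj_on D (plane_forests (n + 1))
     \<and> subdivision (D ` plane_forests (n + 1)) T
     \<and> fact n * measure lborel T
         = (\<Sum>G \<in> labeled_graphs (n + 1). q ^ (num_comps {1..n + 1} G - 1) * t ^ card G)
     \<and> (\<Sum>G \<in> labeled_graphs (n + 1). q ^ (num_comps {1..n + 1} G - 1) * t ^ card G)
         = Z_poly {1..n + 1} (complete_edges (n + 1)) q t"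
proof -
  interpret tutte_space q t n e
    by standard (use assms in auto)
  \<comment> \<open>The complete graph has one component, and its spanning subgraphs are the labeled
    graphs.\<close>
  have "(\<Sum>G \<in> labeled_graphs (n + 1). q ^ (num_comps {1..n + 1} G - 1) * t ^ card G)
      = Z_poly {1..n + 1} (complete_edges (n + 1)) q t"
    using num_comps_complete[of "n + 1"] by (simp add: Z_poly_def labeled_graphs_def)
  then show ?thesis
    unfolding assms(6,7) Let_def
    using polytope_forest_cell polytope_imp_bounded fact_measure_forest_cell sum_Psi_closed_form
      inj_on_forest_cell subdivision_T fact_measure_T
    by (intro conjI ballI) blast+
qed

end
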